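(* Let $f,g$ satisfy Assumption (CPSO) and let $(x^*,u^* )\in\mathcal M\times\Omega$ be a point at which (RPD-ii) and (ND) hold. Then for every $\alpha\in[\underline\alpha,\overline\alpha]$, $$\rho\big(D_x\mathcal A_\alpha(x^*,u^* )\,\Pi(x^* )\big)<1 .$$ If in addition (RPD-i) holds at $(x^*,u^* )$, let $\psi:U\to\mathcal M$ be the local solution map around $u^*$. Then for every $\alpha\in[\underline\alpha,\overline\alpha]$, after possibly shrinking the neighbourhood $U$ of $u^*$, for all $u\in U$ the point $x:=\psi(u)$ satisfies $x=\mathcal A_\alpha(x,u)$ and $$D\psi(u)=\big(I-D_x\mathcal A_\alpha(x,u)\,\Pi(x)\big)^{-1}D_u\mathcal A_\alpha(x,u).$$
   Context: $\mathcal X,\mathcal U$ are finite-dimensional Euclidean spaces, $\mathcal M\subset\mathcal X$ is a $C^2$-smooth embedded submanifold, $\Omega\subset\mathcal U$ is open. $T_x\mathcal M$, $N_x\mathcal M=(T_x\mathcal M)^\perp$ are the tangent and normal spaces, $\Pi(x)$, $\Pi^\perp(x)$ the orthogonal projections onto them. A linear operator defined on a subspace is extended to the whole space by composing it with the orthogonal projection onto that subspace; $\dagger$ is the pseudoinverse; $\rho$ is the spectral radius. Riemannian derivatives: for a function $h$ whose restriction to $\mathcal M$ is $C^2$ with $C^2$ extension $\tilde h$ near $x\in\mathcal M$, $\nabla_{\mathcal M}h(x)=\Pi(x)\nabla\tilde h(x)$ and $\nabla^2_{\mathcal M}h(x)=\Pi(x)\nabla^2\tilde h(x)+\mathfrak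 W_x(\cdot,\Pi^\perp(x)\nabla\tilde h(x))$ on $T_x\mathcal M$, where for $w\in N_x\mathcal M$ the Weingarten map $\mathfrak W_x(\cdot,w):T_x\mathcal M\to T_x\mathcal M$ is $v\mapsto-\Pi(x)\,\mathrm dW[v]$ with $W$ any local extension of $w$ to a normal vector field on $\mathcal M$. For $h(x,u)$, $\nabla_{\mathcal M}h,\nabla^2_{\mathcal M}h$ are taken in $x$ with $u$ fixed, and $D_u$ is the partial derivative in $u$. Partial smoothness: a proper lower semicontinuous $h$ is partly smooth at $x\in\mathcal M$ relative to $\mathcal M$ if $h$ is (Clarke/Rockafellar–Wets) regular at all points near $x$ and $\partial h(x)\ne\emptyset$; $\mathcal M$ is a $C^2$ manifold and $h|_{\mathcal M}$ is $C^2$ around $x$; $N_x\mathcal M=\mathrm{par}\,\partial h(x)$ (subspace parallel to the affine hull); and $\partial h$ is continuous at $x$ relative to $\mathcal M$. It is partly smooth relative to $\mathcal M$ if this holds at every $x\in\mathcal M$. Assumption (CPSO): $f:\mathcal X\times\mathcal U\to\mathbb R$ is $C^2$; $g:\mathcal X\times\mathcal U\to\overline{\mathbb R}$ is partly smooth relative to $\mathcal M\times\Omega$; for each $u\in\Omega$, $f(\cdot,u)$ and $g(\cdot,u)$ are convex and $\nabla_xf(\cdot,u)$ is $L$-Lipschitz. $F:=f+g$; $\partial_x$ is the convex subdifferential in $x$. Conditions at a point $(x^*,u^* )\in\mathcal M\times\Omega$: (RPD-i) $\nabla^2_{\mathcal M}F(x^*,u^* )$ is positive definite on $T_{x^*}\mathcal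 M$; (RPD-ii) $\Pi(x^* )\nabla_x^2f(x^*,u^* )|_{T_{x^*}\mathcal M}$ is positive definite on $T_{x^*}\mathcal M$; (ND) $0\in\mathrm{ri}\,\partial_xF(x^*,u^* )$. Local solution map (known fact): if (CPSO) holds and (RPD-i), (ND) hold at $(x^*,u^* )$, there are an open neighbourhood $U\subset\Omega$ of $u^*$ and a $C^1$ map $\psi:U\to\mathcal M$ with $\psi(u^* )=x^*$ such that for all $u\in U$: $\psi(u)$ is the unique minimizer of $F(\cdot,u)|_{\mathcal M}$, (ND) and (RPD-i) hold at $(\psi(u),u)$, and $D\psi(u)=-\nabla^2_{\mathcal M}F(\psi(u),u)^\dagger D_u\nabla_{\mathcal M}F(\psi(u),u)$. Proximal gradient map: $0<\underline\alpha\le\overline\alpha<2/L$ are fixed; $P_{\alpha g}(w,u):=\arg\min_{x\in\mathcal X}\alpha g(x,u)+\tfrac12\|x-w\|^2$ and $\mathcal A_\alpha(x,u):=P_{\alpha g}(x-\alpha\nabla_xf(x,u),u)$. (Under (CPSO) and (ND) at $(x^*,u^* )$, $\mathcal A_\alpha$ is $C^1$ near $(x^*,u^* )$ for $\alpha\in(0,2/L)$.) *)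

theory Defs
  imports "HOL-Analysis.Analysis"
begin

section \<open>Smooth maps, gradients, Hessians\<close>

text \<open>Intended for open sets: the derivatives are taken in the ambient space.\<close>

definition C1_on :: "('a::real_normed_vector \<Rightarrow> 'b::real_normed_vector) \<Rightarrow> 'a set \<Rightarrow> bool" where
  "C1_on f S \<longleftrightarrow> (\<exists>f' :: 'a \<Rightarrow> 'a \<Rightarrow>\<^sub>L 'b.
     (\<forall>x\<in>S. (f has_derivative blinfun_apply (f' x)) (at x)) \<and> continuous_on S f')"

definition C2_on :: "('a::real_normed_vector \<Rightarrow> 'b::real_normed_vector) \<Rightarrow> 'a set \<Rightarrow> bool" where
  "C2_on f S \<longleftrightarrow> (\<exists>f' :: 'a \<Rightarrow> 'a \<Rightarrow>\<^sub>L 'b.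
     (\<forall>x\<in>S. (f has_derivative blinfun_apply (f' x)) (at x)) \<and> C1_on f' S)"

definition grad :: "('a::real_inner \<Rightarrow> real) \<Rightarrow> 'a \<Rightarrow> 'a" where
  "grad h x = (THE d. GDERIV h x :> d)"

definition hess :: "('a::real_inner \<Rightarrow> real) \<Rightarrow> 'a \<Rightarrow> 'a \<Rightarrow> 'a" where
  "hess h x = frechet_derivative (grad h) (at x)"


section \<open>Linear algebra\<close>

definition orth_proj :: "'a::euclidean_space set \<Rightarrow> 'a \<Rightarrow> 'a" where
  "orth_proj S x = (THE y. y \<in> S \<and> x - y \<in> S\<^sup>\<bottom>)"

definition pos_def_on :: "('a::real_inner \<Rightarrow> 'a) \<Rightarrow> 'a set \<Rightarrow> bool" where
  "pos_def_on A S \<longleftrightarrow> (\<forall>v\<in>S. v \<noteq> 0 \<longrightarrow> 0 < inner v (A v))"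

text \<open>Moore--Penrose pseudoinverse, via the four Penrose conditions.\<close>

definition pinv :: "('a::euclidean_space \<Rightarrow> 'b::euclidean_space) \<Rightarrow> 'b \<Rightarrow> 'a" where
  "pinv A = (THE B. linear B \<and> A \<circ> B \<circ> A = A \<and> B \<circ> A \<circ> B = B
     \<and> adjoint (A \<circ> B) = A \<circ> B \<and> adjoint (B \<circ> A) = B \<circ> A)"

text \<open>
  Complex eigenvalues of a real linear operator: \<open>p + i q\<close> is an eigenvector of the
  complexification of \<open>A\<close> for the eigenvalue \<open>z\<close>; the two equations are the real and
  imaginary parts of \<open>A p + i A q = z (p + i q)\<close>.
\<close>

definition complex_eigenvalue :: "('a::euclidean_space \<Rightarrow> 'a) \<Rightarrow> complex \<Rightarrow> bool" where
  "complex_eigenvalue A z \<longleftrightarrow> (\<exists>p q. (p \<noteq> 0 \<or> q \<noteq> 0)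
     \<and> A p = Re z *\<^sub>R p - Im z *\<^sub>R q \<and> A q = Im z *\<^sub>R p + Re z *\<^sub>R q)"

definition spectral_radius :: "('a::euclidean_space \<Rightarrow> 'a) \<Rightarrow> real" where
  "spectral_radius A = Sup {cmod z | z. complex_eigenvalue A z}"

text \<open>The linear subspace parallel to the affine hull.\<close>

definition par :: "'a::real_vector set \<Rightarrow> 'a set" where
  "par S = {a - b | a b. a \<in> affine hull S \<and> b \<in> affine hull S}"


section \<open>Embedded submanifolds and Riemannian derivatives\<close>

text \<open>Near \<open>x\<close>, a \<open>C\<^sup>2\<close>-diffeomorphism flattens \<open>M\<close> to a \<open>d\<close>-dimensional subspace.\<close>

definition C2_manifold_at :: "nat \<Rightarrow> 'a::euclidean_space set \<Rightarrow> 'a \<Rightarrow> bool" where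
  "C2_manifold_at d M x \<longleftrightarrow> (\<exists>V W \<phi> \<phi>' S. open V \<and> x \<in> V \<and> open (W :: 'a set)
     \<and> homeomorphism V W \<phi> \<phi>' \<and> C2_on \<phi> V \<and> C2_on \<phi>' W
     \<and> subspace S \<and> dim S = d \<and> \<phi> ` (M \<inter> V) = S \<inter> W)"

definition C2_submanifold :: "'a::euclidean_space set \<Rightarrow> bool" where
  "C2_submanifold M \<longleftrightarrow> (\<exists>d. \<forall>x\<in>M. C2_manifold_at d M x)"

definition tangent_space :: "'a::euclidean_space set \<Rightarrow> 'a \<Rightarrow> 'a set" where
  "tangent_space M x = {v. \<exists>\<gamma> e. 0 < e \<and> C1_on \<gamma> {-e<..<e} \<and> \<gamma> ` {-e<..<e} \<subseteq> M
     \<and> \<gamma> 0 = x \<and> (\<gamma> has_vector_derivative v) (at 0)}"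

definition normal_space :: "'a::euclidean_space set \<Rightarrow> 'a \<Rightarrow> 'a set" where
  "normal_space M x = (tangent_space M x)\<^sup>\<bottom>"

definition tproj :: "'a::euclidean_space set \<Rightarrow> 'a \<Rightarrow> 'a \<Rightarrow> 'a" where
  "tproj M x = orth_proj (tangent_space M x)"

definition nproj :: "'a::euclidean_space set \<Rightarrow> 'a \<Rightarrow> 'a \<Rightarrow> 'a" where
  "nproj M x = orth_proj (normal_space M x)"

definition C2_extension ::
  "'a::euclidean_space set \<Rightarrow> ('a \<Rightarrow> ereal) \<Rightarrow> 'a \<Rightarrow> ('a \<Rightarrow> real) \<Rightarrow> bool" where
  "C2_extension M h x k \<longleftrightarrow> (\<exists>V. open V \<and> x \<in> V \<and> C2_on k V \<and> (\<forall>y\<in>M \<inter> V. h y = ereal (k y)))"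

definition normal_extension ::
  "'a::euclidean_space set \<Rightarrow> 'a \<Rightarrow> 'a \<Rightarrow> ('a \<Rightarrow> 'a) \<Rightarrow> bool" where
  "normal_extension M x w W \<longleftrightarrow> (\<exists>V. open V \<and> x \<in> V \<and> C1_on W V \<and> W x = w
     \<and> (\<forall>y\<in>M \<inter> V. W y \<in> normal_space M y))"

text \<open>
  The objects below do not depend on the chosen local extension (at points of a
  \<open>C\<^sup>2\<close>-submanifold, and for tangent \<open>v\<close> in \<open>weingarten\<close>), so a choice operator is used.
\<close>

definition weingarten :: "'a::euclidean_space set \<Rightarrow> 'a \<Rightarrow> 'a \<Rightarrow> 'a \<Rightarrow> 'a" where
  "weingarten M x v w =
     (let W = (SOME W. normal_extension M x w W)
      in - tproj M x (frechet_derivative W (at x) v))"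

definition riem_grad :: "'a::euclidean_space set \<Rightarrow> ('a \<Rightarrow> ereal) \<Rightarrow> 'a \<Rightarrow> 'a" where
  "riem_grad M h x = (let k = (SOME k. C2_extension M h x k) in tproj M x (grad k x))"

text \<open>Extended from the tangent space to the whole space by the orthogonal projection.\<close>

definition riem_hess :: "'a::euclidean_space set \<Rightarrow> ('a \<Rightarrow> ereal) \<Rightarrow> 'a \<Rightarrow> 'a \<Rightarrow> 'a" where
  "riem_hess M h x v =
     (let k = (SOME k. C2_extension M h x k); t = tproj M x v
      in tproj M x (hess k x t) + weingarten M x t (nproj M x (grad k x)))"


section \<open>Variational analysis\<close>

definition proper_fun :: "('a \<Rightarrow> ereal) \<Rightarrow> bool" where
  "proper_fun h \<longleftrightarrow> (\<forall>x. h x \<noteq> -\<infinity>) \<and> (\<exists>x. h x \<noteq> \<infinity>)"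

definition lsc_fun :: "('a::topological_space \<Rightarrow> ereal) \<Rightarrow> bool" where
  "lsc_fun h \<longleftrightarrow> (\<forall>x. h x \<le> Liminf (at x) h)"

definition epi :: "('a \<Rightarrow> ereal) \<Rightarrow> ('a \<times> real) set" where
  "epi h = {(x, r). h x \<le> ereal r}"

definition convex_fun :: "('a::real_vector \<Rightarrow> ereal) \<Rightarrow> bool" where
  "convex_fun h \<longleftrightarrow> convex (epi h)"

definition convex_subdiff :: "('a::euclidean_space \<Rightarrow> ereal) \<Rightarrow> 'a \<Rightarrow> 'a set" where
  "convex_subdiff h x = {v. \<bar>h x\<bar> \<noteq> \<infinity> \<and> (\<forall>y. h x + ereal (inner v (y - x)) \<le> h y)}"

definition regular_subdiff :: "('a::euclidean_space \<Rightarrow> ereal) \<Rightarrow> 'a \<Rightarrow> 'a set" where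
  "regular_subdiff h x = {v. \<bar>h x\<bar> \<noteq> \<infinity> \<and> (\<forall>e>0. \<forall>\<^sub>F y in nhds x.
     h x + ereal (inner v (y - x) - e * norm (y - x)) \<le> h y)}"

definition limiting_subdiff :: "('a::euclidean_space \<Rightarrow> ereal) \<Rightarrow> 'a \<Rightarrow> 'a set" where
  "limiting_subdiff h x = {v. \<bar>h x\<bar> \<noteq> \<infinity> \<and> (\<exists>X V. X \<longlonglongrightarrow> x \<and> (\<lambda>n. h (X n)) \<longlonglongrightarrow> h x
     \<and> (\<forall>n. V n \<in> regular_subdiff h (X n)) \<and> V \<longlonglongrightarrow> v)}"

definition regular_normal_cone :: "'a::euclidean_space set \<Rightarrow> 'a \<Rightarrow> 'a set" where
  "regular_normal_cone C x = {v. \<forall>e>0. \<forall>\<^sub>F y in at x within C.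
     inner v (y - x) \<le> e * norm (y - x)}"

definition limiting_normal_cone :: "'a::euclidean_space set \<Rightarrow> 'a \<Rightarrow> 'a set" where
  "limiting_normal_cone C x = {v. \<exists>X V. (\<forall>n. X n \<in> C) \<and> X \<longlonglongrightarrow> x
     \<and> (\<forall>n. V n \<in> regular_normal_cone C (X n)) \<and> V \<longlonglongrightarrow> v}"

definition clarke_regular_set :: "'a::euclidean_space set \<Rightarrow> 'a \<Rightarrow> bool" where
  "clarke_regular_set C x \<longleftrightarrow> x \<in> C \<and> (\<exists>r>0. closed (C \<inter> cball x r))
     \<and> limiting_normal_cone C x = regular_normal_cone C x"

definition regular_fun :: "('a::euclidean_space \<Rightarrow> ereal) \<Rightarrow> 'a \<Rightarrow> bool" where
  "regular_fun h x \<longleftrightarrow> \<bar>h x\<bar> \<noteq> \<infinity> \<and> clarke_regular_set (epi h) (x, real_of_ereal (h x))"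

text \<open>Painleve--Kuratowski continuity of a set-valued map relative to \<open>M\<close>: outer and inner part.\<close>

definition set_continuous_rel ::
  "('a::euclidean_space \<Rightarrow> 'b::euclidean_space set) \<Rightarrow> 'a set \<Rightarrow> 'a \<Rightarrow> bool" where
  "set_continuous_rel S M x \<longleftrightarrow>
     (\<forall>X V v. (\<forall>n. X n \<in> M) \<and> X \<longlonglongrightarrow> x \<and> (\<forall>n. V n \<in> S (X n)) \<and> V \<longlonglongrightarrow> v \<longrightarrow> v \<in> S x)
   \<and> (\<forall>v\<in>S x. \<forall>X. (\<forall>n. X n \<in> M) \<and> X \<longlonglongrightarrow> x
        \<longrightarrow> (\<exists>V. (\<forall>\<^sub>F n in sequentially. V n \<in> S (X n)) \<and> V \<longlonglongrightarrow> v))"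

text \<open>Regularity is a notion for points where the function is finite, hence the guard below.\<close>

definition partly_smooth_at :: "('a::euclidean_space \<Rightarrow> ereal) \<Rightarrow> 'a set \<Rightarrow> 'a \<Rightarrow> bool" where
  "partly_smooth_at h M x \<longleftrightarrow>
     (\<forall>\<^sub>F y in nhds x. \<bar>h y\<bar> \<noteq> \<infinity> \<longrightarrow> regular_fun h y)
   \<and> limiting_subdiff h x \<noteq> {}
   \<and> (\<exists>d. \<forall>\<^sub>F y in nhds x. y \<in> M \<longrightarrow> C2_manifold_at d M y)
   \<and> (\<exists>k. C2_extension M h x k)
   \<and> normal_space M x = par (limiting_subdiff h x)
   \<and> set_continuous_rel (limiting_subdiff h) M x"

definition partly_smooth :: "('a::euclidean_space \<Rightarrow> ereal) \<Rightarrow> 'a set \<Rightarrow> bool" where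
  "partly_smooth h M \<longleftrightarrow> proper_fun h \<and> lsc_fun h \<and> (\<forall>x\<in>M. partly_smooth_at h M x)"


section \<open>The parametric problem\<close>

definition CPSO ::
  "('x::euclidean_space \<times> 'u::euclidean_space \<Rightarrow> real) \<Rightarrow> ('x \<times> 'u \<Rightarrow> ereal)
    \<Rightarrow> 'x set \<Rightarrow> 'u set \<Rightarrow> real \<Rightarrow> bool" where
  "CPSO f g M \<Omega> L \<longleftrightarrow> C2_on f UNIV \<and> partly_smooth g (M \<times> \<Omega>)
     \<and> (\<forall>u\<in>\<Omega>. convex_on UNIV (\<lambda>x. f (x, u)) \<and> convex_fun (\<lambda>x. g (x, u))
          \<and> L-lipschitz_on UNIV (grad (\<lambda>x. f (x, u))))"

definition objective ::
  "('x \<times> 'u \<Rightarrow> real) \<Rightarrow> ('x \<times> 'u \<Rightarrow> ereal) \<Rightarrow> 'x \<times> 'u \<Rightarrow> ereal" where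
  "objective f g z = ereal (f z) + g z"

definition RPD_i ::
  "('x::euclidean_space \<times> 'u \<Rightarrow> real) \<Rightarrow> ('x \<times> 'u \<Rightarrow> ereal) \<Rightarrow> 'x set \<Rightarrow> 'x \<times> 'u \<Rightarrow> bool" where
  "RPD_i f g M = (\<lambda>(x, u).
     pos_def_on (riem_hess M (\<lambda>y. objective f g (y, u)) x) (tangent_space M x))"

definition RPD_ii ::
  "('x::euclidean_space \<times> 'u \<Rightarrow> real) \<Rightarrow> 'x set \<Rightarrow> 'x \<times> 'u \<Rightarrow> bool" where
  "RPD_ii f M = (\<lambda>(x, u).
     pos_def_on (\<lambda>v. tproj M x (hess (\<lambda>y. f (y, u)) x v)) (tangent_space M x))"

definition ND ::
  "('x::euclidean_space \<times> 'u \<Rightarrow> real) \<Rightarrow> ('x \<times> 'u \<Rightarrow> ereal) \<Rightarrow> 'x \<times> 'u \<Rightarrow> bool" where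
  "ND f g = (\<lambda>(x, u). 0 \<in> rel_interior (convex_subdiff (\<lambda>y. objective f g (y, u)) x))"

definition local_solution_map ::
  "('x::euclidean_space \<times> 'u::euclidean_space \<Rightarrow> real) \<Rightarrow> ('x \<times> 'u \<Rightarrow> ereal)
    \<Rightarrow> 'x set \<Rightarrow> 'u set \<Rightarrow> 'x \<Rightarrow> 'u \<Rightarrow> 'u set \<Rightarrow> ('u \<Rightarrow> 'x) \<Rightarrow> bool" where
  "local_solution_map f g M \<Omega> xs us U \<psi> \<longleftrightarrow>
     open U \<and> us \<in> U \<and> U \<subseteq> \<Omega> \<and> C1_on \<psi> U \<and> \<psi> ` U \<subseteq> M \<and> \<psi> us = xs
   \<and> (\<forall>u\<in>U.
        (\<forall>y\<in>M. y \<noteq> \<psi> u \<longrightarrow> objective f g (\<psi> u, u) < objective f g (y, u))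
      \<and> ND f g (\<psi> u, u) \<and> RPD_i f g M (\<psi> u, u)
      \<and> frechet_derivative \<psi> (at u) =
          (\<lambda>d. - pinv (riem_hess M (\<lambda>y. objective f g (y, u)) (\<psi> u))
             (frechet_derivative (\<lambda>w. riem_grad M (\<lambda>y. objective f g (y, w)) (\<psi> u)) (at u) d)))"

definition prox :: "real \<Rightarrow> ('x::euclidean_space \<times> 'u \<Rightarrow> ereal) \<Rightarrow> 'x \<times> 'u \<Rightarrow> 'x" where
  "prox \<alpha> g = (\<lambda>(w, u).
     arg_min (\<lambda>x. ereal \<alpha> * g (x, u) + ereal ((norm (x - w))\<^sup>2 / 2)) (\<lambda>_. True))"

definition PG ::
  "('x::euclidean_space \<times> 'u \<Rightarrow> real) \<Rightarrow> ('x \<times> 'u \<Rightarrow> ereal) \<Rightarrow> real \<Rightarrow> 'x \<times> 'u \<Rightarrow> 'x" where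
  "PG f g \<alpha> = (\<lambda>(x, u). prox \<alpha> g (x - \<alpha> *\<^sub>R grad (\<lambda>y. f (y, u)) x, u))"

definition D_x ::
  "('x::real_normed_vector \<times> 'u \<Rightarrow> 'y::real_normed_vector) \<Rightarrow> 'x \<times> 'u \<Rightarrow> 'x \<Rightarrow> 'y" where
  "D_x A = (\<lambda>(x, u). frechet_derivative (\<lambda>y. A (y, u)) (at x))"

definition D_u ::
  "('x \<times> 'u::real_normed_vector \<Rightarrow> 'y::real_normed_vector) \<Rightarrow> 'x \<times> 'u \<Rightarrow> 'u \<Rightarrow> 'y" where
  "D_u A = (\<lambda>(x, u). frechet_derivative (\<lambda>w. A (x, w)) (at u))"

end

theory Submission
  imports Defs "HOL-Computational_Algebra.Fundamental_Theorem_Algebra"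
begin

text \<open>
  Let \<open>d = - grad f\<close> and \<open>w = x - \<alpha> grad f\<close> at the given point. In a chart that flattens \<open>M\<close>, strong
  convexity of \<open>\<alpha> g + |\<cdot> - w|^2 / 2\<close> makes its critical point on \<open>M\<close> nondegenerate, so the implicit
  function theorem yields a differentiable map of critical points \<open>P (w, u)\<close>. Because \<open>d\<close> is relatively
  interior to the subdifferential, whose affine hull is normal to \<open>M\<close>, and the subdifferential is
  inner semicontinuous along \<open>M\<close>, a separation argument shows that \<open>(w - P) / \<alpha>\<close> remains a
  subgradient nearby; hence \<open>P\<close> is the proximal map there and the proximal gradient map is
  differentiable. Its \<open>x\<close>-derivative is \<open>Q (I - \<alpha> H)\<close> with \<open>Q\<close> nonexpansive, and the
  Baillon--Haddad inequality \<open>|H v|^2 \<le> L \<langle>H v, v\<rangle>\<close> together with positive definiteness of \<open>H\<close> on the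
  tangent space makes it a contraction there. The derivative of \<open>\<psi>\<close> then comes from differentiating
  \<open>\<psi> u = PG (\<psi> u, u)\<close>, as \<open>D\<psi>\<close> takes tangential values; no Riemannian Hessian is needed.
\<close>

section \<open>Continuously differentiable maps and orthogonal projections\<close>

text \<open>Partial smoothness concerns the joint limiting subdifferential of \<open>g\<close> on
  the product space, while (ND) and the proximal map concern the convex subdifferential in
  \<open>x\<close> alone. Bridging the two is the main obstacle. The \<open>x\<close> component of a
  joint subgradient is a partial one by convexity. The reverse inclusion needs a qualification
  condition, which the geometry supplies: \<open>\<Omega>\<close> is open, so normals to
  \<open>M \<times> \<Omega>\<close> have zero parameter part.

  The local result holds at any point satisfying (RPD-ii) and (ND), so it applies at every
  \<open>(\<psi> u, u)\<close> with \<open>u\<close> near \<open>us\<close>: (ND) along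
  \<open>\<psi>\<close> belongs to the local solution map, and (RPD-ii) persists by compactness. Its
  output is a norm bound \<open>q < 1\<close> for the \<open>x\<close>-derivative composed with the
  tangent projection. This one bound gives both the spectral radius estimate and the invertibility
  in the derivative formula.\<close>

lemma C1_onE:
  assumes "C1_on f S"
  obtains f' where "\<And>x. x \<in> S \<Longrightarrow> (f has_derivative blinfun_apply (f' x)) (at x)"
    "continuous_on S f'"
  using assms unfolding C1_on_def by blast

lemma C1_onI:
  assumes "\<And>x. x \<in> S \<Longrightarrow> (f has_derivative blinfun_apply (f' x)) (at x)" "continuous_on S f'"
  shows "C1_on f S"
  using assms unfolding C1_on_def by blast

lemma C1_on_subset: "C1_on f S \<Longrightarrow> T \<subseteq> S \<Longrightarrow> C1_on f T"
  unfolding C1_on_def by (meson continuous_on_subset subsetD)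

lemma C1_on_imp_continuous_on: "C1_on f S \<Longrightarrow> continuous_on S f"
  by (meson C1_on_def continuous_at_imp_continuous_on has_derivative_continuous)

lemma C1_on_compose:
  assumes "C1_on f S" "C1_on g T" "\<And>x. x \<in> S \<Longrightarrow> f x \<in> T"
  shows "C1_on (\<lambda>x. g (f x)) S"
proof -
  obtain f' where f: "\<And>x. x \<in> S \<Longrightarrow> (f has_derivative blinfun_apply (f' x)) (at x)"
    "continuous_on S f'" using C1_onE[OF assms(1)] by blast
  obtain g' where g: "\<And>x. x \<in> T \<Longrightarrow> (g has_derivative blinfun_apply (g' x)) (at x)"
    "continuous_on T g'" using C1_onE[OF assms(2)] by blast
  show ?thesis
  proof (rule C1_onI[where f' = "\<lambda>x. g' (f x) o\<^sub>L f' x"])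
    fix x assume "x \<in> S"
    then show "((\<lambda>x. g (f x)) has_derivative blinfun_apply (g' (f x) o\<^sub>L f' x)) (at x)"
      using has_derivative_compose[OF f(1) g(1)[OF assms(3)]]
      by (simp add: blinfun_compose.rep_eq o_def)
  next
    have "continuous_on S (\<lambda>x. g' (f x))"
      using continuous_on_compose2[OF g(2) C1_on_imp_continuous_on[OF assms(1)]] assms(3) by blast
    then show "continuous_on S (\<lambda>x. g' (f x) o\<^sub>L f' x)"
      using f(2) by (rule bounded_bilinear.continuous_on[OF bounded_bilinear_blinfun_compose])
  qed
qed

lemma C1_on_bounded_linear:
  assumes "bounded_linear h" shows "C1_on h S"
  by (rule C1_onI[where f' = "\<lambda>_. Blinfun h"])
    (use assms in \<open>auto simp: bounded_linear_Blinfun_apply bounded_linear_imp_has_derivative intro!: continuous_intros\<close>)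

lemma C1_on_const: "C1_on (\<lambda>x. c) S"
  by (rule C1_onI[where f' = "\<lambda>_. 0"]) (auto simp: zero_blinfun.rep_eq intro!: has_derivative_const)

lemma (in bounded_bilinear) C1_on:
  assumes "C1_on f S" "C1_on g S"
  shows "C1_on (\<lambda>x. prod (f x) (g x)) S"
proof -
  obtain f' where f: "\<And>x. x \<in> S \<Longrightarrow> (f has_derivative blinfun_apply (f' x)) (at x)"
    "continuous_on S f'" using C1_onE[OF assms(1)] by blast
  obtain g' where g: "\<And>x. x \<in> S \<Longrightarrow> (g has_derivative blinfun_apply (g' x)) (at x)"
    "continuous_on S g'" using C1_onE[OF assms(2)] by blast
  show ?thesis
  proof (rule C1_onI[where f' = "\<lambda>x. (prod_right (f x) o\<^sub>L g' x) + (prod_left (g x) o\<^sub>L f' x)"])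
    fix x assume "x \<in> S"
    then show "((\<lambda>x. prod (f x) (g x)) has_derivative
      blinfun_apply ((prod_right (f x) o\<^sub>L g' x) + (prod_left (g x) o\<^sub>L f' x))) (at x)"
      by (intro has_derivative_eq_rhs[OF FDERIV[OF f(1) g(1)]])
        (auto simp: blinfun.bilinear_simps prod_left.rep_eq prod_right.rep_eq)
  next
    show "continuous_on S (\<lambda>x. (prod_right (f x) o\<^sub>L g' x) + (prod_left (g x) o\<^sub>L f' x))"
      by (intro continuous_on_add bounded_bilinear.continuous_on[OF bounded_bilinear_blinfun_compose]
          bounded_linear.continuous_on[OF bounded_linear_prod_right] f g
          bounded_linear.continuous_on[OF bounded_linear_prod_left]
          C1_on_imp_continuous_on assms)
  qed
qed

lemma C1_on_add:
  assumes "C1_on f S" "C1_on g S"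
  shows "C1_on (\<lambda>x. f x + g x) S"
proof -
  obtain f' where f: "\<And>x. x \<in> S \<Longrightarrow> (f has_derivative blinfun_apply (f' x)) (at x)"
    "continuous_on S f'" using C1_onE[OF assms(1)] by blast
  obtain g' where g: "\<And>x. x \<in> S \<Longrightarrow> (g has_derivative blinfun_apply (g' x)) (at x)"
    "continuous_on S g'" using C1_onE[OF assms(2)] by blast
  show ?thesis
    by (rule C1_onI[where f' = "\<lambda>x. f' x + g' x"])
      (use f g in \<open>auto intro!: continuous_intros derivative_eq_intros simp: blinfun.add_left\<close>)
qed

lemma C1_on_linear_image: "bounded_linear h \<Longrightarrow> C1_on f S \<Longrightarrow> C1_on (\<lambda>x. h (f x)) S"
  by (rule C1_on_compose[where T=UNIV]) (auto intro: C1_on_bounded_linear)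

lemma C1_on_sum:
  "finite I \<Longrightarrow> (\<And>i. i \<in> I \<Longrightarrow> C1_on (f i) S) \<Longrightarrow> C1_on (\<lambda>x. \<Sum>i\<in>I. f i x) S"
  by (induction I rule: finite_induct) (auto intro: C1_on_const C1_on_add)

lemma C1_on_Pair:
  assumes "C1_on f S" "C1_on g S"
  shows "C1_on (\<lambda>x. (f x, g x)) S"
proof -
  have "C1_on (\<lambda>x. (f x, 0) + (0, g x)) S"
    using assms
    by (intro C1_on_add C1_on_linear_image[where h="\<lambda>y. (y,0)"] C1_on_linear_image[where h="\<lambda>y. (0,y)"]
      bounded_linear_Pair bounded_linear_ident bounded_linear_zero)
  then show ?thesis by simp
qed

lemma C2_onE:
  assumes "C2_on f S"
  obtains f' where "\<And>x. x \<in> S \<Longrightarrow> (f has_derivative blinfun_apply (f' x)) (at x)"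
    "C1_on f' S"
  using assms unfolding C2_on_def by blast

text \<open>The inverse function theorem is applied to \<open>z \<mapsto> (\<Phi> z, snd z)\<close>,
  whose derivative at the base point is injective exactly when the partial derivative of
  \<open>\<Phi>\<close> in the first argument is. With \<open>g\<close> the local inverse,
  \<open>p \<mapsto> fst (g (0, p))\<close> solves the equation.\<close>

lemma implicit_function:
  fixes \<Phi> :: "'s::euclidean_space \<times> 'p::euclidean_space \<Rightarrow> 's"
  assumes "open U" "C1_on \<Phi> U" "(s0, p0) \<in> U" "\<Phi> (s0, p0) = 0"
    and inj: "\<And>\<sigma>. frechet_derivative \<Phi> (at (s0, p0)) (\<sigma>, 0) = 0 \<Longrightarrow> \<sigma> = 0"
  obtains V s where "open V" "p0 \<in> V" "s p0 = s0"
    "\<And>p. p \<in> V \<Longrightarrow> (s p, p) \<in> U" "\<And>p. p \<in> V \<Longrightarrow> \<Phi> (s p, p) = 0"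
    "\<And>p. p \<in> V \<Longrightarrow> s differentiable at p"
proof -
  let ?\<Psi> = "\<lambda>z. (\<Phi> z, snd z)"
  have "C1_on ?\<Psi> U"
    by (intro C1_on_Pair assms C1_on_bounded_linear bounded_linear_snd)
  then obtain \<Psi>' where \<Psi>: "\<And>x. x \<in> U \<Longrightarrow> (?\<Psi> has_derivative blinfun_apply (\<Psi>' x)) (at x)"
    "continuous_on U \<Psi>'" by (rule C1_onE) blast
  let ?z = "(s0, p0)"
  obtain \<Phi>' where "(\<Phi> has_derivative \<Phi>') (at ?z)"
    using assms(2,3) C1_onE by metis
  then have \<Phi>': "(\<Phi> has_derivative frechet_derivative \<Phi> (at ?z)) (at ?z)"
    using frechet_derivative_at by fastforce
  have eq: "blinfun_apply (\<Psi>' ?z) = (\<lambda>h. (frechet_derivative \<Phi> (at ?z) h, snd h))"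
    by (rule has_derivative_unique[OF \<Psi>(1)[OF assms(3)]])
      (intro has_derivative_Pair \<Phi>' bounded_linear_imp_has_derivative bounded_linear_snd)
  have lin: "linear (blinfun_apply (\<Psi>' ?z))"
    by (simp add: bounded_linear.linear blinfun.bounded_linear_right)
  have "inj (blinfun_apply (\<Psi>' ?z))"
    unfolding linear_injective_0[OF lin] 
  proof (intro allI impI)
    fix h assume "blinfun_apply (\<Psi>' ?z) h = 0"
    then have "frechet_derivative \<Phi> (at ?z) (fst h, 0) = 0 \<and> snd h = 0"
      unfolding eq by (cases h) (simp add: zero_prod_def)
    then show "h = 0" using inj by (cases h) (simp add: zero_prod_def)
  qed
  then obtain inv' where inv': "linear inv'" "inv' \<circ> blinfun_apply (\<Psi>' ?z) = id"
    using linear_injective_left_inverse[OF lin] by blast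
  have "Blinfun inv' o\<^sub>L \<Psi>' ?z = id_blinfun"
    using inv' by (intro blinfun_eqI)
      (auto simp: bounded_linear_Blinfun_apply linear_conv_bounded_linear[symmetric] fun_eq_iff)
  note inv_fun = inverse_function_theorem[OF assms(1) \<Psi> assms(3) this]
  show thesis
  proof (rule inv_fun)
    fix U' W g and g' :: "'s \<times> 'p \<Rightarrow> 's \<times> 'p \<Rightarrow> 's \<times> 'p"
    assume W: "open U'" "U' \<subseteq> U" "?z \<in> U'" "open W" "?\<Psi> ?z \<in> W"
        "homeomorphism U' W ?\<Psi> g"
        "\<And>y. y \<in> W \<Longrightarrow> (g has_derivative (g' y)) (at y)"
    have gz: "g (0, p0) = ?z"
      using homeomorphism_apply1[OF W(6) W(3)] assms(4) by simp
    have g: "g (0, p) \<in> U' \<and> \<Phi> (g (0, p)) = 0 \<and> snd (g (0, p)) = p" if "(0, p) \<in> W" for p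
    proof -
      have "g (0, p) \<in> U'" using W(6) that by (auto simp: homeomorphism_def)
      then show ?thesis using homeomorphism_apply2[OF W(6) that] by simp
    qed
    let ?V = "(\<lambda>p. (0, p)) -` W"
    let ?s = "\<lambda>p. fst (g (0, p))"
    show ?thesis
    proof (rule that[of ?V ?s])
      show "open ?V"
        by (rule continuous_open_vimage[OF W(4)]) (auto intro!: continuous_intros)
      show "p0 \<in> ?V" using W(5) assms(4) by simp
      show "?s p0 = s0" using gz by simp
      fix p assume "p \<in> ?V"
      then have p: "(0, p) \<in> W" by simp
      have e: "(?s p, p) = g (0, p)" using g[OF p] by (metis prod.collapse)
      show "(?s p, p) \<in> U" "\<Phi> (?s p, p) = 0" using g[OF p] W(2) unfolding e by auto
      have "((\<lambda>p. g (0, p)) has_derivative (\<lambda>h. g' (0, p) (0, h))) (at p)"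
        by (rule has_derivative_compose[where f="\<lambda>p. (0, p)", OF _ W(7)[OF p]])
          (intro has_derivative_Pair has_derivative_const has_derivative_ident)
      then show "?s differentiable at p"
        using has_derivative_fst differentiableI by blast
    qed
  qed
qed

section \<open>Extraction of sequences\<close>

lemma compact_subseq:
  fixes f :: "nat \<Rightarrow> 'a::metric_space"
  assumes "compact K" "\<And>n. f n \<in> K"
  obtains l r where "l \<in> K" "strict_mono r" "(f \<circ> r) \<longlonglongrightarrow> l"
proof -
  have "\<exists>l\<in>K. \<exists>r. strict_mono r \<and> (f \<circ> r) \<longlonglongrightarrow> l"
    using assms(1)[unfolded compact_def, rule_format, of f] assms(2) by blast
  then show ?thesis using that by blast
qed

text \<open>Turns the failure of a local statement into a convergent sequence of counterexamples.
  \<open>R\<close> carries along side conditions valid near \<open>a\<close>, such as membership in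
  an open set.\<close>

lemma not_eventually_nhds_sequence:
  fixes a :: "'a::metric_space"
  assumes "\<not> (\<forall>\<^sub>F x in nhds a. P x)" "\<forall>\<^sub>F x in nhds a. R x"
  obtains X where "X \<longlonglongrightarrow> a" "\<And>n. R (X n)" "\<And>n. \<not> P (X n)"
proof -
  have "\<exists>x. dist x a < inverse (real (Suc n)) \<and> R x \<and> \<not> P x" for n
  proof (rule ccontr)
    assume *: "\<not> ?thesis"
    have "\<forall>\<^sub>F x in nhds a. dist x a < inverse (real (Suc n))"
      unfolding eventually_nhds_metric by (rule exI[of _ "inverse (real (Suc n))"]) simp
    with assms(2) have "\<forall>\<^sub>F x in nhds a. P x" by eventually_elim (use * in blast)
    with assms(1) show False by contradiction
  qed
  then have "\<exists>X. \<forall>n. dist (X n) a < inverse (real (Suc n)) \<and> R (X n) \<and> \<not> P (X n)"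
    by (intro choice allI)
  then obtain X where X: "\<And>n. dist (X n) a < inverse (real (Suc n))" "\<And>n. R (X n)" "\<And>n. \<not> P (X n)"
    by blast
  have "(\<lambda>n. dist (X n) a) \<longlonglongrightarrow> 0"
    by (rule tendsto_sandwich[OF _ _ tendsto_const LIMSEQ_inverse_real_of_nat])
      (use X(1) in \<open>auto intro!: always_eventually less_imp_le\<close>)
  then have "X \<longlonglongrightarrow> a" by (rule iffD2[OF tendsto_dist_iff])
  then show thesis using X(2,3) by (rule that)
qed

section \<open>Orthogonal projections onto subspaces\<close>

lemma orth_proj_eqI:
  assumes "subspace S" "y \<in> S" "x - y \<in> S\<^sup>\<bottom>"
  shows "orth_proj S x = y"
  unfolding orth_proj_def
proof (rule the_equality)
  fix z assume z: "z \<in> S \<and> x - z \<in> S\<^sup>\<bottom>"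
  have "z - y \<in> S" using assms z by (simp add: subspace_diff)
  moreover have "z - y \<in> S\<^sup>\<bottom>"
    using subspace_diff[OF subspace_orthogonal_comp assms(3), of "x - z"] z by simp
  ultimately have "z - y \<in> S \<inter> S\<^sup>\<bottom>" by simp
  then show "z = y" unfolding orthogonal_Int_0[OF assms(1)] by simp
qed (use assms in auto)

context
  fixes S :: "'a::euclidean_space set"
  assumes S: "subspace S"
begin

lemma orth_proj_props: "orth_proj S x \<in> S" "x - orth_proj S x \<in> S\<^sup>\<bottom>"
proof -
  have "x \<in> S + S\<^sup>\<bottom>" using subspace_sum_orthogonal_comp[OF S] by simp
  then obtain y z where "x = y + z" "y \<in> S" "z \<in> S\<^sup>\<bottom>" by (rule set_plus_elim)
  then have "orth_proj S x = y" by (intro orth_proj_eqI S) auto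
  then show "orth_proj S x \<in> S" "x - orth_proj S x \<in> S\<^sup>\<bottom>"
    using \<open>y \<in> S\<close> \<open>z \<in> S\<^sup>\<bottom>\<close> \<open>x = y + z\<close> by auto
qed

lemma orth_proj_id: "x \<in> S \<Longrightarrow> orth_proj S x = x"
  by (rule orth_proj_eqI[OF S]) (auto simp: subspace_0 subspace_orthogonal_comp)

lemma linear_orth_proj: "linear (orth_proj S)"
proof (rule linearI)
  fix x y
  show "orth_proj S (x + y) = orth_proj S x + orth_proj S y"
    using subspace_add[OF subspace_orthogonal_comp orth_proj_props(2)[of x] orth_proj_props(2)[of y]]
    by (intro orth_proj_eqI S) (auto simp: S subspace_add orth_proj_props algebra_simps)
next
  fix c x
  show "orth_proj S (c *\<^sub>R x) = c *\<^sub>R orth_proj S x"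
    using subspace_scale[OF subspace_orthogonal_comp orth_proj_props(2)[of x], of c]
    by (intro orth_proj_eqI S) (auto simp: S subspace_scale orth_proj_props algebra_simps)
qed

lemma inner_orth_proj: "y \<in> S \<Longrightarrow> inner (orth_proj S x) y = inner x y"
  using orth_proj_props(2)[of x]
  by (auto simp: orthogonal_comp_def orthogonal_def inner_diff_right inner_commute)

lemma norm_orth_proj: "norm (orth_proj S x) \<le> norm x"
proof -
  have "(norm (orth_proj S x))\<^sup>2 = inner x (orth_proj S x)"
    by (metis inner_orth_proj orth_proj_props(1) power2_norm_eq_inner)
  also have "\<dots> \<le> norm x * norm (orth_proj S x)" by (rule norm_cauchy_schwarz)
  finally show ?thesis
    by (metis mult_le_cancel_right norm_ge_zero not_less power2_eq_square less_le mult.commute mult_zero_right)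
qed

end


section \<open>Charts and tangent spaces\<close>

text \<open>Continuity of \<open>D\<close> serves limits of tangent spaces. \<open>Di\<close> is
  \<open>C1\<close> because the derivative of the parametrization enters the critical point
  equation, which the implicit function theorem differentiates once more.\<close>

locale manifold_chart =
  fixes M V W :: "'a::euclidean_space set" and \<phi> \<phi>i :: "'a \<Rightarrow> 'a" and S :: "'a set"
    and D Di :: "'a \<Rightarrow> 'a \<Rightarrow>\<^sub>L 'a"
  assumes open_V: "open V" and open_W: "open W"
    and homeo: "homeomorphism V W \<phi> \<phi>i"
    and der: "\<And>y. y \<in> V \<Longrightarrow> (\<phi> has_derivative blinfun_apply (D y)) (at y)"
    and cont_D: "continuous_on V D"
    and der_inv: "\<And>s. s \<in> W \<Longrightarrow> (\<phi>i has_derivative blinfun_apply (Di s)) (at s)"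
    and C1_Di: "C1_on Di W"
    and subspace_S: "subspace S"
    and flat: "\<phi> ` (M \<inter> V) = S \<inter> W"
begin

lemma \<phi>_in: "y \<in> V \<Longrightarrow> \<phi> y \<in> W" and \<phi>i_in: "s \<in> W \<Longrightarrow> \<phi>i s \<in> V"
  and \<phi>i_\<phi>: "y \<in> V \<Longrightarrow> \<phi>i (\<phi> y) = y" and \<phi>_\<phi>i: "s \<in> W \<Longrightarrow> \<phi> (\<phi>i s) = s"
  using homeo by (auto simp: homeomorphism_def)

lemma \<phi>_in_S: "y \<in> M \<Longrightarrow> y \<in> V \<Longrightarrow> \<phi> y \<in> S"
  using flat by auto

lemma \<phi>i_in_M: "s \<in> S \<Longrightarrow> s \<in> W \<Longrightarrow> \<phi>i s \<in> M"
proof -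
  assume "s \<in> S" "s \<in> W"
  then obtain y where "y \<in> M \<inter> V" "s = \<phi> y" using flat by blast
  then show ?thesis by (simp add: \<phi>i_\<phi>)
qed

lemma cont_\<phi>: "continuous_on V \<phi>"
  using homeo by (simp add: homeomorphism_def)

lemma cont_Di: "continuous_on W Di"
  by (rule C1_on_imp_continuous_on[OF C1_Di])

lemma C1_\<phi>i: "C1_on \<phi>i W"
  using der_inv cont_Di by (rule C1_onI)

lemma Di_D: "Di (\<phi> y) (D y v) = v" if "y \<in> V"
proof -
  have "((\<lambda>y. \<phi>i (\<phi> y)) has_derivative (\<lambda>v. Di (\<phi> y) (D y v))) (at y)"
    using has_derivative_compose[OF der der_inv] that \<phi>_in by blast
  moreover have "((\<lambda>y. \<phi>i (\<phi> y)) has_derivative (\<lambda>v. v)) (at y)"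
    by (rule has_derivative_transform_within_open[OF has_derivative_ident open_V that])
      (simp add: \<phi>i_\<phi>)
  ultimately show ?thesis using has_derivative_unique by metis
qed

lemma D_Di: "D y (Di (\<phi> y) s) = s" if "y \<in> V"
proof -
  have "((\<lambda>s. \<phi> (\<phi>i s)) has_derivative (\<lambda>v. D (\<phi>i (\<phi> y)) (Di (\<phi> y) v))) (at (\<phi> y))"
    using has_derivative_compose[OF der_inv der] that \<phi>_in \<phi>i_in by blast
  moreover have "((\<lambda>s. \<phi> (\<phi>i s)) has_derivative (\<lambda>v. v)) (at (\<phi> y))"
    by (rule has_derivative_transform_within_open[OF has_derivative_ident open_W \<phi>_in[OF that]])
      (simp add: \<phi>_\<phi>i)
  ultimately show ?thesis using has_derivative_unique \<phi>i_\<phi>[OF that] by metis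
qed

text \<open>In the chart a curve in \<open>M\<close> runs in \<open>S\<close>, so its difference
  quotients and their limit \<open>D y v\<close> lie in the closed subspace \<open>S\<close>.
  Conversely, the line through \<open>\<phi> y\<close> with direction \<open>D y v\<close> is pulled
  back to a curve with velocity \<open>v\<close>. The subspace structure, invisible in the
  definition by curves, follows.\<close>

lemma tangent_space_eq:
  assumes "y \<in> M" "y \<in> V"
  shows "tangent_space M y = {v. D y v \<in> S}"
proof (intro set_eqI iffI)
  fix v assume "v \<in> tangent_space M y"
  then obtain \<gamma> e where \<gamma>: "0 < e" "C1_on \<gamma> {-e<..<e}" "\<gamma> ` {-e<..<e} \<subseteq> M" "\<gamma> 0 = y"
    "(\<gamma> has_vector_derivative v) (at 0)"
    by (auto simp: tangent_space_def)
  let ?c = "\<lambda>t. \<phi> (\<gamma> t)"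
  have d: "((\<lambda>t. \<phi> (\<gamma> t)) has_vector_derivative D y v) (at 0)"
    using has_derivative_compose[OF \<gamma>(5)[unfolded has_vector_derivative_def], of \<phi> "D y"] der[OF assms(2)] \<gamma>(4)
    by (simp add: has_vector_derivative_def blinfun.scaleR_right)
  have "isCont \<gamma> 0" using \<gamma>(5) has_vector_derivative_continuous by blast
  then have "eventually (\<lambda>t. \<gamma> t \<in> V) (nhds 0)"
    using open_V assms(2) \<gamma>(4)
    by (metis continuous_at isCont_def tendsto_def tendsto_at_iff_tendsto_nhds)
  moreover have "eventually (\<lambda>t. t \<in> {-e<..<e}) (nhds 0)"
    using \<gamma>(1) by (intro eventually_nhds_in_open) auto
  ultimately have ev: "eventually (\<lambda>t. ?c t \<in> S) (nhds 0)"
    by eventually_elim (use \<gamma>(3) \<phi>_in_S in blast)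
  have "((\<lambda>t. (?c t - ?c 0) /\<^sub>R t) \<longlongrightarrow> D y v) (at 0)"
  proof -
    have "((\<lambda>t. norm (((?c t - ?c 0) - t *\<^sub>R D y v) /\<^sub>R t)) \<longlongrightarrow> 0) (at 0)"
      using d unfolding has_vector_derivative_def has_derivative_at
      by (simp add: divide_inverse_commute)
    then have "((\<lambda>t. ((?c t - ?c 0) - t *\<^sub>R D y v) /\<^sub>R t) \<longlongrightarrow> 0) (at 0)"
      by (rule tendsto_norm_zero_cancel)
    then have "((\<lambda>t. ((?c t - ?c 0) - t *\<^sub>R D y v) /\<^sub>R t + D y v) \<longlongrightarrow> 0 + D y v) (at 0)"
      by (intro tendsto_intros)
    moreover have "eventually (\<lambda>t::real. ((?c t - ?c 0) - t *\<^sub>R D y v) /\<^sub>R t + D y v = (?c t - ?c 0) /\<^sub>R t) (at 0)"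
      unfolding eventually_at_filter by (intro always_eventually) (auto simp: scaleR_diff_right)
    ultimately show ?thesis using tendsto_cong by fastforce
  qed
  moreover have "eventually (\<lambda>t. (?c t - ?c 0) /\<^sub>R t \<in> S) (at 0)"
  proof -
    have "?c 0 \<in> S" using ev eventually_nhds_x_imp_x by blast
    then show ?thesis
      using ev unfolding eventually_at_filter
      by (auto elim!: eventually_mono intro!: subspace_scale subspace_diff subspace_S)
  qed
  ultimately have "D y v \<in> S"
    by (intro Lim_in_closed_set[OF closed_subspace[OF subspace_S]]) auto
  then show "v \<in> {v. D y v \<in> S}" by simp
next
  fix v assume "v \<in> {v. D y v \<in> S}"
  then have S: "D y v \<in> S" by simp
  define l where "l = (\<lambda>t. \<phi> y + t *\<^sub>R D y v)"
  have lS: "l t \<in> S" for t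
    unfolding l_def by (intro subspace_add subspace_scale subspace_S S \<phi>_in_S assms)
  have "open (l -` W)"
    by (rule continuous_open_vimage[OF open_W]) (auto simp: l_def intro!: continuous_intros)
  moreover have "0 \<in> l -` W" by (simp add: l_def \<phi>_in assms)
  ultimately obtain e where e: "e > 0" "ball 0 e \<subseteq> l -` W"
    using open_contains_ball by blast
  have "{-e<..<e} = ball 0 e" by (auto simp: dist_real_def)
  with e have lW: "\<And>t. t \<in> {-e<..<e} \<Longrightarrow> l t \<in> W" by auto
  have "C1_on l {-e<..<e}"
    unfolding l_def
    by (intro C1_on_add C1_on_const C1_on_bounded_linear bounded_linear_scaleR_left)
  then have "C1_on (\<lambda>t. \<phi>i (l t)) {-e<..<e}"
    by (rule C1_on_compose[OF _ C1_\<phi>i lW])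
  moreover have "((\<lambda>t. \<phi>i (l t)) has_vector_derivative v) (at 0)"
  proof -
    have "(l has_derivative (\<lambda>t. t *\<^sub>R D y v)) (at 0)"
      unfolding l_def by (auto intro!: derivative_eq_intros)
    from has_derivative_compose[OF this, of \<phi>i "Di (l 0)"] der_inv[of "l 0"] \<phi>_in assms
    show ?thesis
      by (simp add: l_def has_vector_derivative_def blinfun.scaleR_right Di_D)
  qed
  ultimately show "v \<in> tangent_space M y"
    unfolding tangent_space_def using e(1) lW lS \<phi>i_in_M assms
    by (auto simp: l_def \<phi>i_\<phi> intro!: exI[of _ "\<lambda>t. \<phi>i (l t)"] exI[of _ e])
qed

lemma subspace_tangent_space:
  assumes "y \<in> M" "y \<in> V"
  shows "subspace (tangent_space M y)"
  unfolding tangent_space_eq[OF assms] subspace_def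
  using subspace_S by (auto simp: blinfun.bilinear_simps subspace_0 subspace_add subspace_scale)

text \<open>The approximating vectors are those with the same chart coordinates \<open>D x v\<close>
  as \<open>v\<close>, transported to the base points \<open>X n\<close>. This is what makes limits
  of normal vectors normal.\<close>

lemma tangent_space_inner_limit:
  assumes X: "X \<longlonglongrightarrow> x" "x \<in> M" "x \<in> V" "\<And>n. X n \<in> M" "\<And>n. X n \<in> V"
    and v: "v \<in> tangent_space M x"
  shows "\<exists>\<tau>. (\<forall>n. \<tau> n \<in> tangent_space M (X n)) \<and> \<tau> \<longlonglongrightarrow> v"
proof (intro exI conjI allI)
  let ?\<tau> = "\<lambda>n. Di (\<phi> (X n)) (D x v)"
  have "D x v \<in> S" using v tangent_space_eq X by simp
  then show "?\<tau> n \<in> tangent_space M (X n)" for n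
    using D_Di tangent_space_eq X by simp
  have "(\<lambda>n. \<phi> (X n)) \<longlonglongrightarrow> \<phi> x"
    using cont_\<phi> X by (intro continuous_on_tendsto_compose[OF cont_\<phi>]) auto
  then have "(\<lambda>n. Di (\<phi> (X n))) \<longlonglongrightarrow> Di (\<phi> x)"
    using X \<phi>_in by (intro continuous_on_tendsto_compose[OF cont_Di]) auto
  then have "?\<tau> \<longlonglongrightarrow> Di (\<phi> x) (D x v)" by (intro tendsto_intros)
  then show "?\<tau> \<longlonglongrightarrow> v" using Di_D X by simp
qed

text \<open>The chart coordinates \<open>D (X n) (v n)\<close> stay in the closed set
  \<open>S\<close>. It serves to pass a failure of positive definiteness to the limit.\<close>

lemma tangent_space_outer_limit:
  assumes X: "X \<longlonglongrightarrow> x" "x \<in> M" "x \<in> V" "\<And>n. X n \<in> M" "\<And>n. X n \<in> V"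
    and v: "\<And>n. v n \<in> tangent_space M (X n)" "v \<longlonglongrightarrow> w"
  shows "w \<in> tangent_space M x"
proof -
  have "(\<lambda>n. D (X n)) \<longlonglongrightarrow> D x"
    using X by (intro continuous_on_tendsto_compose[OF cont_D]) auto
  then have "(\<lambda>n. D (X n) (v n)) \<longlonglongrightarrow> D x w" using v(2) by (intro tendsto_intros)
  moreover have "D (X n) (v n) \<in> S" for n using v(1) tangent_space_eq X by auto
  ultimately have "D x w \<in> S"
    by (intro Lim_in_closed_set[OF closed_subspace[OF subspace_S]]) auto
  then show ?thesis using tangent_space_eq X by simp
qed

end

section \<open>Submanifolds, products with an open set, and derivatives along curves\<close>

lemma C2_manifold_at_chart:
  assumes "C2_manifold_at d M x"
  obtains V W \<phi> \<phi>i S D Di where "manifold_chart M V W \<phi> \<phi>i S D Di" "x \<in> V"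
proof -
  from assms[unfolded C2_manifold_at_def] show thesis
  proof (elim exE conjE)
    fix V W \<phi> \<phi>i and S :: "'a set"
    assume c: "open V" "x \<in> V" "open W" "homeomorphism V W \<phi> \<phi>i" "C2_on \<phi> V" "C2_on \<phi>i W"
      "subspace S" "\<phi> ` (M \<inter> V) = S \<inter> W"
    obtain D where D: "\<And>x. x \<in> V \<Longrightarrow> (\<phi> has_derivative blinfun_apply (D x)) (at x)"
      "C1_on D V" using C2_onE[OF c(5)] by blast
    obtain Di where Di: "\<And>x. x \<in> W \<Longrightarrow> (\<phi>i has_derivative blinfun_apply (Di x)) (at x)"
      "C1_on Di W" using C2_onE[OF c(6)] by blast
    have "manifold_chart M V W \<phi> \<phi>i S D Di"
      by unfold_locales (use c D Di C1_on_imp_continuous_on in auto)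
    then show thesis using c(2) by (rule that)
  qed
qed

lemma C2_submanifold_chart:
  assumes "C2_submanifold M" "x \<in> M"
  obtains V W \<phi> \<phi>i S D Di where "manifold_chart M V W \<phi> \<phi>i S D Di" "x \<in> V"
proof -
  obtain d where d: "C2_manifold_at d M x" using assms unfolding C2_submanifold_def by blast
  show thesis by (rule C2_manifold_at_chart[OF d that])
qed

lemma tproj_properties:
  assumes "C2_submanifold M" "x \<in> M"
  shows "linear (tproj M x)" "v \<in> tangent_space M x \<Longrightarrow> tproj M x v = v"
proof -
  obtain V W \<phi> \<phi>i S D Di where "manifold_chart M V W \<phi> \<phi>i S D Di" "x \<in> V"
    by (rule C2_submanifold_chart[OF assms])
  then have "subspace (tangent_space M x)" using manifold_chart.subspace_tangent_space assms(2) by blast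
  then show "linear (tproj M x)" "v \<in> tangent_space M x \<Longrightarrow> tproj M x v = v"
    unfolding tproj_def using linear_orth_proj orth_proj_id by blast+
qed

text \<open>Parameter directions are free because a short straight line through \<open>u\<close>
  stays in the open set \<open>\<Omega>\<close>; the two curves are run on the smaller of their time
  intervals.\<close>

lemma tangent_space_Times:
  fixes M :: "'a::euclidean_space set" and \<Omega> :: "'b::euclidean_space set"
  assumes "open \<Omega>" "u \<in> \<Omega>"
  shows "tangent_space (M \<times> \<Omega>) (x, u) = tangent_space M x \<times> UNIV"
proof (intro set_eqI iffI)
  fix v assume "v \<in> tangent_space (M \<times> \<Omega>) (x, u)"
  then obtain \<gamma> e where \<gamma>: "0 < e" "C1_on \<gamma> {-e<..<e}" "\<gamma> ` {-e<..<e} \<subseteq> M \<times> \<Omega>" "\<gamma> 0 = (x, u)"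
    "(\<gamma> has_vector_derivative v) (at 0)"
    by (auto simp: tangent_space_def)
  have "C1_on (\<lambda>t. fst (\<gamma> t)) {-e<..<e}"
    by (rule C1_on_linear_image[OF bounded_linear_fst \<gamma>(2)])
  moreover have "((\<lambda>t. fst (\<gamma> t)) has_vector_derivative fst v) (at 0)"
    using bounded_linear.has_vector_derivative[OF bounded_linear_fst \<gamma>(5)] .
  moreover have "(\<lambda>t. fst (\<gamma> t)) ` {-e<..<e} \<subseteq> M" using \<gamma>(3) by auto
  ultimately have "fst v \<in> tangent_space M x"
    using \<gamma> unfolding tangent_space_def
    by (auto intro!: exI[of _ "\<lambda>t. fst (\<gamma> t)"] exI[of _ e])
  then show "v \<in> tangent_space M x \<times> UNIV" by (cases v) auto
next
  fix v assume "v \<in> tangent_space M x \<times> (UNIV :: 'b set)"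
  then obtain a b where v: "v = (a, b)" "a \<in> tangent_space M x" by blast
  then obtain \<gamma> e where \<gamma>: "0 < e" "C1_on \<gamma> {-e<..<e}" "\<gamma> ` {-e<..<e} \<subseteq> M" "\<gamma> 0 = x"
    "(\<gamma> has_vector_derivative a) (at 0)"
    by (auto simp: tangent_space_def)
  define l where "l = (\<lambda>t. u + t *\<^sub>R b)"
  have "open (l -` \<Omega>)"
    by (rule continuous_open_vimage[OF assms(1)]) (auto simp: l_def intro!: continuous_intros)
  moreover have "0 \<in> l -` \<Omega>" by (simp add: l_def assms)
  ultimately obtain e' where e': "e' > 0" "ball 0 e' \<subseteq> l -` \<Omega>"
    using open_contains_ball by blast
  have "{-e'<..<e'} = ball 0 e'" by (auto simp: dist_real_def)
  with e' have l\<Omega>: "\<And>t. t \<in> {-e'<..<e'} \<Longrightarrow> l t \<in> \<Omega>" by auto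
  let ?e = "min e e'" and ?c = "\<lambda>t. (\<gamma> t, l t)"
  have "C1_on ?c {-?e<..<?e}"
  proof (rule C1_on_Pair)
    show "C1_on \<gamma> {-?e<..<?e}" by (rule C1_on_subset[OF \<gamma>(2)]) auto
    show "C1_on l {-?e<..<?e}" unfolding l_def
      by (intro C1_on_add C1_on_const C1_on_bounded_linear bounded_linear_scaleR_left)
  qed
  moreover have "?c ` {-?e<..<?e} \<subseteq> M \<times> \<Omega>"
  proof clarify
    fix t assume "t \<in> {-?e<..<?e}"
    then have "t \<in> {-e<..<e}" "t \<in> {-e'<..<e'}" by auto
    then show "\<gamma> t \<in> M \<and> l t \<in> \<Omega>" using \<gamma>(3) l\<Omega> by blast
  qed
  moreover have "(?c has_vector_derivative (a, b)) (at 0)"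
    unfolding l_def
    by (intro has_vector_derivative_Pair \<gamma>) (auto simp: has_vector_derivative_def intro!: derivative_eq_intros)
  ultimately show "v \<in> tangent_space (M \<times> \<Omega>) (x, u)"
    unfolding tangent_space_def v using \<gamma> e'
    by (auto simp: l_def intro!: exI[of _ ?c] exI[of _ ?e])
qed

text \<open>Testing a normal \<open>(a, b)\<close> with the tangent vector \<open>(0, b)\<close>
  gives \<open>inner b b = 0\<close>; this is where \<open>0\<close> must be tangent to
  \<open>M\<close>. The vanishing parameter part later rules out horizontal epigraph normals in the
  lifting of partial subgradients.\<close>

lemma normal_space_Times:
  fixes M :: "'a::euclidean_space set" and \<Omega> :: "'b::euclidean_space set"
  assumes "open \<Omega>" "u \<in> \<Omega>" "0 \<in> tangent_space M x"
  shows "normal_space (M \<times> \<Omega>) (x, u) = normal_space M x \<times> {0}"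
proof -
  have "(a, b) \<in> (tangent_space M x \<times> UNIV)\<^sup>\<bottom> \<longleftrightarrow> a \<in> (tangent_space M x)\<^sup>\<bottom> \<and> b = 0" for a and b :: 'b
  proof
    assume ab: "(a, b) \<in> (tangent_space M x \<times> UNIV)\<^sup>\<bottom>"
    have *: "inner \<tau> a + inner \<beta> b = 0" if "\<tau> \<in> tangent_space M x" for \<tau> \<beta>
      using bspec[OF ab[unfolded orthogonal_comp_def mem_Collect_eq], of "(\<tau>, \<beta>)"] that
      by (simp add: orthogonal_def)
    have "b = 0" using *[OF assms(3), of b] by simp
    moreover have "a \<in> (tangent_space M x)\<^sup>\<bottom>"
      using *[of _ 0] by (simp add: orthogonal_comp_def orthogonal_def)
    ultimately show "a \<in> (tangent_space M x)\<^sup>\<bottom> \<and> b = 0" by simp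
  qed (auto simp: orthogonal_comp_def orthogonal_def)
  then show ?thesis
    unfolding normal_space_def tangent_space_Times[OF assms(1,2)] by auto
qed

text \<open>The restriction of \<open>\<psi>\<close> to the line through \<open>u\<close> with
  direction \<open>h\<close> is an admissible curve in \<open>M\<close>. This allows the tangent
  projection to be inserted into the differentiated fixed point equation.\<close>

lemma C1_on_derivative_in_tangent_space:
  assumes "open U" "u \<in> U" "C1_on \<psi> U" "\<psi> ` U \<subseteq> M" "(\<psi> has_derivative \<psi>') (at u)"
  shows "\<psi>' h \<in> tangent_space M (\<psi> u)"
proof -
  define l where "l = (\<lambda>t. u + t *\<^sub>R h)"
  have "open (l -` U)"
    by (rule continuous_open_vimage[OF assms(1)]) (auto simp: l_def intro!: continuous_intros)
  moreover have "0 \<in> l -` U" by (simp add: l_def assms)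
  ultimately obtain e where e: "e > 0" "ball 0 e \<subseteq> l -` U"
    using open_contains_ball by blast
  have "{-e<..<e} = ball 0 e" by (auto simp: dist_real_def)
  with e have lU: "\<And>t. t \<in> {-e<..<e} \<Longrightarrow> l t \<in> U" by auto
  have "C1_on l {-e<..<e}"
    unfolding l_def
    by (intro C1_on_add C1_on_const C1_on_bounded_linear bounded_linear_scaleR_left)
  then have "C1_on (\<lambda>t. \<psi> (l t)) {-e<..<e}" by (rule C1_on_compose[OF _ assms(3) lU])
  moreover have "((\<lambda>t. \<psi> (l t)) has_vector_derivative \<psi>' h) (at 0)"
  proof -
    have "(l has_derivative (\<lambda>t. t *\<^sub>R h)) (at 0)"
      unfolding l_def by (auto intro!: derivative_eq_intros)
    from has_derivative_compose[OF this, of \<psi> \<psi>'] assms(5)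
    show ?thesis
      by (simp add: l_def has_vector_derivative_def linear_scale[OF has_derivative_linear[OF assms(5)]])
  qed
  moreover have "(\<lambda>t. \<psi> (l t)) ` {-e<..<e} \<subseteq> M" using lU assms(4) by blast
  moreover have "\<psi> (l 0) = \<psi> u" by (simp add: l_def)
  ultimately show ?thesis
    unfolding tangent_space_def using e(1) by blast
qed

text \<open>Fermat's rule along a curve in \<open>M\<close>: composed with the curve,
  \<open>h\<close> has an interior local minimum at time \<open>0\<close>.\<close>

lemma derivative_zero_at_min_on:
  assumes "(h has_derivative h') (at x)" "v \<in> tangent_space M x"
    and "eventually (\<lambda>y. y \<in> M \<longrightarrow> (h x :: real) \<le> h y) (nhds x)"
  shows "h' v = 0"
proof -
  obtain \<gamma> e where \<gamma>: "0 < e" "C1_on \<gamma> {-e<..<e}" "\<gamma> ` {-e<..<e} \<subseteq> M" "\<gamma> 0 = x"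
    "(\<gamma> has_vector_derivative v) (at 0)"
    using assms(2) by (auto simp: tangent_space_def)
  have lin: "linear h'" using assms(1) has_derivative_linear by blast
  have d: "((\<lambda>t. h (\<gamma> t)) has_field_derivative h' v) (at 0)"
    using has_derivative_compose[OF \<gamma>(5)[unfolded has_vector_derivative_def], of h h'] assms(1) \<gamma>(4)
    by (simp add: has_field_derivative_def linear_scale[OF lin] mult.commute mult_commute_abs)
  have "isCont \<gamma> 0" using \<gamma>(5) has_vector_derivative_continuous by blast
  then have "filterlim \<gamma> (nhds x) (nhds 0)"
    unfolding isCont_def tendsto_at_iff_tendsto_nhds by (simp add: \<gamma>(4))
  then have "eventually (\<lambda>t. \<gamma> t \<in> M \<longrightarrow> h x \<le> h (\<gamma> t)) (nhds 0)"
    using assms(3) filterlim_iff by fast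
  moreover have "eventually (\<lambda>t. t \<in> {-e<..<e}) (nhds 0)"
    using \<gamma>(1) by (intro eventually_nhds_in_open) auto
  ultimately have "eventually (\<lambda>t. h (\<gamma> 0) \<le> h (\<gamma> t)) (nhds 0)"
    by eventually_elim (use \<gamma>(3,4) in blast)
  then obtain r where "r > 0" "\<And>t. \<bar>0 - t\<bar> < r \<Longrightarrow> h (\<gamma> 0) \<le> h (\<gamma> t)"
    unfolding eventually_nhds_metric dist_real_def by (metis abs_minus_commute)
  then show ?thesis using DERIV_local_min[OF d] by blast
qed


section \<open>Subdifferentials and the proximal map\<close>

text \<open>Trades an inequality between extended reals for real inequalities over points of the
  epigraph, so that infinite values need no separate cases.\<close>

lemma ereal_le_iff_upper: "ereal r \<le> z \<longleftrightarrow> (\<forall>b. z \<le> ereal b \<longrightarrow> r \<le> b)"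
proof
  assume *: "\<forall>b. z \<le> ereal b \<longrightarrow> r \<le> b"
  show "ereal r \<le> z"
    by (rule ereal_le_real) (use * in auto)
next
  assume "ereal r \<le> z"
  then show "\<forall>b. z \<le> ereal b \<longrightarrow> r \<le> b"
    by (auto dest: order_trans)
qed

lemma mem_convex_subdiff_iff:
  assumes "h x = ereal a"
  shows "v \<in> convex_subdiff h x \<longleftrightarrow> (\<forall>y b. h y \<le> ereal b \<longrightarrow> a + inner v (y - x) \<le> b)"
  by (simp add: convex_subdiff_def assms ereal_le_iff_upper)

lemma mem_regular_subdiff_iff:
  assumes "h x = ereal a"
  shows "v \<in> regular_subdiff h x \<longleftrightarrow>
    (\<forall>e>0. \<forall>\<^sub>F y in nhds x. \<forall>b. h y \<le> ereal b \<longrightarrow> a + (inner v (y - x) - e * norm (y - x)) \<le> b)"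
  by (simp add: regular_subdiff_def assms ereal_le_iff_upper)

text \<open>From left to right, the subgradient inequality at \<open>y\<close> controls every
  epigraph point above \<open>y\<close>. From right to left, a failure at \<open>y\<close> puts
  \<open>(y, b0 y)\<close> into the epigraph, where \<open>b0\<close> is the violated lower bound.
  Its height tends to \<open>a\<close> as \<open>y\<close> tends to \<open>x\<close>, whatever
  \<open>h y\<close> does, so the normal cone inequality applies to it and gives a
  contradiction.\<close>

lemma regular_subdiff_iff_normal_cone_epi:
  assumes "h x = ereal a"
  shows "v \<in> regular_subdiff h x \<longleftrightarrow> (v, -1) \<in> regular_normal_cone (epi h) (x, a)"
proof
  assume v: "v \<in> regular_subdiff h x"
  show "(v, -1) \<in> regular_normal_cone (epi h) (x, a)"
    unfolding regular_normal_cone_def mem_Collect_eq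
  proof (intro allI impI)
    fix e :: real assume "e > 0"
    let ?P = "\<lambda>y. \<forall>b. h y \<le> ereal b \<longrightarrow> a + (inner v (y - x) - e * norm (y - x)) \<le> b"
    have "\<forall>\<^sub>F y in nhds x. ?P y"
      using v \<open>e > 0\<close> mem_regular_subdiff_iff[of h x a v] assms by blast
    moreover have "filterlim fst (nhds x) (at (x, a) within epi h)"
      using tendsto_fst[OF tendsto_ident_at] by fastforce
    ultimately have "\<forall>\<^sub>F p in at (x, a) within epi h. ?P (fst p)"
      unfolding filterlim_iff by blast
    moreover have "\<forall>\<^sub>F p in at (x, a) within epi h. p \<in> epi h"
      by (simp add: eventually_at_filter)
    ultimately show "\<forall>\<^sub>F p in at (x, a) within epi h. inner (v, -1) (p - (x, a)) \<le> e * norm (p - (x, a))"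
    proof eventually_elim
      case (elim p)
      obtain y b where p: "p = (y, b)" by (cases p)
      have "h y \<le> ereal b" using elim(2) p by (simp add: epi_def)
      then have "inner (v, -1) (p - (x, a)) \<le> e * norm (y - x)"
        using elim(1) p by (auto simp: inner_prod_def)
      also have "\<dots> \<le> e * norm (p - (x, a))"
        using \<open>e > 0\<close> norm_fst_le[of "y - x" "b - a"] p by (auto simp: minus_prod_def)
      finally show ?case .
    qed
  qed
next
  assume n: "(v, -1) \<in> regular_normal_cone (epi h) (x, a)"
  show "v \<in> regular_subdiff h x"
    unfolding mem_regular_subdiff_iff[of h, OF assms]
  proof (intro allI impI)
    fix e :: real assume "e > 0"
    define b0 where "b0 = (\<lambda>y. a + (inner v (y - x) - e * norm (y - x)))"
    \<comment> \<open>The distance from \<open>(y, b0 y)\<close> to \<open>(x, a)\<close> is at most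
      \<open>C * norm (y - x)\<close>. The factor 2 in \<open>e'\<close> leaves the bound
      \<open>e / 2\<close>, strictly below \<open>e\<close>.\<close>
    define C where "C = 1 + norm v + e"
    have "C > 0" unfolding C_def using \<open>e > 0\<close> by (simp add: add_pos_nonneg add.commute)
    define e' where "e' = e / (2 * C)"
    have "e' > 0" using \<open>e > 0\<close> \<open>C > 0\<close> by (simp add: e'_def)
    let ?P = "\<lambda>p. p \<noteq> (x, a) \<longrightarrow> p \<in> epi h \<longrightarrow> inner (v, -1) (p - (x, a)) \<le> e' * norm (p - (x, a))"
    have "\<forall>\<^sub>F p in nhds (x, a). ?P p"
      using n \<open>e' > 0\<close> unfolding regular_normal_cone_def eventually_at_filter by blast
    moreover have "filterlim (\<lambda>y. (y, b0 y)) (nhds (x, a)) (nhds x)"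
    proof -
      have "((\<lambda>y. (y, b0 y)) \<longlongrightarrow> (x, a + (inner v (x - x) - e * norm (x - x)))) (nhds x)"
        unfolding b0_def by (intro tendsto_intros filterlim_ident)
      then show ?thesis by simp
    qed
    ultimately have "\<forall>\<^sub>F y in nhds x. ?P (y, b0 y)"
      unfolding filterlim_iff by blast
    then show "\<forall>\<^sub>F y in nhds x. \<forall>b. h y \<le> ereal b \<longrightarrow> a + (inner v (y - x) - e * norm (y - x)) \<le> b"
    proof eventually_elim
      case (elim y)
      show ?case
      proof (intro allI impI, rule ccontr)
        fix b assume b: "h y \<le> ereal b" "\<not> a + (inner v (y - x) - e * norm (y - x)) \<le> b"
        then have "b < b0 y" by (simp add: b0_def)
        have "y \<noteq> x" using b assms by auto
        moreover have "(y, b0 y) \<in> epi h"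
          using b(1) \<open>b < b0 y\<close> by (simp add: epi_def) (meson ereal_less_eq(3) less_imp_le order_trans)
        ultimately have *: "inner (v, -1) ((y, b0 y) - (x, a)) \<le> e' * norm ((y, b0 y) - (x, a))"
          using elim by blast
        have "e * norm (y - x) = inner (v, -1) ((y, b0 y) - (x, a))"
          by (simp add: inner_prod_def b0_def)
        also note *
        also have "norm ((y, b0 y) - (x, a)) \<le> norm (y - x) + \<bar>b0 y - a\<bar>"
          using norm_Pair_le[of "y - x" "b0 y - a"] by (simp add: minus_prod_def)
        also have "\<bar>b0 y - a\<bar> \<le> \<bar>inner v (y - x)\<bar> + e * norm (y - x)"
          using abs_triangle_ineq4[of "inner v (y - x)" "e * norm (y - x)"] \<open>e > 0\<close>
          by (simp add: b0_def abs_mult)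
        also have "\<bar>inner v (y - x)\<bar> \<le> norm v * norm (y - x)" by (rule Cauchy_Schwarz_ineq2)
        also have "e' * (norm (y - x) + (norm v * norm (y - x) + e * norm (y - x)))
           = e / 2 * norm (y - x)"
        proof -
          have "norm (y - x) + (norm v * norm (y - x) + e * norm (y - x)) = C * norm (y - x)"
            by (simp add: C_def algebra_simps)
          then show ?thesis using \<open>C > 0\<close> by (simp add: e'_def)
        qed
        finally have "e * norm (y - x) \<le> e / 2 * norm (y - x)" using \<open>e' > 0\<close> by simp
        then show False using \<open>y \<noteq> x\<close> \<open>e > 0\<close> by simp
      qed
    qed
  qed
qed

lemma regular_subdiff_subset_limiting: "regular_subdiff h x \<subseteq> limiting_subdiff h x"
proof
  fix v assume v: "v \<in> regular_subdiff h x"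
  then have "\<bar>h x\<bar> \<noteq> \<infinity>" by (simp add: regular_subdiff_def)
  moreover have "(\<lambda>_. x) \<longlonglongrightarrow> x \<and> (\<lambda>_. h x) \<longlonglongrightarrow> h x
     \<and> (\<forall>n::nat. v \<in> regular_subdiff h x) \<and> (\<lambda>_. v) \<longlonglongrightarrow> v"
    using v by simp
  ultimately show "v \<in> limiting_subdiff h x"
    unfolding limiting_subdiff_def mem_Collect_eq
    by (intro conjI exI[where x="\<lambda>_. x"] exI[where x="\<lambda>_. v"]) auto
qed

lemma limiting_normal_coneI:
  assumes "\<And>n. X n \<in> C" "X \<longlonglongrightarrow> x" "\<And>n. V n \<in> regular_normal_cone C (X n)" "V \<longlonglongrightarrow> v"
  shows "v \<in> limiting_normal_cone C x"
  using assms unfolding limiting_normal_cone_def by blast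

text \<open>Regular subgradients along a sequence become regular normals \<open>(V n, -1)\<close> to
  the epigraph, and their limit is a limiting normal because the function values converge too.
  Clarke regularity of the epigraph makes it a regular normal.\<close>

lemma limiting_subdiff_eq_regular:
  assumes "regular_fun h x"
  shows "limiting_subdiff h x = regular_subdiff h x"
proof (rule antisym[OF _ regular_subdiff_subset_limiting], rule subsetI)
  fix v assume v: "v \<in> limiting_subdiff h x"
  obtain a where a: "h x = ereal a" using assms unfolding regular_fun_def by (cases "h x") auto
  obtain X V where XV: "X \<longlonglongrightarrow> x" "(\<lambda>n. h (X n)) \<longlonglongrightarrow> h x"
    "\<And>n. V n \<in> regular_subdiff h (X n)" "V \<longlonglongrightarrow> v"
    using v unfolding limiting_subdiff_def by blast
  define A where "A = (\<lambda>n. real_of_ereal (h (X n)))"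
  have A: "h (X n) = ereal (A n)" for n
    using XV(3)[of n] unfolding regular_subdiff_def A_def by (cases "h (X n)") auto
  have "A \<longlonglongrightarrow> a" using XV(2) by (simp add: A a)
  have "(v, -1) \<in> limiting_normal_cone (epi h) (x, a)"
  proof (rule limiting_normal_coneI)
    show "(X n, A n) \<in> epi h" for n by (simp add: epi_def A)
    show "(\<lambda>n. (X n, A n)) \<longlonglongrightarrow> (x, a)" by (intro tendsto_intros XV \<open>A \<longlonglongrightarrow> a\<close>)
    show "(V n, -1) \<in> regular_normal_cone (epi h) (X n, A n)" for n
      using XV(3) regular_subdiff_iff_normal_cone_epi[of h, OF A] by blast
    show "(\<lambda>n. (V n, -1)) \<longlonglongrightarrow> (v, -1)" by (intro tendsto_intros XV)
  qed
  then have "(v, -1) \<in> regular_normal_cone (epi h) (x, a)"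
    using assms a unfolding regular_fun_def clarke_regular_set_def by simp
  then show "v \<in> regular_subdiff h x"
    using regular_subdiff_iff_normal_cone_epi[of h, OF a] by blast
qed

lemma convex_funD:
  assumes "convex_fun h" "h x \<le> ereal a" "h y \<le> ereal b" "0 \<le> t" "t \<le> 1"
  shows "h (x + t *\<^sub>R (y - x)) \<le> ereal (a + t * (b - a))"
proof -
  have "(1 - t) *\<^sub>R (x, a) + t *\<^sub>R (y, b) \<in> epi h"
    using assms by (intro convexD[OF assms(1)[unfolded convex_fun_def]]) (auto simp: epi_def)
  then show ?thesis by (simp add: epi_def algebra_simps)
qed

text \<open>The joint local inequality is read on the segment from \<open>x\<close> to
  \<open>y\<close> at fixed \<open>u\<close>. There convexity bounds \<open>g\<close> by linear
  interpolation, so dividing by \<open>t\<close> turns it into a global inequality with error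
  \<open>e * norm (y - x)\<close> for arbitrary \<open>e > 0\<close>.\<close>

lemma partial_regular_subdiff_convex:
  assumes v: "(v, w) \<in> regular_subdiff g (x, u)" and c: "convex_fun (\<lambda>x. g (x, u))"
  shows "v \<in> convex_subdiff (\<lambda>x. g (x, u)) x"
proof -
  obtain a where a: "g (x, u) = ereal a"
    using v unfolding regular_subdiff_def by (cases "g (x, u)") auto
  show ?thesis
  proof (subst mem_convex_subdiff_iff[of _ _ a], rule a, intro allI impI)
    fix y b assume b: "g (y, u) \<le> ereal b"
    have *: "a + inner v (y - x) \<le> b + e * norm (y - x)" if "e > 0" for e
    proof -
      let ?P = "\<lambda>z. \<forall>b. g z \<le> ereal b \<longrightarrow> a + (inner (v, w) (z - (x, u)) - e * norm (z - (x, u))) \<le> b"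
      let ?c = "\<lambda>t::real. (x + t *\<^sub>R (y - x), u)"
      have "\<forall>\<^sub>F z in nhds (x, u). ?P z"
        using v that mem_regular_subdiff_iff[of g, OF a] by blast
      moreover have "filterlim ?c (nhds (x, u)) (at_right 0)"
      proof -
        have "(?c \<longlongrightarrow> (x + 0 *\<^sub>R (y - x), u)) (at_right 0)" by (intro tendsto_intros)
        then show ?thesis by simp
      qed
      ultimately have "\<forall>\<^sub>F t in at_right 0. ?P (?c t)" unfolding filterlim_iff by blast
      moreover have "\<forall>\<^sub>F t::real in at_right 0. 0 < t \<and> t < 1"
        by (simp add: eventually_at_right_less eventually_conj eventually_at_right_field)
          (use zero_less_one in blast)
      ultimately have "\<forall>\<^sub>F t::real in at_right 0. 0 < t \<and> t < 1 \<and> ?P (?c t)"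
        by eventually_elim simp
      then obtain t :: real where t: "0 < t" "t < 1" "?P (?c t)"
        using eventually_happens' trivial_limit_at_right_real by (metis (mono_tags, lifting))
      have "g (?c t) \<le> ereal (a + t * (b - a))"
        by (rule convex_funD[OF c]) (use a b t in auto)
      then have "a + (inner (v, w) (?c t - (x, u)) - e * norm (?c t - (x, u))) \<le> a + t * (b - a)"
        using t(3) by blast
      moreover have "norm (?c t - (x, u)) = t * norm (y - x)" using t by (simp add: norm_Pair)
      moreover have "inner (v, w) (?c t - (x, u)) = t * inner v (y - x)" by simp
      ultimately have "t * (inner v (y - x) - e * norm (y - x)) \<le> t * (b - a)"
        by (simp add: algebra_simps)
      then show ?thesis using t(1) by simp
    qed
    show "a + inner v (y - x) \<le> b"
    proof (rule field_le_epsilon)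
      fix \<epsilon> :: real assume "\<epsilon> > 0"
      have "norm (y - x) * (\<epsilon> / (1 + norm (y - x))) \<le> \<epsilon>"
        using \<open>\<epsilon> > 0\<close> by (simp add: divide_simps add_pos_nonneg)
      then show "a + inner v (y - x) \<le> b + \<epsilon>"
        using *[of "\<epsilon> / (1 + norm (y - x))"] \<open>\<epsilon> > 0\<close> by (simp add: add_pos_nonneg mult.commute)
    qed
  qed
qed

section \<open>Convex subdifferentials, proximal points and the smooth sum rule\<close>

lemma convex_subdiff_eq_Inter:
  assumes "h x = ereal a"
  shows "convex_subdiff h x = (\<Inter>(y, b)\<in>epi h. {v. inner (y - x) v \<le> b - a})"
  using mem_convex_subdiff_iff[of h, OF assms]
  by (auto simp: epi_def inner_commute algebra_simps)

lemma closed_convex_subdiff: "closed (convex_subdiff h x)"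
  and convex_convex_subdiff: "convex (convex_subdiff h x)"
proof -
  have *: "convex_subdiff h x = {} \<or> (\<exists>a. h x = ereal a)"
    by (cases "h x") (auto simp: convex_subdiff_def)
  show "closed (convex_subdiff h x)"
    using * by (auto simp: convex_subdiff_eq_Inter intro!: closed_INT closed_halfspace_le)
  show "convex (convex_subdiff h x)"
    using * by (auto simp: convex_subdiff_eq_Inter intro!: convex_INT convex_halfspace_le)
qed

lemma convex_subdiff_monotone:
  assumes "v \<in> convex_subdiff h x" "w \<in> convex_subdiff h y"
  shows "0 \<le> inner (v - w) (x - y)"
proof -
  obtain a b where "h x = ereal a" "h y = ereal b"
    using assms unfolding convex_subdiff_def by (cases "h x"; cases "h y") auto
  then have "a + inner v (y - x) \<le> b" "b + inner w (x - y) \<le> a"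
    using assms by (auto simp: mem_convex_subdiff_iff)
  then show ?thesis by (simp add: inner_diff_left inner_diff_right)
qed

text \<open>The subgradient inequality times \<open>\<alpha>\<close> is added to the expansion of
  the square around \<open>x\<close>, and the last quadratic term is the strong convexity gain. It
  yields uniqueness of the proximal point and, later, nondegeneracy of the critical point on
  \<open>M\<close>.\<close>

lemma prox_growth:
  assumes "\<alpha> > 0" "(w - x) /\<^sub>R \<alpha> \<in> convex_subdiff h x" "h x = ereal a" "h y \<le> ereal b"
  shows "\<alpha> * a + (norm (x - w))\<^sup>2 / 2 + (norm (y - x))\<^sup>2 / 2 \<le> \<alpha> * b + (norm (y - w))\<^sup>2 / 2"
proof -
  have "a + inner ((w - x) /\<^sub>R \<alpha>) (y - x) \<le> b"
    using assms by (auto simp: mem_convex_subdiff_iff)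
  then have "\<alpha> * (a + inner ((w - x) /\<^sub>R \<alpha>) (y - x)) \<le> \<alpha> * b" using assms(1) by simp
  then have "\<alpha> * a + inner (w - x) (y - x) \<le> \<alpha> * b"
    using assms(1) by (simp add: distrib_left mult.assoc[symmetric])
  moreover have "(norm (y - w))\<^sup>2 = (norm (x - w))\<^sup>2 + (norm (y - x))\<^sup>2 - 2 * inner (w - x) (y - x)"
    unfolding power2_norm_eq_inner by (simp add: algebra_simps inner_commute)
  ultimately show ?thesis by (simp add: field_simps)
qed

text \<open>By the growth inequality \<open>x\<close> is the strict global minimizer, which
  determines the choice made by \<open>arg_min\<close>.\<close>

lemma prox_eqI:
  assumes "\<alpha> > 0" "(w - x) /\<^sub>R \<alpha> \<in> convex_subdiff (\<lambda>x. g (x, u)) x"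
  shows "prox \<alpha> g (w, u) = x"
proof -
  let ?q = "\<lambda>x. ereal \<alpha> * g (x, u) + ereal ((norm (x - w))\<^sup>2 / 2)"
  obtain a where a: "g (x, u) = ereal a"
    using assms unfolding convex_subdiff_def by (cases "g (x, u)") auto
  have less: "?q x < ?q y" if "y \<noteq> x" for y
  proof (cases "g (y, u)")
    case (real b)
    have "(norm (y - x))\<^sup>2 > 0" using that by simp
    moreover have "\<alpha> * a + (norm (x - w))\<^sup>2 / 2 + (norm (y - x))\<^sup>2 / 2 \<le> \<alpha> * b + (norm (y - w))\<^sup>2 / 2"
      by (rule prox_growth[OF assms a]) (simp add: real)
    ultimately have "\<alpha> * a + (norm (x - w))\<^sup>2 / 2 < \<alpha> * b + (norm (y - w))\<^sup>2 / 2"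
      by linarith
    then show ?thesis by (simp add: a real)
  next
    case PInf
    then show ?thesis using a assms(1) by simp
  next
    case MInf
    \<comment> \<open>A value \<open>-\<infinity>\<close> is refuted by the subgradient inequality,
      which would place one fixed real below every \<open>b\<close>.\<close>
    then have "g (y, u) \<le> ereal b" for b by simp
    then have "a + inner ((w - x) /\<^sub>R \<alpha>) (y - x) \<le> b" for b
      using assms(2) mem_convex_subdiff_iff[of "\<lambda>x. g (x, u)", OF a] by blast
    from this[of "a + inner ((w - x) /\<^sub>R \<alpha>) (y - x) - 1"] show ?thesis by simp
  qed
  show ?thesis
    unfolding prox_def arg_min_def is_arg_min_def prod.case
  proof (rule some_equality)
    show "True \<and> \<not> (\<exists>y. True \<and> ?q y < ?q x)"
    proof (clarsimp simp del: not_less)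
      fix y assume "?q y < ?q x"
      then show False using less[of y] by (cases "y = x") auto
    qed
    show "y = x" if "True \<and> \<not> (\<exists>z. True \<and> ?q z < ?q y)" for y
      using that less[of y] by blast
  qed
qed

text \<open>Both directions work with the difference quotient of \<open>\<phi>\<close> along the
  segment to \<open>y\<close>. Convexity of \<open>h\<close> bounds the quotient from below and
  gives the forward direction as \<open>t\<close> tends to \<open>0\<close>; convexity of
  \<open>\<phi>\<close> bounds it from above by \<open>\<phi> y - \<phi> x\<close> and gives the
  converse.\<close>

lemma convex_subdiff_add_smooth:
  assumes h: "convex_fun h" and \<phi>: "convex_on UNIV \<phi>" and d: "GDERIV \<phi> x :> d"
  shows "v \<in> convex_subdiff (\<lambda>y. ereal (\<phi> y) + h y) x \<longleftrightarrow> v - d \<in> convex_subdiff h x"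
proof (cases "\<exists>a. h x = ereal a")
  case False
  then have "\<bar>h x\<bar> = \<infinity>" "\<bar>ereal (\<phi> x) + h x\<bar> = \<infinity>" by (cases "h x"; auto)+
  then show ?thesis by (simp add: convex_subdiff_def)
next
  case True
  then obtain a where a: "h x = ereal a" by blast
  have der: "((\<lambda>t. \<phi> (x + t *\<^sub>R (y - x))) has_field_derivative inner d (y - x)) (at 0)" for y
  proof -
    have "((\<lambda>t. x + t *\<^sub>R (y - x)) has_derivative (\<lambda>t. t *\<^sub>R (y - x))) (at 0)"
      by (auto intro!: derivative_eq_intros)
    from has_derivative_compose[OF this, of \<phi> "\<lambda>h. inner h d"] d
    show ?thesis
      by (simp add: gderiv_def has_field_derivative_def inner_commute mult_commute_abs)
  qed
  then have lim: "((\<lambda>t. (\<phi> (x + t *\<^sub>R (y - x)) - \<phi> x) / t) \<longlongrightarrow> inner d (y - x)) (at_right 0)" for y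
    unfolding has_field_derivative_iff by (force intro: tendsto_within_subset)
  have ev: "\<forall>\<^sub>F t::real in at_right 0. 0 < t \<and> t < 1"
    by (simp add: eventually_at_right_less eventually_conj eventually_at_right_field)
      (use zero_less_one in blast)
  have aF: "ereal (\<phi> x) + h x = ereal (\<phi> x + a)" using a by simp
  show ?thesis
    unfolding mem_convex_subdiff_iff[of h, OF a] mem_convex_subdiff_iff[of "\<lambda>y. ereal (\<phi> y) + h y", OF aF]
  proof (intro iffI allI impI)
    fix y b
    assume *: "\<forall>y b. ereal (\<phi> y) + h y \<le> ereal b \<longrightarrow> \<phi> x + a + inner v (y - x) \<le> b" and b: "h y \<le> ereal b"
    have "\<forall>\<^sub>F t in at_right 0. a + inner v (y - x) - b \<le> (\<phi> (x + t *\<^sub>R (y - x)) - \<phi> x) / t"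
      using ev
    proof eventually_elim
      case (elim t)
      let ?y = "x + t *\<^sub>R (y - x)"
      have "h ?y \<le> ereal (a + t * (b - a))"
        by (rule convex_funD[OF h]) (use a b elim in auto)
      then have "ereal (\<phi> ?y) + h ?y \<le> ereal (\<phi> ?y + (a + t * (b - a)))"
        by (metis add_left_mono plus_ereal.simps(1))
      with * have "\<phi> x + a + inner v (?y - x) \<le> \<phi> ?y + (a + t * (b - a))" by blast
      then have "t * (a + inner v (y - x) - b) \<le> \<phi> ?y - \<phi> x" by (simp add: algebra_simps)
      then show ?case using elim by (simp add: pos_le_divide_eq mult.commute)
    qed
    then have "a + inner v (y - x) - b \<le> inner d (y - x)"
      using tendsto_lowerbound[OF lim] by simp
    then show "a + inner (v - d) (y - x) \<le> b" by (simp add: inner_diff_left)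
  next
    fix y b
    assume *: "\<forall>y b. h y \<le> ereal b \<longrightarrow> a + inner (v - d) (y - x) \<le> b" and b: "ereal (\<phi> y) + h y \<le> ereal b"
    have "\<forall>\<^sub>F t in at_right 0. (\<phi> (x + t *\<^sub>R (y - x)) - \<phi> x) / t \<le> \<phi> y - \<phi> x"
      using ev
    proof eventually_elim
      case (elim t)
      have "\<phi> ((1 - t) *\<^sub>R x + t *\<^sub>R y) \<le> (1 - t) * \<phi> x + t * \<phi> y"
        by (rule convex_onD[OF \<phi>]) (use elim in auto)
      then have "\<phi> (x + t *\<^sub>R (y - x)) - \<phi> x \<le> t * (\<phi> y - \<phi> x)" by (simp add: algebra_simps)
      then show ?case using elim by (simp add: pos_divide_le_eq mult.commute)
    qed
    then have "inner d (y - x) \<le> \<phi> y - \<phi> x"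
      using tendsto_upperbound[OF lim] by simp
    moreover have "h y \<le> ereal (b - \<phi> y)"
      using b by (cases "h y") auto
    then have "a + inner (v - d) (y - x) \<le> b - \<phi> y" using * by blast
    ultimately show "\<phi> x + a + inner v (y - x) \<le> b" by (simp add: inner_diff_left)
  qed
qed


section \<open>Partial subdifferentials of regular functions\<close>

lemma regular_normal_cone_add:
  assumes "v \<in> regular_normal_cone C x" "w \<in> regular_normal_cone C x"
  shows "v + w \<in> regular_normal_cone C x"
  unfolding regular_normal_cone_def mem_Collect_eq
proof (intro allI impI)
  fix e :: real assume "e > 0"
  then have "\<forall>\<^sub>F y in at x within C. inner v (y - x) \<le> e / 2 * norm (y - x)"
    "\<forall>\<^sub>F y in at x within C. inner w (y - x) \<le> e / 2 * norm (y - x)"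
    using assms half_gt_zero[OF \<open>e > 0\<close>] unfolding regular_normal_cone_def by blast+
  then show "\<forall>\<^sub>F y in at x within C. inner (v + w) (y - x) \<le> e * norm (y - x)"
    by eventually_elim (simp add: inner_add_left)
qed

lemma regular_normal_cone_scale:
  assumes "v \<in> regular_normal_cone C x" "c > 0"
  shows "c *\<^sub>R v \<in> regular_normal_cone C x"
  unfolding regular_normal_cone_def mem_Collect_eq
proof (intro allI impI)
  fix e :: real assume "e > 0"
  then have "\<forall>\<^sub>F y in at x within C. inner v (y - x) \<le> e / c * norm (y - x)"
    using assms divide_pos_pos[OF \<open>e > 0\<close> assms(2)] unfolding regular_normal_cone_def by blast
  then show "\<forall>\<^sub>F y in at x within C. inner (c *\<^sub>R v) (y - x) \<le> e * norm (y - x)"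
  proof eventually_elim
    case (elim y)
    then show ?case using assms(2) by (simp add: pos_le_divide_eq mult.commute)
  qed
qed

text \<open>A quadratic error is \<open>o(norm (p - z))\<close>, so a proximal normal is a regular
  normal. Minimality of a penalized function provides exactly this quadratic form of the
  inequality.\<close>

lemma regular_normal_cone_local_min:
  assumes "open B" "z \<in> B" and min: "\<And>p. p \<in> C \<Longrightarrow> p \<in> B \<Longrightarrow> inner N (p - z) \<le> K * (norm (p - z))\<^sup>2"
  shows "N \<in> regular_normal_cone C z"
  unfolding regular_normal_cone_def mem_Collect_eq
proof (intro allI impI)
  fix e :: real assume "e > 0"
  have "((\<lambda>p. K * norm (p - z)) \<longlongrightarrow> K * norm (z - z)) (at z within C)"
    by (intro tendsto_intros)
  then have "\<forall>\<^sub>F p in at z within C. K * norm (p - z) < e"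
    using \<open>e > 0\<close> order_tendstoD(2) by fastforce
  moreover have "\<forall>\<^sub>F p in at z within C. p \<in> B \<and> p \<in> C"
    using eventually_nhds_in_open[OF assms(1,2)] unfolding eventually_at_filter
    by (auto elim: eventually_mono)
  ultimately show "\<forall>\<^sub>F p in at z within C. inner N (p - z) \<le> e * norm (p - z)"
  proof eventually_elim
    case (elim p)
    have "inner N (p - z) \<le> (K * norm (p - z)) * norm (p - z)"
      using min[of p] elim by (simp add: power2_eq_square)
    also have "\<dots> \<le> e * norm (p - z)" using elim by (intro mult_right_mono) auto
    finally show ?case .
  qed
qed

text \<open>
  Penalization: \<open>J\<close> adds \<open>k/2 |w - u|^2\<close> to the tilted epigraph height, and its minimizers over a
  compact piece of the epigraph converge to the base point and yield normal vectors there. If the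
  penalty gradients \<open>b\<close> blow up, normalizing produces a horizontal normal \<open>((0, - b0), 0)\<close>, which the
  hypothesis on \<open>par\<close> excludes.
\<close>

lemma convex_subdiff_lift:
  fixes g :: "'x::euclidean_space \<times> 'u::euclidean_space \<Rightarrow> ereal"
  assumes reg: "regular_fun g (x, u)" and ne: "limiting_subdiff g (x, u) \<noteq> {}"
    and par: "\<And>w. (0, w) \<in> par (limiting_subdiff g (x, u)) \<Longrightarrow> w = 0"
    and v: "v \<in> convex_subdiff (\<lambda>y. g (y, u)) x"
  shows "\<exists>w. (v, w) \<in> limiting_subdiff g (x, u)"
proof -
  obtain a where a: "g (x, u) = ereal a" using reg unfolding regular_fun_def by (cases "g (x, u)") auto
  let ?z0 = "((x, u), a)"
  obtain r where r: "r > 0" "closed (epi g \<inter> cball ?z0 r)"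
    and cone: "limiting_normal_cone (epi g) ?z0 = regular_normal_cone (epi g) ?z0"
    and z0: "?z0 \<in> epi g"
    using reg a unfolding regular_fun_def clarke_regular_set_def by auto
  let ?K = "epi g \<inter> cball ?z0 r"
  have K: "compact ?K" using r compact_Int_closed[OF compact_cball]
    by (metis bounded_Int bounded_cball compact_eq_bounded_closed)
  define J where "J = (\<lambda>k ((y, w), \<rho>). (\<rho> - a) - inner v (y - x) + (norm (y - x))\<^sup>2 / 2
      + k / 2 * (norm (w - u))\<^sup>2 + (\<rho> - a)\<^sup>2 / 2 :: real)"
  have J: "J k z = (snd z - a) - inner v (fst (fst z) - x) + (norm (fst (fst z) - x))\<^sup>2 / 2
      + k / 2 * (norm (snd (fst z) - u))\<^sup>2 + (snd z - a)\<^sup>2 / 2" for k z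
    by (simp add: J_def split: prod.splits)
  have contJ: "continuous_on A (J k)" for A k
    unfolding J by (intro continuous_intros) auto
  have "\<exists>z\<in>?K. \<forall>p\<in>?K. J (real n) z \<le> J (real n) p" for n
    using continuous_attains_inf[OF K _ contJ] z0 r(1) by (metis IntI centre_in_cball empty_iff less_imp_le)
  then obtain z where z: "\<And>n. z n \<in> ?K" and zmin: "\<And>n p. p \<in> ?K \<Longrightarrow> J (real n) (z n) \<le> J (real n) p"
    by metis
  obtain zl \<sigma> where zl: "zl \<in> ?K" "strict_mono \<sigma>" "(z \<circ> \<sigma>) \<longlonglongrightarrow> zl"
    by (rule compact_subseq[OF K z])
  have Jz: "J (real n) (z n) \<le> 0" for n
    using zmin[of ?z0 n] z0 r(1) by (simp add: J)
  \<comment> \<open>Dropping the nonnegative penalty leaves a function independent of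
    \<open>n\<close>, so the bound survives the limit.\<close>
  have lim0: "J 0 zl \<le> 0"
  proof (rule tendsto_upperbound)
    show "((\<lambda>n. J 0 ((z \<circ> \<sigma>) n)) \<longlongrightarrow> J 0 zl) sequentially"
      using continuous_on_tendsto_compose[OF contJ[of UNIV] zl(3)] by simp
    show "\<forall>\<^sub>F n in sequentially. J 0 ((z \<circ> \<sigma>) n) \<le> 0"
    proof (intro always_eventually allI)
      fix n
      have "J 0 ((z \<circ> \<sigma>) n) \<le> J (real (\<sigma> n)) (z (\<sigma> n))" by (simp add: J)
      then show "J 0 ((z \<circ> \<sigma>) n) \<le> 0" using Jz[of "\<sigma> n"] by linarith
    qed
  qed simp
  have zl_u: "snd (fst zl) = u"
  proof -
    \<comment> \<open>Since \<open>J \<le> 0\<close> at the minimizers, the penalty is at most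
      \<open>norm v * r + r\<close> inside the ball of radius \<open>r\<close>; the factor 2 clears
      the one half.\<close>
    let ?C = "2 * (r + norm v * r)"
    have bd: "real n * (norm (snd (fst (z n)) - u))\<^sup>2 \<le> ?C" for n
    proof -
      have "dist (z n) ?z0 \<le> r" using z[of n] by (simp add: dist_commute)
      then have d: "norm (fst (z n) - (x, u)) \<le> r" "\<bar>snd (z n) - a\<bar> \<le> r"
        using dist_fst_le[of "z n" ?z0] dist_snd_le[of "z n" ?z0] by (auto simp: dist_norm)
      then have d1: "norm (fst (fst (z n)) - x) \<le> r"
        using norm_fst_le[of "fst (fst (z n)) - x" "snd (fst (z n)) - u"]
        by (metis (no_types, lifting) diff_Pair order_trans prod.collapse)
      have "inner v (fst (fst (z n)) - x) \<le> norm v * norm (fst (fst (z n)) - x)"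
        by (rule norm_cauchy_schwarz)
      also have "\<dots> \<le> norm v * r" using d1 by (intro mult_left_mono) auto
      finally have "inner v (fst (fst (z n)) - x) \<le> norm v * r" .
      moreover have "0 \<le> (norm (fst (fst (z n)) - x))\<^sup>2 / 2" "0 \<le> (snd (z n) - a)\<^sup>2 / 2" by simp_all
      ultimately have "real n / 2 * (norm (snd (fst (z n)) - u))\<^sup>2 \<le> r + norm v * r"
        using Jz[of n, unfolded J] d(2) by linarith
      then show ?thesis by simp
    qed
    have "(\<lambda>n. (norm (snd (fst ((z \<circ> \<sigma>) n)) - u))\<^sup>2) \<longlonglongrightarrow> (norm (snd (fst zl) - u))\<^sup>2"
      by (intro tendsto_intros zl)
    moreover have "(\<lambda>n. (norm (snd (fst ((z \<circ> \<sigma>) n)) - u))\<^sup>2) \<longlonglongrightarrow> 0"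
    proof (rule tendsto_sandwich[where f="\<lambda>_. 0"])
      show "(\<lambda>n. ?C / real (\<sigma> n)) \<longlonglongrightarrow> 0"
        using LIMSEQ_subseq_LIMSEQ[OF lim_const_over_n[of ?C] zl(2)] by (simp add: o_def)
      show "\<forall>\<^sub>F n in sequentially. (norm (snd (fst ((z \<circ> \<sigma>) n)) - u))\<^sup>2 \<le> ?C / real (\<sigma> n)"
        using eventually_gt_at_top[of 0]
      proof eventually_elim
        case (elim n)
        then have "\<sigma> n > 0" using seq_suble[OF zl(2), of n] by linarith
        then show ?case using bd[of "\<sigma> n"] by (simp add: pos_le_divide_eq mult.commute)
      qed
    qed auto
    ultimately have "(norm (snd (fst zl) - u))\<^sup>2 = 0" by (rule LIMSEQ_unique)
    then show ?thesis by simp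
  qed
  \<comment> \<open>At parameter \<open>u\<close> the subgradient inequality makes the linear part
    of \<open>J\<close> nonnegative, so \<open>J 0 zl \<le> 0\<close> forces both remaining squares
    to vanish.\<close>
  have zl_eq: "zl = ?z0"
  proof -
    obtain y \<rho> where y: "zl = ((y, u), \<rho>)" using zl_u by (metis prod.collapse)
    have "g (y, u) \<le> ereal \<rho>" using zl(1) y by (simp add: epi_def)
    then have "a + inner v (y - x) \<le> \<rho>"
      using v mem_convex_subdiff_iff[of "\<lambda>y. g (y, u)", OF a] by blast
    moreover have "0 \<le> (norm (y - x))\<^sup>2 / 2" "0 \<le> (\<rho> - a)\<^sup>2 / 2" by simp_all
    moreover have "(\<rho> - a) - inner v (y - x) + (norm (y - x))\<^sup>2 / 2 + (\<rho> - a)\<^sup>2 / 2 \<le> 0"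
      using lim0 y by (simp add: J)
    ultimately have "(norm (y - x))\<^sup>2 / 2 = 0 \<and> (\<rho> - a)\<^sup>2 / 2 = 0" by linarith
    then show ?thesis using y by simp
  qed
  define b where "b = (\<lambda>n. real n *\<^sub>R (snd (fst (z n)) - u))"
  \<comment> \<open>\<open>N n\<close> is the negative gradient of \<open>J (real n)\<close> at
    \<open>z n\<close>. As \<open>J\<close> is quadratic, the expansion around \<open>z n\<close> is
    exact, with remainder at most \<open>(1 + real n) / 2\<close> times the squared
    distance.\<close>
  define N where "N = (\<lambda>n. ((v - (fst (fst (z n)) - x), - b n), - 1 - (snd (z n) - a)))"
  have normal: "N n \<in> regular_normal_cone (epi g) (z n)" if "z n \<in> ball ?z0 r" for n
  proof (rule regular_normal_cone_local_min[OF open_ball that])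
    fix p assume "p \<in> epi g" "p \<in> ball ?z0 r"
    then have "J (real n) (z n) \<le> J (real n) p" by (intro zmin) auto
    obtain y w \<rho> where zn: "z n = ((y, w), \<rho>)" by (metis prod.collapse)
    obtain y' w' \<rho>' where p: "p = ((y', w'), \<rho>')" by (metis prod.collapse)
    have sq: "(norm (y' - x))\<^sup>2 = (norm (y - x))\<^sup>2 + 2 * inner (y - x) (y' - y) + (norm (y' - y))\<^sup>2"
      "(norm (w' - u))\<^sup>2 = (norm (w - u))\<^sup>2 + 2 * inner (w - u) (w' - w) + (norm (w' - w))\<^sup>2"
      unfolding power2_norm_eq_inner by (simp_all add: algebra_simps inner_commute)
    have "inner (N n) (p - z n) = inner (v - (y - x)) (y' - y) - real n * inner (w - u) (w' - w)
        - (1 + (\<rho> - a)) * (\<rho>' - \<rho>)"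
      by (simp add: N_def b_def zn p algebra_simps)
    also have "\<dots> = J (real n) (z n) - J (real n) p + (norm (y' - y))\<^sup>2 / 2
        + real n / 2 * (norm (w' - w))\<^sup>2 + (\<rho>' - \<rho>)\<^sup>2 / 2"
      unfolding J zn p fst_conv snd_conv sq
      by (simp add: algebra_simps power2_eq_square add_divide_distrib diff_divide_distrib)
    also have "\<dots> \<le> (norm (y' - y))\<^sup>2 / 2 + real n / 2 * (norm (w' - w))\<^sup>2 + (\<rho>' - \<rho>)\<^sup>2 / 2"
      using \<open>J (real n) (z n) \<le> J (real n) p\<close> by simp
    also have "\<dots> \<le> (1 + real n) / 2 * (norm (y' - y))\<^sup>2 + (1 + real n) / 2 * (norm (w' - w))\<^sup>2
        + (1 + real n) / 2 * (\<rho>' - \<rho>)\<^sup>2"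
      by (intro add_mono) (auto simp: field_simps)
    also have "\<dots> = (1 + real n) / 2 * (norm (p - z n))\<^sup>2"
      by (simp add: zn p norm_Pair distrib_left)
    finally show "inner (N n) (p - z n) \<le> (1 + real n) / 2 * (norm (p - z n))\<^sup>2" .
  qed
  \<comment> \<open>Chosen so that \<open>c n\<close> and the norm of
    \<open>c n *\<^sub>R b n\<close> add up to 1: both are bounded, and their limits
    \<open>c0\<close> and \<open>b0\<close> cannot vanish together.\<close>
  define c where "c = (\<lambda>n. 1 / (1 + norm (b n)))"
  have c01: "0 < c n" "c n \<le> 1" for n by (simp_all add: c_def add_pos_nonneg)
  have cb: "norm (c n *\<^sub>R b n) = 1 - c n" for n
    by (simp add: c_def divide_simps add_pos_nonneg add_nonneg_eq_0_iff)
  let ?t = "\<lambda>n. (c (\<sigma> n), c (\<sigma> n) *\<^sub>R b (\<sigma> n))"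
  have t: "?t n \<in> cball 0 1 \<times> cball 0 1" for n using c01[of "\<sigma> n"] cb[of "\<sigma> n"] by auto
  have "compact (cball (0::real) 1 \<times> cball (0::'u) 1)" by (intro compact_Times compact_cball)
  then obtain tl \<tau> where \<tau>: "strict_mono \<tau>" "(?t \<circ> \<tau>) \<longlonglongrightarrow> tl"
    by (rule compact_subseq[OF _ t])
  define \<kappa> where "\<kappa> = \<sigma> \<circ> \<tau>"
  obtain c0 b0 where tl: "tl = (c0, b0)" by (cases tl)
  have cl: "(\<lambda>n. c (\<kappa> n)) \<longlonglongrightarrow> c0" and bl: "(\<lambda>n. c (\<kappa> n) *\<^sub>R b (\<kappa> n)) \<longlonglongrightarrow> b0"
    using tendsto_fst[OF \<tau>(2)] tendsto_snd[OF \<tau>(2)] by (simp_all add: \<kappa>_def o_def tl)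
  have zk: "(\<lambda>n. z (\<kappa> n)) \<longlonglongrightarrow> ?z0"
    using LIMSEQ_subseq_LIMSEQ[OF zl(3) \<tau>(1)] by (simp add: \<kappa>_def o_def zl_eq)
  have nb: "norm b0 = 1 - c0"
  proof (rule LIMSEQ_unique)
    show "(\<lambda>n. norm (c (\<kappa> n) *\<^sub>R b (\<kappa> n))) \<longlonglongrightarrow> norm b0" by (intro tendsto_intros bl)
    show "(\<lambda>n. norm (c (\<kappa> n) *\<^sub>R b (\<kappa> n))) \<longlonglongrightarrow> 1 - c0" unfolding cb by (intro tendsto_intros cl)
  qed
  have c0: "c0 \<ge> 0" by (rule LIMSEQ_le_const[OF cl]) (use c01(1) less_imp_le in blast)
  have "\<forall>\<^sub>F n in sequentially. z (\<kappa> n) \<in> ball ?z0 r"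
    using topological_tendstoD[OF zk open_ball] r(1) by simp
  then obtain m where m: "\<And>n. n \<ge> m \<Longrightarrow> z (\<kappa> n) \<in> ball ?z0 r"
    unfolding eventually_sequentially by blast
  have "((c0 *\<^sub>R v, - b0), - c0) \<in> limiting_normal_cone (epi g) ?z0"
  proof (rule limiting_normal_coneI)
    show "z (\<kappa> (n + m)) \<in> epi g" for n using z by blast
    show "(\<lambda>n. z (\<kappa> (n + m))) \<longlonglongrightarrow> ?z0" by (rule LIMSEQ_ignore_initial_segment[OF zk])
    show "c (\<kappa> (n + m)) *\<^sub>R N (\<kappa> (n + m)) \<in> regular_normal_cone (epi g) (z (\<kappa> (n + m)))" for n
      by (intro regular_normal_cone_scale normal m c01) simp
    have "(\<lambda>n. c (\<kappa> n) *\<^sub>R N (\<kappa> n)) \<longlonglongrightarrow> ((c0 *\<^sub>R (v - (x - x)), - b0), c0 * (- 1 - (a - a)))"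
    proof -
      have "(\<lambda>n. ((c (\<kappa> n) *\<^sub>R (v - (fst (fst (z (\<kappa> n))) - x)), - (c (\<kappa> n) *\<^sub>R b (\<kappa> n))),
          c (\<kappa> n) * (- 1 - (snd (z (\<kappa> n)) - a)))) \<longlonglongrightarrow> ((c0 *\<^sub>R (v - (fst (fst ?z0) - x)), - b0), c0 * (- 1 - (snd ?z0 - a)))"
        by (intro tendsto_intros cl bl zk)
      then show ?thesis by (simp add: N_def)
    qed
    from LIMSEQ_ignore_initial_segment[OF this, of m]
    show "(\<lambda>n. c (\<kappa> (n + m)) *\<^sub>R N (\<kappa> (n + m))) \<longlonglongrightarrow> ((c0 *\<^sub>R v, - b0), - c0)" by simp
  qed
  then have lim: "((c0 *\<^sub>R v, - b0), - c0) \<in> regular_normal_cone (epi g) ?z0" using cone by simp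
  have sub: "q \<in> limiting_subdiff g (x, u) \<longleftrightarrow> (q, -1) \<in> regular_normal_cone (epi g) ?z0" for q
    unfolding limiting_subdiff_eq_regular[OF reg]
    by (rule regular_subdiff_iff_normal_cone_epi[of g, OF a])
  show ?thesis
  proof (cases "c0 = 0")
    case False
    then have "c0 > 0" using c0 by simp
    then have "((v, - b0 /\<^sub>R c0), -1) \<in> regular_normal_cone (epi g) ?z0"
      using regular_normal_cone_scale[OF lim, of "inverse c0"] by simp
    then show ?thesis using sub by blast
  next
    case True
    obtain v1 w1 where vw: "(v1, w1) \<in> limiting_subdiff g (x, u)" using ne by auto
    \<comment> \<open>Adding the horizontal normal to that of an existing subgradient yields a
      second subgradient. The two differ only in the parameter, by \<open>b0\<close>, against
      \<open>norm b0 = 1\<close>.\<close>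
    have "((v1, w1), -1) + ((0, - b0), 0) \<in> regular_normal_cone (epi g) ?z0"
      using regular_normal_cone_add vw lim True unfolding sub by fastforce
    then have "(v1, w1 - b0) \<in> limiting_subdiff g (x, u)" unfolding sub by simp
    then have "(v1, w1) - (v1, w1 - b0) \<in> par (limiting_subdiff g (x, u))"
      using vw unfolding par_def by (blast intro: hull_inc)
    then have "b0 = 0" using par[of b0] by simp
    then show ?thesis using nb True by simp
  qed
qed


section \<open>Smooth convex functions\<close>

lemma GDERIV_unique: "GDERIV h x :> d \<Longrightarrow> GDERIV h x :> d' \<Longrightarrow> d = d'"
  unfolding gderiv_def by (metis has_derivative_unique vector_eq_ldot)

lemma grad_eqI: "GDERIV h x :> d \<Longrightarrow> grad h x = d"
  unfolding grad_def using GDERIV_unique by blast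

text \<open>Evaluating the full derivative at the vectors \<open>(b, 0)\<close> produces the
  gradient in \<open>x\<close> as a field that is \<open>C1\<close> jointly in \<open>x\<close> and
  \<open>u\<close>.\<close>

lemma C2_on_partial_gradient:
  fixes k :: "'x::euclidean_space \<times> 'u::euclidean_space \<Rightarrow> real"
  assumes "C2_on k V"
  obtains G where "C1_on G V" "\<And>x u. (x, u) \<in> V \<Longrightarrow> GDERIV (\<lambda>y. k (y, u)) x :> G (x, u)"
proof -
  obtain k' where k: "\<And>z. z \<in> V \<Longrightarrow> (k has_derivative blinfun_apply (k' z)) (at z)" "C1_on k' V"
    using C2_onE[OF assms] by blast
  define G where "G = (\<lambda>z. \<Sum>b\<in>Basis. k' z (b, 0) *\<^sub>R b)"
  have "C1_on G V"
    unfolding G_def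
    by (intro C1_on_sum C1_on_linear_image[OF _ k(2)] bounded_linear_compose[OF bounded_linear_scaleR_left]
        blinfun.bounded_linear_left) simp
  moreover have "GDERIV (\<lambda>y. k (y, u)) x :> G (x, u)" if "(x, u) \<in> V" for x u
  proof -
    have "((\<lambda>y. (y, u)) has_derivative (\<lambda>h. (h, 0))) (at x)"
      by (auto intro!: derivative_eq_intros)
    from has_derivative_compose[OF this k(1)[OF that]]
    have d: "((\<lambda>y. k (y, u)) has_derivative (\<lambda>h. k' (x, u) (h, 0))) (at x)" .
    have "k' (x, u) (h, 0) = inner h (G (x, u))" for h
    proof -
      interpret linear "\<lambda>h. k' (x, u) (h, 0)"
        using d has_derivative_linear by blast
      have "k' (x, u) (\<Sum>b\<in>Basis. inner h b *\<^sub>R b, 0) = (\<Sum>b\<in>Basis. inner h b * k' (x, u) (b, 0))"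
        unfolding sum by (simp add: scale)
      then show ?thesis
        by (simp add: G_def inner_sum_right euclidean_representation mult.commute)
    qed
    with d show ?thesis by (simp add: gderiv_def)
  qed
  ultimately show ?thesis by (rule that)
qed

lemma C2_on_UNIV_partial_gradient:
  fixes k :: "'x::euclidean_space \<times> 'u::euclidean_space \<Rightarrow> real"
  assumes "C2_on k UNIV"
  shows "\<exists>G. C1_on G UNIV \<and> (\<forall>x u. GDERIV (\<lambda>y. k (y, u)) x :> G (x, u))"
  by (rule C2_on_partial_gradient[OF assms]) (intro exI conjI allI, assumption, simp)

text \<open>An instance of the smooth sum rule with the zero function as second summand.\<close>

lemma convex_on_above_tangent:
  assumes "convex_on UNIV \<phi>" "GDERIV \<phi> x :> d"
  shows "\<phi> x + inner d (y - x) \<le> \<phi> (y :: 'a::euclidean_space)"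
proof -
  have "epi (\<lambda>_::'a. 0 :: ereal) = UNIV \<times> {0..}"
    by (auto simp: epi_def simp flip: zero_ereal_def)
  then have "convex_fun (\<lambda>_::'a. 0 :: ereal)"
    by (simp add: convex_fun_def convex_Times)
  moreover have "d - d \<in> convex_subdiff (\<lambda>_. 0) x" by (simp add: convex_subdiff_def)
  ultimately have "d \<in> convex_subdiff (\<lambda>y. ereal (\<phi> y) + 0) x"
    using convex_subdiff_add_smooth[OF _ assms] by blast
  then show ?thesis by (simp add: convex_subdiff_def)
qed

text \<open>\<open>?\<psi>\<close> subtracts the linear and quadratic terms of the upper bound from
  \<open>\<phi>\<close> along the segment. The Lipschitz bound on \<open>G\<close> and
  Cauchy--Schwarz make its derivative nonpositive for \<open>t\<close> between \<open>0\<close> and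
  \<open>1\<close>.\<close>

lemma lipschitz_gradient_descent:
  fixes G :: "'a::euclidean_space \<Rightarrow> 'a"
  assumes G: "\<And>y. GDERIV \<phi> y :> G y" and L: "L-lipschitz_on UNIV G"
  shows "\<phi> (y + h) \<le> \<phi> y + inner (G y) h + L / 2 * (norm h)\<^sup>2"
proof -
  let ?\<psi> = "\<lambda>t. \<phi> (y + t *\<^sub>R h) - t * inner (G y) h - L / 2 * t\<^sup>2 * (norm h)\<^sup>2"
  have der: "(?\<psi> has_real_derivative (inner (G (y + t *\<^sub>R h)) h - inner (G y) h - L * t * (norm h)\<^sup>2)) (at t)" for t
  proof -
    have "((\<lambda>t. y + t *\<^sub>R h) has_derivative (\<lambda>s. s *\<^sub>R h)) (at t)"
      by (auto intro!: derivative_eq_intros)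
    from has_derivative_compose[OF this G[unfolded gderiv_def]]
    have "((\<lambda>t. \<phi> (y + t *\<^sub>R h)) has_real_derivative inner (G (y + t *\<^sub>R h)) h) (at t)"
      by (simp add: has_field_derivative_def inner_commute mult_commute_abs)
    then show ?thesis
      by (auto intro!: derivative_eq_intros)
  qed
  have "?\<psi> 1 \<le> ?\<psi> 0"
  proof (rule DERIV_nonpos_imp_nonincreasing[where f = ?\<psi>])
    fix t :: real assume t: "0 \<le> t" "t \<le> 1"
    have "inner (G (y + t *\<^sub>R h) - G y) h \<le> norm (G (y + t *\<^sub>R h) - G y) * norm h"
      by (rule norm_cauchy_schwarz)
    also have "\<dots> \<le> L * norm (t *\<^sub>R h) * norm h"
      using lipschitz_onD[OF L, of "y + t *\<^sub>R h" y] by (intro mult_right_mono) (auto simp: dist_norm)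
    also have "\<dots> = L * t * (norm h)\<^sup>2" using t by (simp add: power2_eq_square)
    finally show "\<exists>z. (?\<psi> has_real_derivative z) (at t) \<and> z \<le> 0"
      using der[of t] by (auto simp: inner_diff_left)
  qed simp
  then show ?thesis by simp
qed

text \<open>The Baillon--Haddad theorem.\<close>

lemma convex_lipschitz_gradient_cocoercive:
  fixes G :: "'a::euclidean_space \<Rightarrow> 'a"
  assumes c: "convex_on UNIV \<phi>" and G: "\<And>y. GDERIV \<phi> y :> G y"
    and L: "L-lipschitz_on UNIV G" "L > 0"
  shows "(norm (G x - G y))\<^sup>2 \<le> L * inner (G x - G y) (x - y)"
proof -
  have *: "(norm (G y - G x))\<^sup>2 / (2 * L) \<le> \<phi> y - \<phi> x - inner (G x) (y - x)" for x y
  proof -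
    \<comment> \<open>This step minimizes the quadratic upper bound at \<open>y\<close> of the
      tilted function \<open>\<phi> - inner (G x)\<close>, whose global minimum is attained at
      \<open>x\<close>.\<close>
    define h where "h = - (inverse L *\<^sub>R (G y - G x))"
    have "\<phi> x + inner (G x) (y + h - x) \<le> \<phi> (y + h)" by (rule convex_on_above_tangent[OF c G])
    also have "\<dots> \<le> \<phi> y + inner (G y) h + L / 2 * (norm h)\<^sup>2"
      by (rule lipschitz_gradient_descent[OF G L(1)])
    finally have "0 \<le> \<phi> y - \<phi> x - inner (G x) (y - x) + inner (G y - G x) h + L / 2 * (norm h)\<^sup>2"
      by (simp add: inner_add_right inner_diff_right inner_diff_left)
    moreover have "inner (G y - G x) h = - (norm (G y - G x))\<^sup>2 / L"
      unfolding h_def inner_minus_right inner_scaleR_right power2_norm_eq_inner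
      by (simp add: divide_inverse mult.commute)
    moreover have "L / 2 * (norm h)\<^sup>2 = (norm (G y - G x))\<^sup>2 / (2 * L)"
      unfolding h_def norm_minus_cancel norm_scaleR power_mult_distrib
      using L(2) by (simp add: power2_eq_square divide_simps)
    ultimately show ?thesis using L(2) by (simp add: field_simps)
  qed
  \<comment> \<open>Adding the estimates for both orders of the two points cancels the values of
    \<open>\<phi>\<close>.\<close>
  have "(norm (G y - G x))\<^sup>2 / (2 * L) + (norm (G x - G y))\<^sup>2 / (2 * L)
     \<le> - inner (G x) (y - x) - inner (G y) (x - y)"
    using *[of y x] *[of x y] by linarith
  then have "(norm (G x - G y))\<^sup>2 / L \<le> inner (G x - G y) (x - y)"
    by (simp add: norm_minus_commute inner_diff_left inner_diff_right)
  then show ?thesis using L(2) by (simp add: pos_divide_le_eq mult.commute)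
qed

lemma has_derivative_directional_limit:
  assumes "(G has_derivative H) (at x)"
  shows "((\<lambda>t::real. (G (x + t *\<^sub>R v) - G x) /\<^sub>R t) \<longlongrightarrow> H v) (at 0)"
proof -
  have lin: "linear H" using assms has_derivative_linear by blast
  have "((\<lambda>t::real. x + t *\<^sub>R v) has_derivative (\<lambda>t. t *\<^sub>R v)) (at 0)"
    by (auto intro!: derivative_eq_intros)
  from has_derivative_compose[OF this, of G H] assms
  have "((\<lambda>t. G (x + t *\<^sub>R v)) has_derivative (\<lambda>t. t *\<^sub>R H v)) (at 0)"
    by (simp add: linear_scale[OF lin])
  then have "((\<lambda>t. norm ((G (x + t *\<^sub>R v) - G x - t *\<^sub>R H v) /\<^sub>R t)) \<longlongrightarrow> 0) (at 0)"
    unfolding has_derivative_at by (simp add: divide_inverse_commute)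
  then have "((\<lambda>t. (G (x + t *\<^sub>R v) - G x - t *\<^sub>R H v) /\<^sub>R t + H v) \<longlongrightarrow> 0 + H v) (at 0)"
    by (intro tendsto_add tendsto_const) (rule tendsto_norm_zero_cancel)
  moreover have "\<forall>\<^sub>F t::real in at 0. (G (x + t *\<^sub>R v) - G x - t *\<^sub>R H v) /\<^sub>R t + H v
      = (G (x + t *\<^sub>R v) - G x) /\<^sub>R t"
    unfolding eventually_at_filter by (intro always_eventually) (auto simp: scaleR_diff_right)
  ultimately show ?thesis using Lim_transform_eventually by fastforce
qed

text \<open>Cocoercivity for the points \<open>x + t *\<^sub>R v\<close> and \<open>x\<close>,
  divided by \<open>t\<^sup>2\<close>, passes to the limit in the difference quotients of
  \<open>G\<close>.\<close>

lemma convex_lipschitz_hessian_cocoercive: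
  fixes G :: "'a::euclidean_space \<Rightarrow> 'a"
  assumes "convex_on UNIV \<phi>" "\<And>y. GDERIV \<phi> y :> G y" "L-lipschitz_on UNIV G" "L > 0"
    and H: "(G has_derivative H) (at x)"
  shows "(norm (H v))\<^sup>2 \<le> L * inner (H v) v"
proof (rule tendsto_le)
  let ?D = "\<lambda>t::real. (G (x + t *\<^sub>R v) - G x) /\<^sub>R t"
  have D: "(?D \<longlongrightarrow> H v) (at 0)" by (rule has_derivative_directional_limit[OF H])
  show "((\<lambda>t. (norm (?D t))\<^sup>2) \<longlongrightarrow> (norm (H v))\<^sup>2) (at 0)" by (intro tendsto_intros D)
  show "((\<lambda>t. L * inner (?D t) v) \<longlongrightarrow> L * inner (H v) v) (at 0)" by (intro tendsto_intros D)
  show "\<forall>\<^sub>F t in at 0. (norm (?D t))\<^sup>2 \<le> L * inner (?D t) v"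
    unfolding eventually_at_filter
  proof (intro always_eventually allI impI)
    fix t :: real assume "t \<noteq> 0"
    have "(norm (G (x + t *\<^sub>R v) - G x))\<^sup>2 \<le> L * inner (G (x + t *\<^sub>R v) - G x) (t *\<^sub>R v)"
      using convex_lipschitz_gradient_cocoercive[OF assms(1-4), of "x + t *\<^sub>R v" x] by simp
    then have "(norm (G (x + t *\<^sub>R v) - G x))\<^sup>2 / t\<^sup>2 \<le> L * inner (G (x + t *\<^sub>R v) - G x) (t *\<^sub>R v) / t\<^sup>2"
      by (intro divide_right_mono) auto
    then show "(norm (?D t))\<^sup>2 \<le> L * inner (?D t) v"
      using \<open>t \<noteq> 0\<close> by (simp add: power_mult_distrib divide_simps power2_eq_square)
  qed
qed simp

section \<open>Coercivity and the contraction of a gradient step\<close>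

lemma pos_def_on_coercive:
  fixes H :: "'a::euclidean_space \<Rightarrow> 'a"
  assumes "subspace T" "linear H" and pos: "\<And>v. v \<in> T \<Longrightarrow> v \<noteq> 0 \<Longrightarrow> 0 < inner v (H v)"
  obtains c where "c > 0" "\<And>v. v \<in> T \<Longrightarrow> c * (norm v)\<^sup>2 \<le> inner v (H v)"
proof (cases "T \<subseteq> {0}")
  case True
  \<comment> \<open>The unit sphere of \<open>T\<close> is empty here, so there is nothing to
    minimize over and any positive constant serves.\<close>
  then show ?thesis using that[of 1] linear_0[OF assms(2)] by force
next
  case False
  let ?K = "sphere 0 1 \<inter> T"
  obtain v0 where v0: "v0 \<in> T" "v0 \<noteq> 0" using False by blast
  then have "v0 /\<^sub>R norm v0 \<in> ?K" using assms(1) by (simp add: subspace_scale)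
  moreover have "compact ?K"
    by (intro compact_Int_closed compact_sphere closed_subspace assms)
  moreover have "continuous_on ?K (\<lambda>v. inner v (H v))"
    using assms(2) by (intro continuous_intros linear_continuous_on)
      (simp add: linear_conv_bounded_linear)
  ultimately obtain m where m: "m \<in> ?K" "\<And>v. v \<in> ?K \<Longrightarrow> inner m (H m) \<le> inner v (H v)"
    using continuous_attains_inf[of ?K] by blast
  show ?thesis
  proof (rule that[of "inner m (H m)"])
    show "inner m (H m) > 0" using m(1) pos by fastforce
    fix v assume "v \<in> T"
    show "inner m (H m) * (norm v)\<^sup>2 \<le> inner v (H v)"
    proof (cases "v = 0")
      case False
      then have "v /\<^sub>R norm v \<in> ?K" using \<open>v \<in> T\<close> assms(1) by (simp add: subspace_scale)
      then have "inner m (H m) \<le> inner (v /\<^sub>R norm v) (H (v /\<^sub>R norm v))" by (rule m(2))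
      also have "\<dots> = inner v (H v) / (norm v)\<^sup>2"
        by (simp add: linear_scale[OF assms(2)] power2_eq_square divide_inverse)
      finally show ?thesis using False by (simp add: pos_le_divide_eq)
    qed (simp add: linear_0[OF assms(2)])
  qed
qed

text \<open>In the expanded square, \<open>co\<close> absorbs the term with
  \<open>norm (H v)\<close> into the mixed term, whose coefficient becomes
  \<open>- \<alpha> * (2 - \<alpha> * L)\<close>. This is negative for step sizes below
  \<open>2 / L\<close>, and coercivity on \<open>T\<close> converts it into a factor below
  1.\<close>

lemma gradient_step_contraction:
  fixes H :: "'a::euclidean_space \<Rightarrow> 'a"
  assumes "subspace T" "linear H" "\<And>v. v \<in> T \<Longrightarrow> v \<noteq> 0 \<Longrightarrow> 0 < inner v (H v)"
    and co: "\<And>v. (norm (H v))\<^sup>2 \<le> L * inner (H v) v"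
    and \<alpha>: "0 < \<alpha>" "\<alpha> * L < 2"
  obtains q where "0 \<le> q" "q < 1" "\<And>v. v \<in> T \<Longrightarrow> norm (v - \<alpha> *\<^sub>R H v) \<le> q * norm v"
proof -
  obtain c where c: "c > 0" "\<And>v. v \<in> T \<Longrightarrow> c * (norm v)\<^sup>2 \<le> inner v (H v)"
    by (rule pos_def_on_coercive[OF assms(1-3)]) blast+
  \<comment> \<open>For trivial \<open>T\<close> the constant \<open>c\<close> is arbitrary and the
    difference may be negative; the maximum with \<open>0\<close> keeps the square root
    meaningful.\<close>
  let ?r = "max 0 (1 - \<alpha> * (2 - \<alpha> * L) * c)"
  have pos: "0 < \<alpha> * (2 - \<alpha> * L)" using \<alpha> by simp
  show ?thesis
  proof (rule that[of "sqrt ?r"])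
    show "sqrt ?r < 1" using pos c(1) by simp
    fix v assume v: "v \<in> T"
    have "(norm (v - \<alpha> *\<^sub>R H v))\<^sup>2 = (norm v)\<^sup>2 - 2 * \<alpha> * inner v (H v) + \<alpha>\<^sup>2 * (norm (H v))\<^sup>2"
      unfolding power2_norm_eq_inner by (simp add: algebra_simps inner_commute power2_eq_square)
    also have "\<dots> \<le> (norm v)\<^sup>2 - 2 * \<alpha> * inner v (H v) + \<alpha>\<^sup>2 * (L * inner (H v) v)"
      by (intro add_left_mono mult_left_mono co) simp
    also have "\<dots> = (norm v)\<^sup>2 - \<alpha> * (2 - \<alpha> * L) * inner v (H v)"
      by (simp add: algebra_simps inner_commute power2_eq_square)
    also have "\<dots> \<le> (norm v)\<^sup>2 - \<alpha> * (2 - \<alpha> * L) * (c * (norm v)\<^sup>2)"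
      by (intro diff_left_mono mult_left_mono c(2) v less_imp_le pos)
    also have "\<dots> = (1 - \<alpha> * (2 - \<alpha> * L) * c) * (norm v)\<^sup>2" by (simp add: algebra_simps)
    also have "\<dots> \<le> ?r * (norm v)\<^sup>2" by (intro mult_right_mono) auto
    also have "\<dots> = (sqrt ?r * norm v)\<^sup>2" by (simp add: power_mult_distrib)
    finally show "norm (v - \<alpha> *\<^sub>R H v) \<le> sqrt ?r * norm v"
      by (rule power2_le_imp_le) simp
  qed simp
qed

section \<open>Identification of the manifold by subgradients\<close>

text \<open>The real-valued \<open>C2\<close> extension shows that \<open>h x\<close> is finite,
  which discharges the finiteness guard in \<open>partly_smooth_at\<close>.\<close>

lemma partly_smooth_regular_fun:
  assumes "partly_smooth_at h M x" "x \<in> M"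
  shows "regular_fun h x"
proof -
  obtain k V where "x \<in> V" "\<forall>y\<in>M \<inter> V. h y = ereal (k y)"
    using assms(1) unfolding partly_smooth_at_def C2_extension_def by blast
  then have "\<bar>h x\<bar> \<noteq> \<infinity>" using assms(2) by auto
  moreover have "\<bar>h x\<bar> \<noteq> \<infinity> \<longrightarrow> regular_fun h x"
    by (rule eventually_nhds_x_imp_x[OF assms(1)[unfolded partly_smooth_at_def, THEN conjunct1]])
  ultimately show ?thesis by (rule rev_mp)
qed

text \<open>One half of the comparison between joint and partial subdifferentials;
  \<open>convex_subdiff_lift\<close> is the other.\<close>

lemma fst_limiting_subdiff:
  assumes "regular_fun g (x, u)" "convex_fun (\<lambda>x. g (x, u))" "z \<in> limiting_subdiff g (x, u)"
  shows "fst z \<in> convex_subdiff (\<lambda>x. g (x, u)) x"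
  using partial_regular_subdiff_convex[OF _ assms(2), of "fst z" "snd z"] assms
  by (simp add: limiting_subdiff_eq_regular)

text \<open>Along \<open>M\<close> the function \<open>k (y, u) - inner y c\<close> has a local
  minimum at \<open>x\<close>. Hence all partial subgradients at \<open>x\<close> share the
  tangential part of the gradient of the smooth representative \<open>k\<close>.\<close>

lemma convex_subdiff_tangential:
  assumes c: "c \<in> convex_subdiff (\<lambda>y. g (y, u)) x" and "x \<in> M" "u \<in> \<Omega>"
    and V: "open V" "(x, u) \<in> V" "\<And>z. z \<in> (M \<times> \<Omega>) \<inter> V \<Longrightarrow> g z = ereal (k z)"
    and G: "GDERIV (\<lambda>y. k (y, u)) x :> G" and \<tau>: "\<tau> \<in> tangent_space M x"
  shows "inner \<tau> (G - c) = 0"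
proof -
  have "((\<lambda>y. k (y, u) - inner y c) has_derivative (\<lambda>h. inner h G - inner h c)) (at x)"
    by (intro derivative_intros G[unfolded gderiv_def])
  moreover have "\<forall>\<^sub>F y in nhds x. y \<in> M \<longrightarrow> k (x, u) - inner x c \<le> k (y, u) - inner y c"
  proof -
    have "open ((\<lambda>y. (y, u)) -` V)"
      by (rule continuous_open_vimage[OF V(1)]) (auto intro!: continuous_intros)
    then have "\<forall>\<^sub>F y in nhds x. y \<in> (\<lambda>y. (y, u)) -` V"
      using V(2) by (intro eventually_nhds_in_open) auto
    then show ?thesis
    proof eventually_elim
      case (elim y)
      have gx: "g (x, u) = ereal (k (x, u))" using V(2,3) assms(2,3) by auto
      show ?case
      proof
        assume "y \<in> M"
        then have "g (y, u) = ereal (k (y, u))" using V(3) elim assms(3) by auto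
        then have "k (x, u) + inner c (y - x) \<le> k (y, u)"
          using c mem_convex_subdiff_iff[of "\<lambda>y. g (y, u)", OF gx] by auto
        then show "k (x, u) - inner x c \<le> k (y, u) - inner y c"
          by (simp add: inner_diff_right inner_commute)
      qed
    qed
  qed
  ultimately have "inner \<tau> G - inner \<tau> c = 0"
    using derivative_zero_at_min_on \<tau> by blast
  then show ?thesis by (simp add: inner_diff_right)
qed

text \<open>
  The unit normals \<open>e\<close> separate \<open>D'\<close> from the subdifferentials; a limit \<open>e0\<close> is normal to \<open>M\<close> at \<open>x\<close>
  and supports the subdifferential there at its relative interior point \<open>d\<close>, which is impossible.
\<close>

lemma (in manifold_chart) subdiff_identification:
  fixes g :: "'a \<times> 'u::euclidean_space \<Rightarrow> ereal"
  assumes x: "x \<in> M" "x \<in> V" and u: "u \<in> \<Omega>" "open \<Omega>"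
    and ps: "\<And>z. z \<in> M \<times> \<Omega> \<Longrightarrow> partly_smooth_at g (M \<times> \<Omega>) z"
    and cv: "\<And>u. u \<in> \<Omega> \<Longrightarrow> convex_fun (\<lambda>x. g (x, u))"
    and ri: "d \<in> rel_interior (convex_subdiff (\<lambda>y. g (y, u)) x)"
    and A: "open A" "\<And>z. z \<in> (M \<times> \<Omega>) \<inter> A \<Longrightarrow> g z = ereal (k z)"
    and G: "\<And>x u. (x, u) \<in> A \<Longrightarrow> GDERIV (\<lambda>y. k (y, u)) x :> G (x, u)"
    and X: "\<And>n. X n \<in> M" "\<And>n. X n \<in> V" "X \<longlonglongrightarrow> x"
    and Y: "\<And>n. Y n \<in> \<Omega>" "Y \<longlonglongrightarrow> u" and XY: "\<And>n. (X n, Y n) \<in> A"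
    and D: "D' \<longlonglongrightarrow> d" "\<And>n \<tau>. \<tau> \<in> tangent_space M (X n) \<Longrightarrow> inner \<tau> (G (X n, Y n) - D' n) = 0"
    and notin: "\<And>n. D' n \<notin> convex_subdiff (\<lambda>y. g (y, Y n)) (X n)"
  shows False
proof -
  let ?K = "\<lambda>n. convex_subdiff (\<lambda>y. g (y, Y n)) (X n)"
  let ?C = "convex_subdiff (\<lambda>y. g (y, u)) x"
  have xu: "(x, u) \<in> M \<times> \<Omega>" and XYM: "(X n, Y n) \<in> M \<times> \<Omega>" for n using x u X Y by auto
  note regs = partly_smooth_regular_fun[OF ps]
  have K_ne: "?K n \<noteq> {}" for n
  proof -
    obtain z where "z \<in> limiting_subdiff g (X n, Y n)"
      using ps[OF XYM[of n]] unfolding partly_smooth_at_def by blast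
    then show ?thesis using fst_limiting_subdiff[OF regs[OF XYM XYM] cv[OF Y(1)]] by blast
  qed
  define c where "c = (\<lambda>n. closest_point (?K n) (D' n))"
  have c: "c n \<in> ?K n" for n
    unfolding c_def by (rule closest_point_in_set[OF closed_convex_subdiff K_ne])
  have cD: "D' n - c n \<noteq> 0" for n using c[of n] notin[of n] by auto
  have c_dot: "inner (D' n - c n) (y - c n) \<le> 0" if "y \<in> ?K n" for y n
    unfolding c_def by (rule closest_point_dot[OF convex_convex_subdiff closed_convex_subdiff that])
  define e where "e = (\<lambda>n. (D' n - c n) /\<^sub>R norm (D' n - c n))"
  have e1: "norm (e n) = 1" for n using cD[of n] by (simp add: e_def)
  \<comment> \<open>\<open>c n\<close> has the tangential part of \<open>G\<close> because it is a
    subgradient, and \<open>D' n\<close> has it by assumption, so their difference is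
    normal.\<close>
  have e_normal: "inner \<tau> (e n) = 0" if "\<tau> \<in> tangent_space M (X n)" for \<tau> n
  proof -
    have "inner \<tau> (G (X n, Y n) - c n) = 0"
      using convex_subdiff_tangential[OF c X(1) Y(1) A(1) XY A(2) G[OF XY] that] by simp
    then show ?thesis using D(2)[OF that] by (simp add: e_def inner_diff_right)
  qed
  have e_le: "inner (e n) (y - D' n) \<le> 0" if "y \<in> ?K n" for y n
  proof -
    have "inner (D' n - c n) (y - D' n) = inner (D' n - c n) (y - c n) - (norm (D' n - c n))\<^sup>2"
      unfolding power2_norm_eq_inner by (simp add: inner_diff_left inner_diff_right)
    also have "\<dots> \<le> 0" using c_dot[OF that] by (smt (verit) zero_le_power2)
    finally show ?thesis by (simp add: e_def mult_nonneg_nonpos)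
  qed
  have "e n \<in> sphere 0 1" for n using e1 by simp
  then obtain e0 r where r: "e0 \<in> sphere 0 1" "strict_mono r" "(e \<circ> r) \<longlonglongrightarrow> e0"
    by (rule compact_subseq[OF compact_sphere])
  have Xr: "(\<lambda>n. X (r n)) \<longlonglongrightarrow> x" and Yr: "(\<lambda>n. Y (r n)) \<longlonglongrightarrow> u" and Dr: "(\<lambda>n. D' (r n)) \<longlonglongrightarrow> d"
    and er: "(\<lambda>n. e (r n)) \<longlonglongrightarrow> e0"
    using LIMSEQ_subseq_LIMSEQ[OF _ r(2)] X(3) Y(2) D(1) r(3) by (auto simp: o_def)
  have e0_normal: "inner \<tau> e0 = 0" if \<tau>: "\<tau> \<in> tangent_space M x" for \<tau>
  proof -
    obtain t where t: "\<And>n. t n \<in> tangent_space M (X (r n))" "t \<longlonglongrightarrow> \<tau>"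
      using tangent_space_inner_limit[where X="\<lambda>n. X (r n)", OF Xr x X(1) X(2) \<tau>] by blast
    have "(\<lambda>n. inner (t n) (e (r n))) \<longlonglongrightarrow> inner \<tau> e0" by (intro tendsto_intros t er)
    then show ?thesis using e_normal[OF t(1)] by (simp add: LIMSEQ_const_iff)
  qed
  have normal: "normal_space (M \<times> \<Omega>) (x, u) = normal_space M x \<times> {0}"
    by (rule normal_space_Times[OF u(2,1) subspace_0[OF subspace_tangent_space[OF x]]])
  have par: "par (limiting_subdiff g (x, u)) = normal_space M x \<times> {0}"
    using ps[OF xu] normal unfolding partly_smooth_at_def by simp
  have lift: "\<exists>w. (v, w) \<in> limiting_subdiff g (x, u)" if "v \<in> ?C" for v
  proof (rule convex_subdiff_lift[OF regs[OF xu xu] _ _ that])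
    show "limiting_subdiff g (x, u) \<noteq> {}" using ps[OF xu] unfolding partly_smooth_at_def by blast
    show "w = 0" if "(0, w) \<in> par (limiting_subdiff g (x, u))" for w using that par by simp
  qed
  \<comment> \<open>\<open>v\<close> is lifted to a joint subgradient, approximated along the
    sequence by inner semicontinuity, and projected back; the separating inequality holds for the
    projections and passes to the limit.\<close>
  have e0_le: "inner e0 (v - d) \<le> 0" if v: "v \<in> ?C" for v
  proof -
    obtain w where w: "(v, w) \<in> limiting_subdiff g (x, u)" using lift[OF v] by blast
    have "set_continuous_rel (limiting_subdiff g) (M \<times> \<Omega>) (x, u)"
      using ps[OF xu] unfolding partly_smooth_at_def by blast
    moreover have "(\<lambda>n. (X (r n), Y (r n))) \<longlonglongrightarrow> (x, u)" by (intro tendsto_intros Xr Yr)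
    ultimately obtain Z where Z: "\<forall>\<^sub>F n in sequentially. Z n \<in> limiting_subdiff g (X (r n), Y (r n))"
      "Z \<longlonglongrightarrow> (v, w)"
      using w XYM unfolding set_continuous_rel_def by meson
    have "(\<lambda>n. inner (e (r n)) (fst (Z n) - D' (r n))) \<longlonglongrightarrow> inner e0 (fst (v, w) - d)"
      by (intro tendsto_intros er Dr Z)
    moreover have "\<forall>\<^sub>F n in sequentially. inner (e (r n)) (fst (Z n) - D' (r n)) \<le> 0"
      using Z(1) by eventually_elim (intro e_le fst_limiting_subdiff[OF regs[OF XYM XYM] cv[OF Y(1)]])
    ultimately have "inner e0 (fst (v, w) - d) \<le> 0" by (rule tendsto_upperbound) simp
    then show ?thesis by simp
  qed
  \<comment> \<open>Normality at \<open>x\<close> places \<open>e0\<close> in the direction space of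
    the affine hull of \<open>?C\<close>, so moving \<open>d\<close> slightly along
    \<open>e0\<close> stays in \<open>?C\<close> by relative interiority.\<close>
  have "(e0, 0) \<in> par (limiting_subdiff g (x, u))"
    unfolding par using e0_normal by (simp add: normal_space_def orthogonal_comp_def orthogonal_def)
  then obtain a b where ab: "(e0, 0) = a - b" "a \<in> affine hull limiting_subdiff g (x, u)"
    "b \<in> affine hull limiting_subdiff g (x, u)" unfolding par_def by blast
  have "fst ` (affine hull limiting_subdiff g (x, u)) = affine hull (fst ` limiting_subdiff g (x, u))"
    by (rule affine_hull_linear_image[OF bounded_linear_fst])
  also have "\<dots> \<subseteq> affine hull ?C"
    using fst_limiting_subdiff[OF regs[OF xu xu] cv[OF u(1)]] by (intro hull_mono) blast
  finally have "fst a \<in> affine hull ?C" "fst b \<in> affine hull ?C" using ab by blast+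
  moreover have "fst a - fst b = e0" using ab(1) by (metis fst_conv fst_diff)
  moreover obtain \<epsilon> where \<epsilon>: "\<epsilon> > 0" "d \<in> ?C" "ball d \<epsilon> \<inter> affine hull ?C \<subseteq> ?C"
    using ri unfolding mem_rel_interior_ball by blast
  ultimately have "d + (\<epsilon> / 2) *\<^sub>R e0 \<in> affine hull ?C"
    using mem_affine_3_minus[OF affine_affine_hull hull_inc] by metis
  moreover have "d + (\<epsilon> / 2) *\<^sub>R e0 \<in> ball d \<epsilon>" using r(1) \<epsilon>(1) by (simp add: dist_norm)
  ultimately have "inner e0 (d + (\<epsilon> / 2) *\<^sub>R e0 - d) \<le> 0" using \<epsilon>(3) by (intro e0_le) blast
  moreover have "inner e0 e0 = 1" using r(1) by (simp add: dot_square_norm)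
  ultimately show False using \<epsilon>(1) by simp
qed


section \<open>Critical points along the manifold\<close>

lemma half_norm_square_derivative:
  assumes "(c has_vector_derivative v) (at t)"
  shows "((\<lambda>t. (norm (c t - w))\<^sup>2 / 2) has_real_derivative inner (c t - w) v) (at t)"
proof -
  have "((\<lambda>t. inner (c t - w) (c t - w) / 2) has_derivative (\<lambda>h. (inner (c t - w) (h *\<^sub>R v) + inner (h *\<^sub>R v) (c t - w)) / 2)) (at t)"
    using assms unfolding has_vector_derivative_def
    by (auto intro!: derivative_eq_intros simp: fun_eq_iff)
  then show ?thesis
    unfolding has_field_derivative_def power2_norm_eq_inner
    by (rule has_derivative_eq_rhs) (auto simp: inner_commute)
qed

text \<open>
  \<open>\<Phi>\<close> is the gradient in \<open>s\<close> of \<open>\<alpha> k (\<xi> s, u) + |\<xi> s - w|^2 / 2 + |s - \<pi> s|^2 / 2\<close>; the last term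
  forces critical points into \<open>S\<close> while letting \<open>s\<close> range over the whole space. The growth hypothesis
  makes its partial derivative in \<open>s\<close> positive definite at the base point.
\<close>

lemma (in manifold_chart) critical_point_map:
  fixes k :: "'a \<times> 'u::euclidean_space \<Rightarrow> real" and G :: "'a \<times> 'u \<Rightarrow> 'a"
  assumes x0: "x0 \<in> M" "x0 \<in> V" and A: "open A" "(x0, u0) \<in> A"
    and G: "C1_on G A" "\<And>x u. (x, u) \<in> A \<Longrightarrow> GDERIV (\<lambda>y. k (y, u)) x :> G (x, u)"
    and growth: "\<And>y. y \<in> M \<Longrightarrow> (y, u0) \<in> A \<Longrightarrow>
      \<alpha> * k (x0, u0) + (norm (x0 - w0))\<^sup>2 / 2 + (norm (y - x0))\<^sup>2 / 2 \<le> \<alpha> * k (y, u0) + (norm (y - w0))\<^sup>2 / 2"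
  obtains B P where "open B" "(w0, u0) \<in> B" "P (w0, u0) = x0"
    "\<And>p. p \<in> B \<Longrightarrow> P p \<in> M" "\<And>p. p \<in> B \<Longrightarrow> P p \<in> V" "\<And>p. p \<in> B \<Longrightarrow> (P p, snd p) \<in> A"
    "\<And>p \<tau>. p \<in> B \<Longrightarrow> \<tau> \<in> tangent_space M (P p) \<Longrightarrow> inner \<tau> (\<alpha> *\<^sub>R G (P p, snd p) + P p - fst p) = 0"
    "\<And>p. p \<in> B \<Longrightarrow> P differentiable (at p)"
proof -
  define \<pi> where "\<pi> = orth_proj S"
  have \<pi>: "bounded_linear \<pi>" "\<And>s. \<pi> s \<in> S" "\<And>s. s \<in> S \<Longrightarrow> \<pi> s = s" "\<And>s v. v \<in> S \<Longrightarrow> inner (s - \<pi> s) v = 0"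
    unfolding \<pi>_def
    using linear_orth_proj[OF subspace_S] orth_proj_props(1)[OF subspace_S] orth_proj_id[OF subspace_S]
      inner_orth_proj[OF subspace_S]
    by (auto simp: linear_conv_bounded_linear inner_diff_left)
  have lin: "linear \<pi>" using \<pi>(1) by (simp add: linear_conv_bounded_linear)
  \<comment> \<open>Composing with \<open>\<pi>\<close> extends the parametrization of
    \<open>M\<close> from \<open>S\<close> to an open set of the ambient space; it is constant along
    the orthogonal complement of \<open>S\<close>.\<close>
  define \<xi> where "\<xi> = (\<lambda>s. \<phi>i (\<pi> s))"
  define \<xi>' where "\<xi>' = (\<lambda>s. Di (\<pi> s) o\<^sub>L Blinfun \<pi>)"
  have \<xi>'_apply: "\<xi>' s \<sigma> = Di (\<pi> s) (\<pi> \<sigma>)" for s \<sigma>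
    by (simp add: \<xi>'_def bounded_linear_Blinfun_apply \<pi>)
  define W0 where "W0 = \<pi> -` W"
  have W0: "open W0"
    unfolding W0_def using \<pi>(1) by (intro continuous_open_vimage open_W) (simp add: linear_continuous_at)
  have C1_\<pi>: "C1_on \<pi> W0" by (rule C1_on_bounded_linear[OF \<pi>(1)])
  have \<pi>W: "\<pi> s \<in> W" if "s \<in> W0" for s using that by (simp add: W0_def)
  have C1_\<xi>: "C1_on \<xi> W0" unfolding \<xi>_def by (rule C1_on_compose[OF C1_\<pi> C1_\<phi>i \<pi>W])
  have C1_\<xi>': "C1_on \<xi>' W0" unfolding \<xi>'_def
    by (intro bounded_bilinear.C1_on[OF bounded_bilinear_blinfun_compose] C1_on_const
        C1_on_compose[OF C1_\<pi> C1_Di \<pi>W])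
  have der_\<xi>: "(\<xi> has_derivative (\<lambda>\<sigma>. \<xi>' s \<sigma>)) (at s)" if "s \<in> W0" for s
    unfolding \<xi>_def \<xi>'_apply
    by (rule has_derivative_compose[OF bounded_linear_imp_has_derivative[OF \<pi>(1)] der_inv[OF \<pi>W[OF that]]])
  have \<xi>_M: "\<xi> s \<in> M" "\<xi> s \<in> V" if "s \<in> W0" for s
    unfolding \<xi>_def using \<phi>i_in_M \<phi>i_in \<pi> \<pi>W[OF that] by auto
  define s0 where "s0 = \<phi> x0"
  have s0: "s0 \<in> S" "\<pi> s0 = s0" "s0 \<in> W0" "\<xi> s0 = x0"
    using \<phi>_in_S[OF x0] \<phi>_in[OF x0(2)] \<phi>i_\<phi>[OF x0(2)] \<pi>(3) by (auto simp: s0_def W0_def \<xi>_def)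
  define U0 where "U0 = {z :: 'a \<times> 'a \<times> 'u. fst z \<in> W0 \<and> (\<xi> (fst z), snd (snd z)) \<in> A}"
  have fstW0: "open (fst -` W0 :: ('a \<times> 'a \<times> 'u) set)"
    by (intro continuous_open_vimage W0) (auto intro!: continuous_intros)
  have cont_\<xi>fst: "continuous_on (fst -` W0) (\<lambda>z::'a \<times> 'a \<times> 'u. (\<xi> (fst z), snd (snd z)))"
    by (intro continuous_on_Pair continuous_on_compose2[OF C1_on_imp_continuous_on[OF C1_\<xi>]]
        continuous_on_fst continuous_on_snd continuous_on_id) simp
  have "U0 = fst -` W0 \<inter> (\<lambda>z. (\<xi> (fst z), snd (snd z))) -` A" by (auto simp: U0_def)
  then have U0: "open U0" using continuous_open_preimage[OF cont_\<xi>fst fstW0 A(1)] by simp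
  let ?p0 = "(w0, u0)"
  have z0: "(s0, ?p0) \<in> U0" using s0 A(2) by (simp add: U0_def)
  define c where "c = (\<lambda>z::'a \<times> 'a \<times> 'u. \<alpha> *\<^sub>R G (\<xi> (fst z), snd (snd z)) + (\<xi> (fst z) + - fst (snd z)))"
  define \<Phi> where "\<Phi> = (\<lambda>z::'a \<times> 'a \<times> 'u. (\<Sum>b\<in>Basis. inner (c z) (\<xi>' (fst z) b) *\<^sub>R b) + (fst z - \<pi> (fst z)))"
  have C1_fst: "C1_on fst U0" by (rule C1_on_bounded_linear[OF bounded_linear_fst])
  have C1_\<xi>fst: "C1_on (\<lambda>z. \<xi> (fst z)) U0"
    by (rule C1_on_compose[OF C1_fst C1_\<xi>]) (simp add: U0_def)
  have C1_snd: "C1_on (\<lambda>z. snd (snd z)) U0" "C1_on (\<lambda>z. - fst (snd z)) U0"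
    by (intro C1_on_bounded_linear bounded_linear_minus
        bounded_linear_compose[OF bounded_linear_snd bounded_linear_snd]
        bounded_linear_compose[OF bounded_linear_fst bounded_linear_snd])+
  have C1_c: "C1_on c U0"
    unfolding c_def
  proof (intro C1_on_add C1_on_linear_image[OF bounded_linear_scaleR_right] C1_\<xi>fst C1_snd)
    show "C1_on (\<lambda>z. G (\<xi> (fst z), snd (snd z))) U0"
      by (rule C1_on_compose[OF C1_on_Pair[OF C1_\<xi>fst C1_snd(1)] G(1)]) (simp add: U0_def)
  qed
  have C1_\<Phi>: "C1_on \<Phi> U0"
    unfolding \<Phi>_def
  proof (intro C1_on_add C1_on_sum C1_on_linear_image[OF bounded_linear_scaleR_left]
      bounded_bilinear.C1_on[OF bounded_bilinear_inner] C1_c)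
    fix b :: 'a
    show "C1_on (\<lambda>z. \<xi>' (fst z) b) U0"
      by (rule C1_on_linear_image[OF blinfun.bounded_linear_left C1_on_compose[OF C1_fst C1_\<xi>']])
        (simp add: U0_def)
    show "C1_on (\<lambda>z. fst z - \<pi> (fst z)) U0"
      by (intro C1_on_bounded_linear bounded_linear_sub bounded_linear_fst
          bounded_linear_compose[OF \<pi>(1)])
  qed simp
  have \<Phi>_inner: "inner (\<Phi> z) \<sigma> = inner (c z) (\<xi>' (fst z) \<sigma>) + inner (fst z - \<pi> (fst z)) \<sigma>" for z \<sigma>
  proof -
    have "inner (c z) (\<xi>' (fst z) \<sigma>) = inner (c z) (\<xi>' (fst z) (\<Sum>b\<in>Basis. inner \<sigma> b *\<^sub>R b))"
      by (simp add: euclidean_representation)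
    also have "\<dots> = (\<Sum>b\<in>Basis. inner (c z) (\<xi>' (fst z) b) * inner b \<sigma>)"
      by (simp add: blinfun.sum_right blinfun.scaleR_right inner_sum_right inner_commute mult.commute)
    finally show ?thesis by (simp add: \<Phi>_def inner_add_left inner_sum_left)
  qed
  \<comment> \<open>The function whose gradient is \<open>\<Phi>\<close>, restricted to the line
    through \<open>s0\<close> with direction \<open>\<sigma>\<close>. As
    \<open>\<pi> s0 = s0\<close>, the distance term depends only on
    \<open>t *\<^sub>R \<sigma>\<close>.\<close>
  define m where "m = (\<lambda>\<sigma> t. \<alpha> * k (\<xi> (s0 + t *\<^sub>R \<sigma>), u0) + (norm (\<xi> (s0 + t *\<^sub>R \<sigma>) - w0))\<^sup>2 / 2
      + (norm (t *\<^sub>R (\<sigma> - \<pi> \<sigma>)))\<^sup>2 / 2)"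
  have line: "((\<lambda>t. s0 + t *\<^sub>R \<sigma>) has_vector_derivative \<sigma>) (at t)" for \<sigma> t
    by (auto simp: has_vector_derivative_def intro!: derivative_eq_intros)
  have near: "\<exists>\<delta>>0. \<forall>t. \<bar>t\<bar> < \<delta> \<longrightarrow> (s0 + t *\<^sub>R \<sigma>, ?p0) \<in> U0" for \<sigma>
  proof -
    have "open ((\<lambda>t. (s0 + t *\<^sub>R \<sigma>, ?p0)) -` U0)"
      by (intro continuous_open_vimage U0) (auto intro!: continuous_intros)
    moreover have "0 \<in> (\<lambda>t. (s0 + t *\<^sub>R \<sigma>, ?p0)) -` U0" using z0 by simp
    ultimately obtain \<delta> where "\<delta> > 0" "ball 0 \<delta> \<subseteq> (\<lambda>t. (s0 + t *\<^sub>R \<sigma>, ?p0)) -` U0"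
      using open_contains_ball by blast
    then show ?thesis by (intro exI[of _ \<delta>]) (auto simp: subset_iff dist_real_def)
  qed
  have der_\<xi>_line: "((\<lambda>t. \<xi> (s0 + t *\<^sub>R \<sigma>)) has_vector_derivative \<xi>' (s0 + t *\<^sub>R \<sigma>) \<sigma>) (at t)"
    if "(s0 + t *\<^sub>R \<sigma>, ?p0) \<in> U0" for \<sigma> t
  proof -
    have "s0 + t *\<^sub>R \<sigma> \<in> W0" using that by (simp add: U0_def)
    from has_derivative_compose[OF line[unfolded has_vector_derivative_def] der_\<xi>[OF this]]
    show ?thesis by (simp add: has_vector_derivative_def blinfun.scaleR_right)
  qed
  have der_m: "(m \<sigma> has_real_derivative inner (\<Phi> (s0 + t *\<^sub>R \<sigma>, ?p0)) \<sigma>) (at t)"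
    if "(s0 + t *\<^sub>R \<sigma>, ?p0) \<in> U0" for \<sigma> t
  proof -
    let ?s = "s0 + t *\<^sub>R \<sigma>"
    have "(\<xi> ?s, u0) \<in> A" using that by (simp add: U0_def)
    from has_derivative_compose[OF der_\<xi>_line[OF that, unfolded has_vector_derivative_def]
        G(2)[OF this, unfolded gderiv_def]]
    have 1: "((\<lambda>t. k (\<xi> (s0 + t *\<^sub>R \<sigma>), u0)) has_real_derivative inner (\<xi>' ?s \<sigma>) (G (\<xi> ?s, u0))) (at t)"
      by (simp add: has_field_derivative_def mult_commute_abs)
    have 2: "((\<lambda>t. (norm (\<xi> (s0 + t *\<^sub>R \<sigma>) - w0))\<^sup>2 / 2) has_real_derivative inner (\<xi> ?s - w0) (\<xi>' ?s \<sigma>)) (at t)"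
      by (rule half_norm_square_derivative[OF der_\<xi>_line[OF that]])
    have "((\<lambda>t. t *\<^sub>R (\<sigma> - \<pi> \<sigma>)) has_vector_derivative \<sigma> - \<pi> \<sigma>) (at t)"
      by (auto simp: has_vector_derivative_def intro!: derivative_eq_intros)
    from half_norm_square_derivative[OF this, of 0]
    have 3: "((\<lambda>t. (norm (t *\<^sub>R (\<sigma> - \<pi> \<sigma>)))\<^sup>2 / 2) has_real_derivative inner (t *\<^sub>R (\<sigma> - \<pi> \<sigma>)) (\<sigma> - \<pi> \<sigma>)) (at t)"
      by simp
    have "?s - \<pi> ?s = t *\<^sub>R (\<sigma> - \<pi> \<sigma>)"
      by (simp add: linear_add[OF lin] linear_scale[OF lin] s0 algebra_simps)
    moreover have "inner (t *\<^sub>R (\<sigma> - \<pi> \<sigma>)) \<sigma> = inner (t *\<^sub>R (\<sigma> - \<pi> \<sigma>)) (\<sigma> - \<pi> \<sigma>)"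
      using \<pi>(4)[OF \<pi>(2), of \<sigma> \<sigma>] by (simp add: inner_diff_right)
    ultimately have "inner (\<Phi> (?s, ?p0)) \<sigma> = inner (c (?s, ?p0)) (\<xi>' ?s \<sigma>) + inner (t *\<^sub>R (\<sigma> - \<pi> \<sigma>)) (\<sigma> - \<pi> \<sigma>)"
      unfolding \<Phi>_inner by (simp only: fst_conv)
    also have "inner (c (?s, ?p0)) (\<xi>' ?s \<sigma>) = \<alpha> * inner (\<xi>' ?s \<sigma>) (G (\<xi> ?s, u0)) + inner (\<xi> ?s - w0) (\<xi>' ?s \<sigma>)"
      by (simp add: c_def inner_add_left inner_add_right inner_commute)
    finally have "inner (\<Phi> (?s, ?p0)) \<sigma> = \<alpha> * inner (\<xi>' ?s \<sigma>) (G (\<xi> ?s, u0))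
        + inner (\<xi> ?s - w0) (\<xi>' ?s \<sigma>) + inner (t *\<^sub>R (\<sigma> - \<pi> \<sigma>)) (\<sigma> - \<pi> \<sigma>)" .
    with DERIV_add[OF DERIV_add[OF DERIV_cmult[OF 1, of \<alpha>] 2] 3] show ?thesis
      unfolding m_def by (simp only:)
  qed
  have m_growth: "m \<sigma> 0 + (norm (\<xi> (s0 + t *\<^sub>R \<sigma>) - x0))\<^sup>2 / 2 + (norm (t *\<^sub>R (\<sigma> - \<pi> \<sigma>)))\<^sup>2 / 2 \<le> m \<sigma> t"
    if "(s0 + t *\<^sub>R \<sigma>, ?p0) \<in> U0" for \<sigma> t
    using growth[of "\<xi> (s0 + t *\<^sub>R \<sigma>)"] that \<xi>_M by (simp add: m_def s0 U0_def)
  have \<Phi>0: "\<Phi> (s0, ?p0) = 0"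
  proof -
    have "inner (\<Phi> (s0, ?p0)) \<sigma> = 0" for \<sigma>
    proof -
      obtain \<delta> where \<delta>: "\<delta> > 0" "\<And>t. \<bar>t\<bar> < \<delta> \<Longrightarrow> (s0 + t *\<^sub>R \<sigma>, ?p0) \<in> U0" using near by blast
      have "m \<sigma> 0 \<le> m \<sigma> t" if "\<bar>t\<bar> < \<delta>" for t
        using m_growth[OF \<delta>(2)[OF that]] by (smt (verit) zero_le_power2 divide_nonneg_pos)
      then show ?thesis using DERIV_local_min[OF der_m[OF \<delta>(2)], of 0 \<delta>] \<delta>(1) by simp
    qed
    from this[of "\<Phi> (s0, ?p0)"] show ?thesis by simp
  qed
  define \<Phi>' where "\<Phi>' = frechet_derivative \<Phi> (at (s0, ?p0))"
  have \<Phi>': "(\<Phi> has_derivative \<Phi>') (at (s0, ?p0))"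
  proof -
    obtain F' where "(\<Phi> has_derivative F') (at (s0, ?p0))"
      using C1_on_def[of \<Phi> U0] C1_\<Phi> z0 by blast
    then show ?thesis unfolding \<Phi>'_def using frechet_derivative_works differentiableI by blast
  qed
  \<comment> \<open>If \<open>\<Phi>' (\<sigma>, 0) = 0\<close>, the derivative of
    \<open>m \<sigma>\<close> at \<open>t\<close> is \<open>o(t)\<close>, so
    \<open>m \<sigma>\<close> rises by \<open>o(t\<^sup>2)\<close> only. The growth inequality
    bounds this rise below by half the squares of
    \<open>\<xi> (s0 + t *\<^sub>R \<sigma>) - x0\<close> and of
    \<open>t *\<^sub>R (\<sigma> - \<pi> \<sigma>)\<close>. Hence
    \<open>\<xi>' s0 \<sigma> = 0\<close> and \<open>\<sigma> = \<pi> \<sigma>\<close>, and the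
    injective chart derivative gives \<open>\<sigma> = 0\<close>.\<close>
  have inj: "\<sigma> = 0" if "\<Phi>' (\<sigma>, 0) = 0" for \<sigma>
  proof -
    obtain \<delta> where \<delta>: "\<delta> > 0" "\<And>t. \<bar>t\<bar> < \<delta> \<Longrightarrow> (s0 + t *\<^sub>R \<sigma>, ?p0) \<in> U0" using near by blast
    have lim: "((\<lambda>t. (\<Phi> (s0 + t *\<^sub>R \<sigma>, ?p0)) /\<^sub>R t) \<longlongrightarrow> 0) (at 0)"
      using has_derivative_directional_limit[OF \<Phi>', of "(\<sigma>, 0)"] that \<Phi>0 by simp
    have "((\<lambda>t. inner ((\<Phi> (s0 + t *\<^sub>R \<sigma>, ?p0)) /\<^sub>R t) \<sigma>) \<longlongrightarrow> inner 0 \<sigma>) (at_right 0)"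
      by (intro tendsto_intros tendsto_within_subset[OF lim]) simp
    then have lim': "((\<lambda>t. inner ((\<Phi> (s0 + t *\<^sub>R \<sigma>, ?p0)) /\<^sub>R t) \<sigma>) \<longlongrightarrow> 0) (at_right 0)" by simp
    have s0U: "(s0 + 0 *\<^sub>R \<sigma>, ?p0) \<in> U0" using z0 by simp
    have quot: "((\<lambda>t. (norm ((\<xi> (s0 + t *\<^sub>R \<sigma>) - x0) /\<^sub>R t))\<^sup>2 + (norm (\<sigma> - \<pi> \<sigma>))\<^sup>2)
        \<longlongrightarrow> (norm (\<xi>' s0 \<sigma>))\<^sup>2 + (norm (\<sigma> - \<pi> \<sigma>))\<^sup>2) (at_right 0)"
    proof -
      have "((\<lambda>t. (\<xi> (s0 + t *\<^sub>R \<sigma>) - x0) /\<^sub>R t) \<longlongrightarrow> \<xi>' s0 \<sigma>) (at 0)"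
        using has_derivative_directional_limit[OF der_\<xi>[OF s0(3)], of \<sigma>] s0(4) by simp
      then have "((\<lambda>t. (\<xi> (s0 + t *\<^sub>R \<sigma>) - x0) /\<^sub>R t) \<longlongrightarrow> \<xi>' s0 \<sigma>) (at_right 0)"
        by (rule tendsto_within_subset) simp
      then show ?thesis by (intro tendsto_intros)
    qed
    have "(norm (\<xi>' s0 \<sigma>))\<^sup>2 + (norm (\<sigma> - \<pi> \<sigma>))\<^sup>2 \<le> \<epsilon>" if "\<epsilon> > 0" for \<epsilon>
    proof (rule tendsto_upperbound[OF quot])
      have "\<forall>\<^sub>F t in at_right 0. inner ((\<Phi> (s0 + t *\<^sub>R \<sigma>, ?p0)) /\<^sub>R t) \<sigma> < \<epsilon>"
        using order_tendstoD(2)[OF lim' that] .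
      then obtain \<delta>' where \<delta>': "\<delta>' > 0"
        "\<And>t. 0 < t \<Longrightarrow> t < \<delta>' \<Longrightarrow> inner ((\<Phi> (s0 + t *\<^sub>R \<sigma>, ?p0)) /\<^sub>R t) \<sigma> < \<epsilon>"
        unfolding eventually_at_right_field by auto
      have "(norm ((\<xi> (s0 + t *\<^sub>R \<sigma>) - x0) /\<^sub>R t))\<^sup>2 + (norm (\<sigma> - \<pi> \<sigma>))\<^sup>2 \<le> \<epsilon>"
        if t: "0 < t" "t < min \<delta> \<delta>'" for t
      proof -
        \<comment> \<open>The derivative of \<open>m \<sigma>\<close> at \<open>r\<close> is at most
          \<open>\<epsilon> * r\<close> on this range; the subtracted parabola integrates that
          bound.\<close>
        have "m \<sigma> t - \<epsilon> * t\<^sup>2 / 2 \<le> m \<sigma> 0 - \<epsilon> * 0\<^sup>2 / 2"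
        proof (rule DERIV_nonpos_imp_nonincreasing[where f = "\<lambda>r. m \<sigma> r - \<epsilon> * r\<^sup>2 / 2"])
          fix r assume r: "0 \<le> r" "r \<le> t"
          have "((\<lambda>r. m \<sigma> r - \<epsilon> * r\<^sup>2 / 2) has_real_derivative inner (\<Phi> (s0 + r *\<^sub>R \<sigma>, ?p0)) \<sigma> - \<epsilon> * r) (at r)"
            using r t by (auto intro!: derivative_eq_intros der_m \<delta>(2))
          moreover have "inner (\<Phi> (s0 + r *\<^sub>R \<sigma>, ?p0)) \<sigma> - \<epsilon> * r \<le> 0"
          proof (cases "r = 0")
            case False
            then show ?thesis using \<delta>'(2)[of r] r t by (simp add: field_simps)
          qed (simp add: \<Phi>0)
          ultimately show "\<exists>y. ((\<lambda>r. m \<sigma> r - \<epsilon> * r\<^sup>2 / 2) has_real_derivative y) (at r) \<and> y \<le> 0"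
            by blast
        qed (use t in simp)
        moreover have "(s0 + t *\<^sub>R \<sigma>, ?p0) \<in> U0" using \<delta>(2) t by simp
        note m_growth[OF this]
        ultimately have "(norm (\<xi> (s0 + t *\<^sub>R \<sigma>) - x0))\<^sup>2 + (norm (t *\<^sub>R (\<sigma> - \<pi> \<sigma>)))\<^sup>2 \<le> \<epsilon> * t\<^sup>2"
          by simp
        then have "((norm (\<xi> (s0 + t *\<^sub>R \<sigma>) - x0))\<^sup>2 + (norm (t *\<^sub>R (\<sigma> - \<pi> \<sigma>)))\<^sup>2) / t\<^sup>2 \<le> \<epsilon>"
          using t(1) by (simp add: pos_divide_le_eq)
        moreover have "(norm ((\<xi> (s0 + t *\<^sub>R \<sigma>) - x0) /\<^sub>R t))\<^sup>2 = (norm (\<xi> (s0 + t *\<^sub>R \<sigma>) - x0))\<^sup>2 / t\<^sup>2"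
          by (simp add: power_mult_distrib divide_inverse power_inverse mult.commute)
        moreover have "(norm (t *\<^sub>R (\<sigma> - \<pi> \<sigma>)))\<^sup>2 / t\<^sup>2 = (norm (\<sigma> - \<pi> \<sigma>))\<^sup>2"
          using t(1) by (simp add: power_mult_distrib)
        ultimately show ?thesis by (simp add: add_divide_distrib)
      qed
      then show "\<forall>\<^sub>F t in at_right 0. (norm ((\<xi> (s0 + t *\<^sub>R \<sigma>) - x0) /\<^sub>R t))\<^sup>2 + (norm (\<sigma> - \<pi> \<sigma>))\<^sup>2 \<le> \<epsilon>"
        unfolding eventually_at_right_field using \<delta>(1) \<delta>'(1)
        by (intro exI[of _ "min \<delta> \<delta>'"]) simp
    qed simp
    then have "(norm (\<xi>' s0 \<sigma>))\<^sup>2 + (norm (\<sigma> - \<pi> \<sigma>))\<^sup>2 \<le> 0"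
      using field_le_epsilon[of "(norm (\<xi>' s0 \<sigma>))\<^sup>2 + (norm (\<sigma> - \<pi> \<sigma>))\<^sup>2" 0] by simp
    then have "(norm (\<xi>' s0 \<sigma>))\<^sup>2 = 0 \<and> (norm (\<sigma> - \<pi> \<sigma>))\<^sup>2 = 0"
      using zero_le_power2[of "norm (\<xi>' s0 \<sigma>)"] zero_le_power2[of "norm (\<sigma> - \<pi> \<sigma>)"] by linarith
    then have "\<xi>' s0 \<sigma> = 0" "\<sigma> = \<pi> \<sigma>" by simp_all
    then have "Di (\<phi> x0) (\<pi> \<sigma>) = 0" using s0(2) by (simp add: \<xi>'_apply s0_def)
    then have "\<pi> \<sigma> = 0"
      using D_Di[OF x0(2), of "\<pi> \<sigma>"] by (simp add: blinfun.zero_right)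
    then show "\<sigma> = 0" using \<open>\<sigma> = \<pi> \<sigma>\<close> by simp
  qed
  show thesis
  proof (rule implicit_function[OF U0 C1_\<Phi> z0 \<Phi>0 inj[unfolded \<Phi>'_def]])
    fix B s
    assume B: "open B" "?p0 \<in> B" "s ?p0 = s0" "\<And>p. p \<in> B \<Longrightarrow> (s p, p) \<in> U0"
      "\<And>p. p \<in> B \<Longrightarrow> \<Phi> (s p, p) = 0" "\<And>p. p \<in> B \<Longrightarrow> s differentiable at p"
    have sW: "s p \<in> W0" if "p \<in> B" for p using B(4)[OF that] by (simp add: U0_def)
    show thesis
    proof (rule that[of B "\<lambda>p. \<xi> (s p)"])
      fix p assume p: "p \<in> B"
      show "\<xi> (s p) \<in> M" "\<xi> (s p) \<in> V" by (rule \<xi>_M[OF sW[OF p]])+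
      show "(\<xi> (s p), snd p) \<in> A" using B(4)[OF p] by (simp add: U0_def)
      show "(\<lambda>p. \<xi> (s p)) differentiable (at p)"
      proof -
        obtain s' where "(s has_derivative s') (at p)"
          using B(6)[OF p] unfolding differentiable_def by blast
        from has_derivative_compose[OF this der_\<xi>[OF sW[OF p]]] show ?thesis
          by (rule differentiableI)
      qed
      fix \<tau> assume \<tau>: "\<tau> \<in> tangent_space M (\<xi> (s p))"
      let ?c = "c (s p, p)"
      have z: "inner ?c (\<xi>' (s p) \<sigma>) + inner (s p - \<pi> (s p)) \<sigma> = 0" for \<sigma>
        using \<Phi>_inner[of "(s p, p)" \<sigma>] B(5)[OF p] by simp
      \<comment> \<open>\<open>\<xi>'\<close> factors through \<open>\<pi>\<close>, so testing with
        the component of \<open>s p\<close> orthogonal to \<open>S\<close> isolates its squared norm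
        and shows that \<open>s p\<close> lies in \<open>S\<close>.\<close>
      have "\<pi> (s p - \<pi> (s p)) = 0" by (simp add: linear_diff[OF lin] \<pi>)
      then have "s p - \<pi> (s p) = 0"
        using z[of "s p - \<pi> (s p)"] by (simp add: \<xi>'_apply blinfun.zero_right)
      then have z': "inner ?c (\<xi>' (s p) \<sigma>) = 0" for \<sigma> using z by simp
      have "D (\<xi> (s p)) \<tau> \<in> S"
        using \<tau> tangent_space_eq[OF \<xi>_M[OF sW[OF p]]] by simp
      moreover have "\<phi> (\<xi> (s p)) = \<pi> (s p)" unfolding \<xi>_def by (rule \<phi>_\<phi>i[OF \<pi>W[OF sW[OF p]]])
      ultimately have "\<xi>' (s p) (D (\<xi> (s p)) \<tau>) = \<tau>"
        using Di_D[OF \<xi>_M(2)[OF sW[OF p]], of \<tau>] by (simp add: \<xi>'_apply \<pi>)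
      then have "inner ?c \<tau> = 0" using z'[of "D (\<xi> (s p)) \<tau>"] by simp
      then show "inner \<tau> (\<alpha> *\<^sub>R G (\<xi> (s p), snd p) + \<xi> (s p) - fst p) = 0"
        by (simp add: c_def inner_commute algebra_simps)
    qed (use B s0 in auto)
  qed
qed


section \<open>Complex eigenvalues\<close>

text \<open>Multiplication by a complex scalar when \<open>(p, q)\<close> stands for
  \<open>p + i q\<close>. An eigenvector in the sense of \<open>complex_eigenvalue\<close> is a
  nonzero pair \<open>x\<close> with \<open>map_prod A A x = cscale z x\<close>.\<close>

definition cscale :: "complex \<Rightarrow> 'a::real_vector \<times> 'a \<Rightarrow> 'a \<times> 'a" where
  "cscale c x = (Re c *\<^sub>R fst x - Im c *\<^sub>R snd x, Im c *\<^sub>R fst x + Re c *\<^sub>R snd x)"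

text \<open>
  The value at \<open>x\<close> of the complex polynomial \<open>p\<close> in \<open>A\<close>, where pairs model the complexification.
\<close>

definition poly_orbit :: "('a::real_vector \<Rightarrow> 'a) \<Rightarrow> 'a \<times> 'a \<Rightarrow> complex poly \<Rightarrow> 'a \<times> 'a" where
  "poly_orbit A x p = (\<Sum>i\<le>degree p. cscale (coeff p i) (map_prod (A ^^ i) (A ^^ i) x))"

lemma cscale_simps:
  "cscale 0 x = 0" "cscale c 0 = 0" "cscale (a + b) x = cscale a x + cscale b x"
  "cscale c (x + y) = cscale c x + cscale c y" "cscale (a * b) x = cscale a (cscale b x)"
  "cscale 1 x = x"
  by (auto simp: cscale_def algebra_simps zero_prod_def prod_eq_iff)

lemma cscale_sum: "cscale c (\<Sum>i\<in>I. f i) = (\<Sum>i\<in>I. cscale c (f i))"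
  by (induction I rule: infinite_finite_induct) (auto simp: cscale_simps)

lemma map_prod_cscale:
  "linear A \<Longrightarrow> map_prod A A (cscale c x) = cscale c (map_prod A A x)"
  by (cases x) (simp add: cscale_def linear_add linear_diff linear_scale)

lemma poly_orbit_bound:
  "degree p \<le> n \<Longrightarrow> poly_orbit A x p = (\<Sum>i\<le>n. cscale (coeff p i) (map_prod (A ^^ i) (A ^^ i) x))"
  unfolding poly_orbit_def
  by (rule sum.mono_neutral_left) (auto simp: coeff_eq_0 cscale_simps)

text \<open>Multiplying by the indeterminate shifts the coefficients, which matches one more
  application of \<open>A\<close>.\<close>

lemma poly_orbit_linear_factor:
  assumes A: "linear A"
  shows "poly_orbit A x ([:- z, 1:] * r) = map_prod A A (poly_orbit A x r) - cscale z (poly_orbit A x r)"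
proof -
  let ?n = "degree r" and ?T = "\<lambda>i. map_prod (A ^^ i) (A ^^ i) x"
  have AT: "map_prod A A (?T i) = ?T (Suc i)" for i by (cases x) simp
  have lin: "map_prod A A (\<Sum>i\<in>I. f i) = (\<Sum>i\<in>I. map_prod A A (f i))" for f :: "nat \<Rightarrow> 'a \<times> 'a" and I
    by (induction I rule: infinite_finite_induct)
      (auto simp: prod_eq_iff linear_0[OF A] linear_add[OF A])
  have c: "coeff ([:- z, 1:] * r) i = (case i of 0 \<Rightarrow> 0 | Suc j \<Rightarrow> coeff r j) + (- z) * coeff r i" for i
    by (simp add: coeff_pCons split: nat.split)
  have deg: "degree ([:- z, 1:] * r) \<le> Suc ?n"
    using degree_mult_le[of "[:- z, 1:]" r] by simp
  have "poly_orbit A x ([:- z, 1:] * r) = (\<Sum>i\<le>Suc ?n. cscale (case i of 0 \<Rightarrow> 0 | Suc j \<Rightarrow> coeff r j) (?T i))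
      + (\<Sum>i\<le>Suc ?n. cscale (- z) (cscale (coeff r i) (?T i)))"
    unfolding poly_orbit_bound[OF deg] c cscale_simps(3,5) by (rule sum.distrib)
  also have "(\<Sum>i\<le>Suc ?n. cscale (case i of 0 \<Rightarrow> 0 | Suc j \<Rightarrow> coeff r j) (?T i))
      = map_prod A A (poly_orbit A x r)"
    unfolding sum.atMost_Suc_shift poly_orbit_def lin by (simp add: cscale_simps map_prod_cscale[OF A] AT)
  also have "(\<Sum>i\<le>Suc ?n. cscale (- z) (cscale (coeff r i) (?T i))) = cscale (- z) (poly_orbit A x r)"
    unfolding cscale_sum[symmetric] by (subst poly_orbit_bound[of r "Suc ?n"]) auto
  also have "cscale (- z) y = - cscale z y" for y :: "'a \<times> 'a"
    by (auto simp: cscale_def prod_eq_iff)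
  finally show ?thesis by simp
qed

text \<open>The iterates of a nonzero \<open>v\<close> are linearly dependent, so some nonzero
  polynomial in \<open>A\<close> annihilates \<open>v\<close>. Take one of least degree and split
  off a linear factor \<open>[:- z, 1:]\<close> at a root. By minimality the cofactor does not
  annihilate \<open>v\<close>, and its value there is an eigenvector for \<open>z\<close>.\<close>

lemma complex_eigenvalue_exists:
  fixes A :: "'a::euclidean_space \<Rightarrow> 'a"
  assumes A: "linear A"
  shows "\<exists>z. complex_eigenvalue A z"
proof -
  obtain v :: 'a where v: "v \<noteq> 0" using nonempty_Basis nonzero_Basis by blast
  define x where "x = (v, 0 :: 'a)"
  let ?f = "\<lambda>i. (A ^^ i) v"
  have "\<exists>c::nat \<Rightarrow> real. \<exists>n. (\<exists>i\<le>n. c i \<noteq> 0) \<and> (\<Sum>i\<le>n. c i *\<^sub>R ?f i) = 0"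
  \<comment> \<open>\<open>dependent\<close> speaks of sets, so a repetition among the iterates,
    which is a relation by itself, is handled apart.\<close>
  proof (cases "inj_on ?f {..DIM('a)}")
    case True
    let ?B = "?f ` {..DIM('a)}"
    have "card ?B > DIM('a)" using card_image[OF True] by simp
    then have "dependent ?B" by (intro dependent_biggerset) auto
    then obtain u where u: "\<exists>w\<in>?B. u w \<noteq> 0" "(\<Sum>w\<in>?B. u w *\<^sub>R w) = 0"
      using dependent_finite[of ?B] by blast
    have "(\<Sum>i\<le>DIM('a). u (?f i) *\<^sub>R ?f i) = 0"
      using u(2) by (simp add: sum.reindex[OF True])
    then show ?thesis using u(1) by (intro exI[of _ "\<lambda>i. u (?f i)"] exI[of _ "DIM('a)"]) auto
  next
    case False
    then obtain i j where ij: "?f i = ?f j" "i \<noteq> j" unfolding inj_on_def by blast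
    let ?c = "\<lambda>l. (if l = i then 1 else 0) - (if l = j then 1 else 0 :: real)"
    have "(\<Sum>l\<le>max i j. ?c l *\<^sub>R ?f l) = ?f i - ?f j"
      by (simp add: scaleR_diff_left sum_subtractf if_distrib[of "\<lambda>r. r *\<^sub>R _"] cong: if_cong)
    then show ?thesis using ij by (intro exI[of _ ?c] exI[of _ "max i j"]) (auto intro!: exI[of _ i])
  qed
  then obtain c :: "nat \<Rightarrow> real" and n i0 where c: "i0 \<le> n" "c i0 \<noteq> 0" "(\<Sum>i\<le>n. c i *\<^sub>R ?f i) = 0"
    by blast
  define P where "P = (\<Sum>i\<le>n. monom (complex_of_real (c i)) i)"
  have coeff_P: "coeff P i = (if i \<le> n then complex_of_real (c i) else 0)" for i
    by (simp add: P_def coeff_sum if_distrib cong: if_cong)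
  have "P \<noteq> 0" using c(1,2) coeff_P[of i0] by auto
  moreover have "poly_orbit A x P = 0"
  proof -
    have "degree P \<le> n" by (rule degree_le) (simp add: coeff_P)
    moreover have "cscale (complex_of_real (c i)) (map_prod (A ^^ i) (A ^^ i) x) = (c i *\<^sub>R ?f i, 0)" for i
    proof -
      have "linear (A ^^ i)" using A by (induction i) (auto intro: linear_compose simp: linear_id)
      then show ?thesis by (simp add: x_def cscale_def linear_0)
    qed
    ultimately have "poly_orbit A x P = (\<Sum>i\<le>n. (c i *\<^sub>R ?f i, 0))"
      by (simp add: poly_orbit_bound coeff_P)
    also have "\<dots> = (\<Sum>i\<le>n. c i *\<^sub>R ?f i, 0)" by (simp add: sum_prod)
    finally show ?thesis using c(3) by (simp add: zero_prod_def)
  qed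
  ultimately have "\<exists>p. p \<noteq> 0 \<and> poly_orbit A x p = 0" by blast
  from ex_has_least_nat[where P = "\<lambda>p. p \<noteq> 0 \<and> poly_orbit A x p = 0" and m = degree, OF conjI] this
  obtain p where p: "p \<noteq> 0" "poly_orbit A x p = 0"
    and least: "\<And>q. q \<noteq> 0 \<Longrightarrow> poly_orbit A x q = 0 \<Longrightarrow> degree p \<le> degree q"
    by (metis (no_types, lifting))
  have "degree p \<noteq> 0"
  proof
    assume "degree p = 0"
    then obtain a where a: "p = [:a:]" by (rule degree_eq_zeroE)
    then have "a \<noteq> 0" using p(1) by simp
    have "cscale a x = 0" using p(2) by (simp add: a poly_orbit_def map_prod_def)
    then have "cscale (inverse a * a) x = 0" unfolding cscale_simps(5) by (simp add: cscale_simps)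
    then show False using v \<open>a \<noteq> 0\<close> by (simp add: cscale_simps x_def zero_prod_def)
  qed
  then obtain z where "poly p z = 0"
    using fundamental_theorem_of_algebra[of p] constant_degree[of p] by auto
  then obtain r where r: "p = [:- z, 1:] * r" using poly_eq_0_iff_dvd by (metis dvdE)
  have "r \<noteq> 0" using p(1) r by auto
  have "degree p = Suc (degree r)" using \<open>r \<noteq> 0\<close> unfolding r by (subst degree_mult_eq) auto
  then have nz: "poly_orbit A x r \<noteq> 0" using least[of r] \<open>r \<noteq> 0\<close> by auto
  have "map_prod A A (poly_orbit A x r) = cscale z (poly_orbit A x r)"
    using p(2) unfolding r poly_orbit_linear_factor[OF A] by simp
  then have "complex_eigenvalue A z"
    unfolding complex_eigenvalue_def using nz
    by (intro exI[of _ "fst (poly_orbit A x r)"] exI[of _ "snd (poly_orbit A x r)"])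
      (auto simp: cscale_def prod_eq_iff zero_prod_def)
  then show ?thesis ..
qed

text \<open>Multiplication by \<open>z\<close> scales the sum of the squared norms of real and
  imaginary part by exactly \<open>(cmod z)\<^sup>2\<close>, so a norm bound for the real operator
  carries over to its complexification.\<close>

lemma complex_eigenvalue_norm_le:
  fixes A :: "'a::euclidean_space \<Rightarrow> 'a"
  assumes "complex_eigenvalue A z" "0 \<le> q" "\<And>v. norm (A v) \<le> q * norm v"
  shows "cmod z \<le> q"
proof -
  obtain p r where pr: "p \<noteq> 0 \<or> r \<noteq> 0" "A p = Re z *\<^sub>R p - Im z *\<^sub>R r" "A r = Im z *\<^sub>R p + Re z *\<^sub>R r"
    using assms(1) unfolding complex_eigenvalue_def by blast
  have pos: "(norm p)\<^sup>2 + (norm r)\<^sup>2 > 0"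
    using pr(1) by (auto simp: add_pos_nonneg add_nonneg_pos)
  have "(cmod z)\<^sup>2 * ((norm p)\<^sup>2 + (norm r)\<^sup>2) = (norm (A p))\<^sup>2 + (norm (A r))\<^sup>2"
    unfolding pr(2,3) cmod_power2 power2_norm_eq_inner
    by (simp add: algebra_simps inner_commute power2_eq_square)
  also have "\<dots> \<le> (q * norm p)\<^sup>2 + (q * norm r)\<^sup>2"
    using assms(3) by (intro add_mono power_mono) auto
  also have "\<dots> = q\<^sup>2 * ((norm p)\<^sup>2 + (norm r)\<^sup>2)"
    by (simp add: power_mult_distrib distrib_left)
  finally have "(cmod z)\<^sup>2 \<le> q\<^sup>2" using pos by simp
  then show ?thesis using assms(2) by (rule power2_le_imp_le)
qed

text \<open>Existence of an eigenvalue matters here: \<open>Sup {}\<close> is an unspecified real.\<close>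

lemma spectral_radius_le:
  fixes A :: "'a::euclidean_space \<Rightarrow> 'a"
  assumes "linear A" "0 \<le> q" "\<And>v. norm (A v) \<le> q * norm v"
  shows "spectral_radius A \<le> q"
  unfolding spectral_radius_def
  using complex_eigenvalue_exists[OF assms(1)] complex_eigenvalue_norm_le[OF _ assms(2,3)]
  by (intro cSup_least) auto

lemma bij_diff_contraction:
  fixes A :: "'a::euclidean_space \<Rightarrow> 'a"
  assumes "linear A" "q < 1" "\<And>v. norm (A v) \<le> q * norm v"
  shows "bij (\<lambda>v. v - A v)"
proof -
  have lin: "linear (\<lambda>v. v - A v)" by (intro linear_compose_sub assms linear_ident)
  have "v = 0" if "v - A v = 0" for v
  proof (rule ccontr)
    assume "v \<noteq> 0"
    then have "q * norm v < 1 * norm v" using assms(2) by (intro mult_strict_right_mono) auto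
    moreover have "A v = v" using that by simp
    ultimately show False using assms(3)[of v] by simp
  qed
  then have "inj (\<lambda>v. v - A v)" using linear_injective_0[OF lin] by blast
  then show ?thesis using linear_injective_imp_surjective[OF lin] by (simp add: bij_def)
qed

section \<open>The proximal gradient map\<close>

lemma partial_derivatives:
  assumes "(F has_derivative F') (at (x, u))"
  shows "D_x F (x, u) = (\<lambda>h. F' (h, 0))" "D_u F (x, u) = (\<lambda>h. F' (0, h))"
proof -
  have "((\<lambda>y. (y, u)) has_derivative (\<lambda>h. (h, 0))) (at x)"
    by (auto intro!: derivative_eq_intros)
  from has_derivative_compose[OF this assms]
  show "D_x F (x, u) = (\<lambda>h. F' (h, 0))"
    unfolding D_x_def prod.case by (rule frechet_derivative_at[symmetric])
  have "((\<lambda>w. (x, w)) has_derivative (\<lambda>h. (0, h))) (at u)"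
    by (auto intro!: derivative_eq_intros)
  from has_derivative_compose[OF this assms]
  show "D_u F (x, u) = (\<lambda>h. F' (0, h))"
    unfolding D_u_def prod.case by (rule frechet_derivative_at[symmetric])
qed

lemma linear_D_x:
  assumes "F differentiable (at (x, u))"
  shows "linear (D_x F (x, u))"
proof -
  obtain F' where F': "(F has_derivative F') (at (x, u))" using assms unfolding differentiable_def by blast
  then have "linear F'" by (rule has_derivative_linear)
  then show ?thesis
    unfolding partial_derivatives(1)[OF F']
    by (intro linearI) (metis add_Pair add_0 linear_add, metis scaleR_Pair scaleR_zero_right linear_scale)
qed

lemma objective_convex_subdiff:
  assumes "convex_fun (\<lambda>y. g (y, u))" "convex_on UNIV (\<lambda>y. f (y, u))" "GDERIV (\<lambda>y. f (y, u)) x :> d"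
  shows "convex_subdiff (\<lambda>y. objective f g (y, u)) x = (\<lambda>v. d + v) ` convex_subdiff (\<lambda>y. g (y, u)) x"
proof -
  have "v \<in> convex_subdiff (\<lambda>y. objective f g (y, u)) x \<longleftrightarrow> v - d \<in> convex_subdiff (\<lambda>y. g (y, u)) x" for v
    unfolding objective_def by (rule convex_subdiff_add_smooth[OF assms])
  note * = this
  show ?thesis
  proof (intro set_eqI iffI)
    fix v assume "v \<in> convex_subdiff (\<lambda>y. objective f g (y, u)) x"
    then show "v \<in> (\<lambda>v. d + v) ` convex_subdiff (\<lambda>y. g (y, u)) x"
      unfolding * by (intro image_eqI[of _ _ "v - d"]) simp_all
  next
    fix v assume "v \<in> (\<lambda>v. d + v) ` convex_subdiff (\<lambda>y. g (y, u)) x"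
    then obtain w where "v = d + w" "w \<in> convex_subdiff (\<lambda>y. g (y, u)) x" by blast
    then show "v \<in> convex_subdiff (\<lambda>y. objective f g (y, u)) x" unfolding * by simp
  qed
qed

text \<open>The norm bound, rather than a bound on eigenvalues, is recorded because it also makes
  the identity minus this operator invertible.\<close>

lemma proximal_gradient_at_solution:
  fixes f :: "'x::euclidean_space \<times> 'u::euclidean_space \<Rightarrow> real" and g :: "'x \<times> 'u \<Rightarrow> ereal"
  assumes M: "C2_submanifold M" and \<Omega>: "open \<Omega>" and C: "CPSO f g M \<Omega> L"
    and L: "L > 0" and \<alpha>: "\<alpha> > 0" "\<alpha> * L < 2"
    and x0: "x0 \<in> M" and u0: "u0 \<in> \<Omega>" and R: "RPD_ii f M (x0, u0)" and N: "ND f g (x0, u0)"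
  shows "PG f g \<alpha> (x0, u0) = x0 \<and> PG f g \<alpha> differentiable (at (x0, u0)) \<and>
    (\<exists>q. 0 \<le> q \<and> q < 1 \<and> (\<forall>v. norm (D_x (PG f g \<alpha>) (x0, u0) (tproj M x0 v)) \<le> q * norm v))"
proof -
  obtain V W \<phi> \<phi>i S D Di where "manifold_chart M V W \<phi> \<phi>i S D Di" and x0V: "x0 \<in> V"
    by (rule C2_submanifold_chart[OF M x0])
  then interpret manifold_chart M V W \<phi> \<phi>i S D Di by simp
  have f2: "C2_on f UNIV" and ps: "\<And>z. z \<in> M \<times> \<Omega> \<Longrightarrow> partly_smooth_at g (M \<times> \<Omega>) z"
    and cf: "\<And>u. u \<in> \<Omega> \<Longrightarrow> convex_on UNIV (\<lambda>x. f (x, u))"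
    and cg: "\<And>u. u \<in> \<Omega> \<Longrightarrow> convex_fun (\<lambda>x. g (x, u))"
    and lip: "\<And>u. u \<in> \<Omega> \<Longrightarrow> L-lipschitz_on UNIV (grad (\<lambda>x. f (x, u)))"
    using C unfolding CPSO_def partly_smooth_def by blast+
  obtain Gf where Gf: "C1_on Gf UNIV" "\<And>x u. GDERIV (\<lambda>y. f (y, u)) x :> Gf (x, u)"
    using C2_on_UNIV_partial_gradient[OF f2] by blast
  have gradf: "grad (\<lambda>y. f (y, u)) = (\<lambda>y. Gf (y, u))" for u
    using grad_eqI[OF Gf(2)] by blast
  obtain Gf' where Gf': "(Gf has_derivative Gf') (at (x0, u0))"
    using Gf(1) unfolding C1_on_def by blast
  define H where "H = (\<lambda>v. Gf' (v, 0))"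
  have "((\<lambda>y. (y, u0)) has_derivative (\<lambda>h. (h, 0))) (at x0)"
    by (auto intro!: derivative_eq_intros)
  from has_derivative_compose[OF this Gf']
  have derH: "((\<lambda>y. Gf (y, u0)) has_derivative H) (at x0)" by (simp add: H_def)
  have linH: "linear H" using derH has_derivative_linear by blast
  have hess: "hess (\<lambda>y. f (y, u0)) x0 = H"
    unfolding hess_def gradf by (rule frechet_derivative_at[OF derH, symmetric])
  let ?T = "tangent_space M x0"
  have T: "subspace ?T" by (rule subspace_tangent_space[OF x0 x0V])
  have pos: "0 < inner v (H v)" if "v \<in> ?T" "v \<noteq> 0" for v
  proof -
    have "0 < inner v (tproj M x0 (H v))"
      using R that unfolding RPD_ii_def pos_def_on_def prod.case hess by blast
    also have "inner v (tproj M x0 (H v)) = inner v (H v)"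
      using inner_orth_proj[OF T that(1), of "H v"] by (simp add: tproj_def inner_commute)
    finally show ?thesis .
  qed
  have co: "(norm (H v))\<^sup>2 \<le> L * inner (H v) v" for v
    by (rule convex_lipschitz_hessian_cocoercive[OF cf[OF u0] Gf(2) lip[OF u0, unfolded gradf] L derH])
  obtain q where q: "0 \<le> q" "q < 1" "\<And>v. v \<in> ?T \<Longrightarrow> norm (v - \<alpha> *\<^sub>R H v) \<le> q * norm v"
    by (rule gradient_step_contraction[OF T linH pos co \<alpha>]) blast+
  let ?K = "\<lambda>x u. convex_subdiff (\<lambda>y. g (y, u)) x"
  define d where "d = - Gf (x0, u0)"
  \<comment> \<open>(ND) is moved to \<open>g\<close> by translating the subdifferential by the
    gradient of \<open>f\<close>, which commutes with taking the relative interior.\<close>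
  have ri: "d \<in> rel_interior (?K x0 u0)"
  proof -
    have "0 \<in> (\<lambda>v. Gf (x0, u0) + v) ` rel_interior (?K x0 u0)"
      using N unfolding ND_def prod.case objective_convex_subdiff[OF cg[OF u0] cf[OF u0] Gf(2)]
        rel_interior_translation .
    then obtain v where v: "0 = Gf (x0, u0) + v" "v \<in> rel_interior (?K x0 u0)" by blast
    have "d = v" unfolding d_def using v(1) by (metis add.inverse_unique)
    with v(2) show ?thesis by simp
  qed
  then have dK: "d \<in> ?K x0 u0" using rel_interior_subset by blast
  define w0 where "w0 = x0 - \<alpha> *\<^sub>R Gf (x0, u0)"
  have w0d: "(w0 - x0) /\<^sub>R \<alpha> = d" using \<alpha>(1) by (simp add: w0_def d_def)
  have prox0: "prox \<alpha> g (w0, u0) = x0"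
    by (rule prox_eqI[OF \<alpha>(1)]) (simp only: w0d dK)
  have PG: "PG f g \<alpha> = (\<lambda>z. prox \<alpha> g (fst z - \<alpha> *\<^sub>R Gf z, snd z))"
    by (auto simp: PG_def gradf)
  obtain k A where A: "open A" "(x0, u0) \<in> A" "C2_on k A" "\<And>z. z \<in> (M \<times> \<Omega>) \<inter> A \<Longrightarrow> g z = ereal (k z)"
    using ps[of "(x0, u0)"] x0 u0 unfolding partly_smooth_at_def C2_extension_def by blast
  obtain Gk where Gk: "C1_on Gk A" "\<And>x u. (x, u) \<in> A \<Longrightarrow> GDERIV (\<lambda>y. k (y, u)) x :> Gk (x, u)"
    using C2_on_partial_gradient[OF A(3)] by blast
  \<comment> \<open>On \<open>M\<close> near the base point \<open>k\<close> represents
    \<open>g\<close>, so strong convexity of the proximal objective supplies the growth needed for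
    nondegeneracy.\<close>
  have growth: "\<alpha> * k (x0, u0) + (norm (x0 - w0))\<^sup>2 / 2 + (norm (y - x0))\<^sup>2 / 2 \<le> \<alpha> * k (y, u0) + (norm (y - w0))\<^sup>2 / 2"
    if "y \<in> M" "(y, u0) \<in> A" for y
  proof (rule prox_growth[OF \<alpha>(1), where h = "\<lambda>y. g (y, u0)"])
    show "(w0 - x0) /\<^sub>R \<alpha> \<in> ?K x0 u0" by (simp only: w0d dK)
    show "g (x0, u0) = ereal (k (x0, u0))" using A x0 u0 by blast
    show "g (y, u0) \<le> ereal (k (y, u0))" using A(4)[of "(y, u0)"] that u0 by simp
  qed
  obtain B P where B: "open B" "(w0, u0) \<in> B" and P0: "P (w0, u0) = x0"
    and PM: "\<And>p. p \<in> B \<Longrightarrow> P p \<in> M" "\<And>p. p \<in> B \<Longrightarrow> P p \<in> V" "\<And>p. p \<in> B \<Longrightarrow> (P p, snd p) \<in> A"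
    and crit: "\<And>p \<tau>. p \<in> B \<Longrightarrow> \<tau> \<in> tangent_space M (P p) \<Longrightarrow> inner \<tau> (\<alpha> *\<^sub>R Gk (P p, snd p) + P p - fst p) = 0"
    and Pd: "\<And>p. p \<in> B \<Longrightarrow> P differentiable (at p)"
    by (rule critical_point_map[where \<alpha> = \<alpha>, OF x0 x0V A(1,2) Gk growth]) blast+
  obtain P' where P': "(P has_derivative P') (at (w0, u0))"
    using Pd[OF B(2)] unfolding differentiable_def by blast
  have ident: "\<forall>\<^sub>F p in nhds (w0, u0). (fst p - P p) /\<^sub>R \<alpha> \<in> ?K (P p) (snd p)"
  proof (rule ccontr)
    assume not_ev: "\<not> ?thesis"
    have "open (B \<inter> (UNIV \<times> \<Omega>))" by (intro open_Int open_Times B \<Omega> open_UNIV)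
    then have ev: "\<forall>\<^sub>F p in nhds (w0, u0). p \<in> B \<inter> (UNIV \<times> \<Omega>)"
      using B u0 by (intro eventually_nhds_in_open) auto
    obtain p where p: "p \<longlonglongrightarrow> (w0, u0)" "\<And>n. p n \<in> B \<inter> (UNIV \<times> \<Omega>)"
      "\<And>n. (fst (p n) - P (p n)) /\<^sub>R \<alpha> \<notin> ?K (P (p n)) (snd (p n))"
      by (rule not_eventually_nhds_sequence[OF not_ev ev]) blast
    have pB: "p n \<in> B" and p\<Omega>: "snd (p n) \<in> \<Omega>" for n using p(2)[of n] by auto
    have Plim: "(\<lambda>n. P (p n)) \<longlonglongrightarrow> x0"
      using isCont_tendsto_compose[OF has_derivative_continuous[OF P'] p(1)] P0 by simp
    have ulim: "(\<lambda>n. snd (p n)) \<longlonglongrightarrow> u0" using tendsto_snd[OF p(1)] by simp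
    have "(\<lambda>n. (fst (p n) - P (p n)) /\<^sub>R \<alpha>) \<longlonglongrightarrow> (fst (w0, u0) - x0) /\<^sub>R \<alpha>"
      by (intro tendsto_intros Plim p(1))
    then have dlim: "(\<lambda>n. (fst (p n) - P (p n)) /\<^sub>R \<alpha>) \<longlonglongrightarrow> d" by (simp only: fst_conv w0d)
    \<comment> \<open>The criticality equation divided by \<open>\<alpha>\<close>: the candidate
      subgradient has the tangential part of \<open>Gk\<close>.\<close>
    have tang: "inner \<tau> (Gk (P (p n), snd (p n)) - (fst (p n) - P (p n)) /\<^sub>R \<alpha>) = 0"
      if "\<tau> \<in> tangent_space M (P (p n))" for n \<tau>
    proof -
      have "\<alpha> *\<^sub>R (Gk (P (p n), snd (p n)) - (fst (p n) - P (p n)) /\<^sub>R \<alpha>)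
          = \<alpha> *\<^sub>R Gk (P (p n), snd (p n)) + P (p n) - fst (p n)"
        using \<alpha>(1) by (simp add: scaleR_diff_right)
      then have "\<alpha> * inner \<tau> (Gk (P (p n), snd (p n)) - (fst (p n) - P (p n)) /\<^sub>R \<alpha>) = 0"
        using crit[OF pB that] by (metis inner_scaleR_right)
      then show ?thesis using \<alpha>(1) by simp
    qed
    show False
      by (rule subdiff_identification[OF x0 x0V u0 \<Omega> ps cg ri A(1,4) Gk(2)
            PM(1)[OF pB] PM(2)[OF pB] Plim p\<Omega> ulim PM(3)[OF pB] dlim tang p(3)])
  qed
  have "\<forall>\<^sub>F p in nhds (w0, u0). P p = prox \<alpha> g p"
    using ident
  proof eventually_elim
    case (elim p)
    then show ?case using prox_eqI[OF \<alpha>(1), of "fst p" "P p" g "snd p"] by simp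
  qed
  then obtain B' where B': "open B'" "(w0, u0) \<in> B'" "\<And>p. p \<in> B' \<Longrightarrow> P p = prox \<alpha> g p"
    unfolding eventually_nhds by blast
  have prox': "(prox \<alpha> g has_derivative P') (at (w0, u0))"
    by (rule has_derivative_transform_within_open[OF P' B'])
  have "((\<lambda>z. (fst z - \<alpha> *\<^sub>R Gf z, snd z)) has_derivative (\<lambda>h. (fst h - \<alpha> *\<^sub>R Gf' h, snd h))) (at (x0, u0))"
    by (intro has_derivative_Pair has_derivative_diff has_derivative_scaleR_right Gf'
        bounded_linear_imp_has_derivative bounded_linear_fst bounded_linear_snd)
  from has_derivative_compose[OF this, of "prox \<alpha> g" P'] prox'
  have PG': "(PG f g \<alpha> has_derivative (\<lambda>h. P' (fst h - \<alpha> *\<^sub>R Gf' h, snd h))) (at (x0, u0))"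
    unfolding PG by (simp add: w0_def)
  have D_x: "D_x (PG f g \<alpha>) (x0, u0) v = P' (v - \<alpha> *\<^sub>R H v, 0)" for v
    unfolding partial_derivatives(1)[OF PG'] H_def by simp
  text \<open>The proximal map is firmly nonexpansive, hence so is its derivative in the first argument.\<close>
  have nonexp: "norm (P' (v, 0)) \<le> norm v" for v
  proof -
    let ?p = "\<lambda>t. (w0, u0) + t *\<^sub>R (v, 0)"
    let ?\<Delta> = "\<lambda>t. (P (?p t) - P (w0, u0)) /\<^sub>R t"
    have lim: "(?\<Delta> \<longlongrightarrow> P' (v, 0)) (at 0)" by (rule has_derivative_directional_limit[OF P'])
    have "(?p \<longlongrightarrow> (w0, u0) + 0 *\<^sub>R (v, 0)) (at 0)" by (intro tendsto_intros)
    then have "filterlim ?p (nhds (w0, u0)) (at 0)" by simp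
    then have "\<forall>\<^sub>F t in at 0. (fst (?p t) - P (?p t)) /\<^sub>R \<alpha> \<in> ?K (P (?p t)) (snd (?p t))"
      using ident unfolding filterlim_iff by blast
    moreover have "\<forall>\<^sub>F t::real in at 0. t \<noteq> 0" by (simp add: eventually_at_filter)
    ultimately have "\<forall>\<^sub>F t in at 0. (norm (?\<Delta> t))\<^sup>2 \<le> inner (?\<Delta> t) v"
    proof eventually_elim
      case (elim t)
      let ?x = "P (?p t)"
      \<comment> \<open>The parameter stays at \<open>u0\<close>, so both vectors are subgradients
        of one convex function and monotonicity applies.\<close>
      have "(w0 + t *\<^sub>R v - ?x) /\<^sub>R \<alpha> \<in> ?K ?x u0" "(w0 - x0) /\<^sub>R \<alpha> \<in> ?K x0 u0"
        using elim(1) dK by (simp_all add: w0d)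
      from convex_subdiff_monotone[OF this]
      have "0 \<le> inner ((w0 + t *\<^sub>R v - ?x) /\<^sub>R \<alpha> - (w0 - x0) /\<^sub>R \<alpha>) (?x - x0)" .
      also have "(w0 + t *\<^sub>R v - ?x) /\<^sub>R \<alpha> - (w0 - x0) /\<^sub>R \<alpha> = (t *\<^sub>R v - (?x - x0)) /\<^sub>R \<alpha>"
        by (simp add: algebra_simps)
      finally have "0 \<le> inner (t *\<^sub>R v - (?x - x0)) (?x - x0)"
        using \<alpha>(1) by (simp add: zero_le_mult_iff)
      moreover have "inner (t *\<^sub>R v - y) y = t * inner y v - (norm y)\<^sup>2" for y
        by (simp add: power2_norm_eq_inner inner_diff_left inner_commute[of v y])
      ultimately have "(norm (?x - x0))\<^sup>2 \<le> t * inner (?x - x0) v" by simp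
      then have "(norm (?x - x0))\<^sup>2 / t\<^sup>2 \<le> t * inner (?x - x0) v / t\<^sup>2"
        by (intro divide_right_mono) auto
      then show ?case
        using elim(2) by (simp add: P0 power_mult_distrib divide_simps power2_eq_square)
    qed
    then have "(norm (P' (v, 0)))\<^sup>2 \<le> inner (P' (v, 0)) v"
      by (intro tendsto_le[of "at (0::real)" "\<lambda>t. inner (?\<Delta> t) v" _ "\<lambda>t. (norm (?\<Delta> t))\<^sup>2"] tendsto_intros lim) auto
    also have "\<dots> \<le> norm (P' (v, 0)) * norm v" by (rule norm_cauchy_schwarz)
    finally show ?thesis
      by (cases "P' (v, 0) = 0") (simp_all add: power2_eq_square)
  qed
  \<comment> \<open>The gradient step is known to contract only on tangent vectors, which is what
    the projection provides.\<close>
  have "norm (D_x (PG f g \<alpha>) (x0, u0) (tproj M x0 v)) \<le> q * norm v" for v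
  proof -
    let ?t = "tproj M x0 v"
    have "norm (D_x (PG f g \<alpha>) (x0, u0) ?t) \<le> norm (?t - \<alpha> *\<^sub>R H ?t)"
      unfolding D_x by (rule nonexp)
    also have "\<dots> \<le> q * norm ?t" by (rule q(3)) (simp add: tproj_def orth_proj_props(1)[OF T])
    also have "\<dots> \<le> q * norm v"
      using norm_orth_proj[OF T] q(1) by (intro mult_left_mono) (simp add: tproj_def)
    finally show ?thesis .
  qed
  moreover have "PG f g \<alpha> (x0, u0) = x0" using prox0 by (simp add: PG w0_def)
  moreover have "PG f g \<alpha> differentiable (at (x0, u0))" using PG' by (rule differentiableI)
  ultimately show ?thesis using q(1,2) by blast
qed

text \<open>The local solution map carries (ND) and (RPD-i) along \<open>\<psi>\<close>, so (RPD-ii)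
  has to be propagated separately. Unit tangent vectors witnessing failure along a sequence
  accumulate at a unit vector tangent at \<open>x0\<close>, where continuity of the Hessian
  contradicts \<open>R\<close>.\<close>

lemma RPD_ii_persists:
  fixes f :: "'x::euclidean_space \<times> 'u::euclidean_space \<Rightarrow> real"
  assumes M: "C2_submanifold M" and f: "C2_on f UNIV" and R: "RPD_ii f M (x0, u0)"
    and U: "open U" "u0 \<in> U" and \<psi>: "continuous_on U \<psi>" "\<psi> ` U \<subseteq> M" "\<psi> u0 = x0"
  shows "\<forall>\<^sub>F u in nhds u0. RPD_ii f M (\<psi> u, u)"
proof (rule ccontr)
  assume not_ev: "\<not> ?thesis"
  have x0: "x0 \<in> M" using U(2) \<psi> by blast
  obtain V W \<phi> \<phi>i S D Di where "manifold_chart M V W \<phi> \<phi>i S D Di" and x0V: "x0 \<in> V"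
    by (rule C2_submanifold_chart[OF M x0])
  then interpret manifold_chart M V W \<phi> \<phi>i S D Di by simp
  obtain Gf where Gf: "C1_on Gf UNIV" "\<And>x u. GDERIV (\<lambda>y. f (y, u)) x :> Gf (x, u)"
    using C2_on_UNIV_partial_gradient[OF f] by blast
  have gradf: "grad (\<lambda>y. f (y, u)) = (\<lambda>y. Gf (y, u))" for u
    using grad_eqI[OF Gf(2)] by blast
  obtain Gf' where Gf': "\<And>z. (Gf has_derivative blinfun_apply (Gf' z)) (at z)" "continuous_on UNIV Gf'"
    using Gf(1) unfolding C1_on_def by blast
  have hess: "hess (\<lambda>y. f (y, u)) x v = Gf' (x, u) (v, 0)" for x u v
  proof -
    have "((\<lambda>y. (y, u)) has_derivative (\<lambda>h. (h, 0))) (at x)"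
      by (auto intro!: derivative_eq_intros)
    from frechet_derivative_at[OF has_derivative_compose[OF this Gf'(1)]]
    show ?thesis unfolding hess_def gradf by metis
  qed
  \<comment> \<open>Against a tangent \<open>v\<close> the projection has no effect; removing it
    leaves an expression visibly continuous in the point and in \<open>v\<close>.\<close>
  have RPD: "RPD_ii f M (x, u) \<longleftrightarrow> (\<forall>v\<in>tangent_space M x. v \<noteq> 0 \<longrightarrow> 0 < inner v (Gf' (x, u) (v, 0)))"
    if "x \<in> M" "x \<in> V" for x u
    unfolding RPD_ii_def pos_def_on_def prod.case hess
    using inner_orth_proj[OF subspace_tangent_space[OF that]]
    by (intro ball_cong refl) (simp add: tproj_def inner_commute)
  have cont: "isCont \<psi> u0" using \<psi>(1) U by (simp add: continuous_on_eq_continuous_at)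
  have "\<forall>\<^sub>F u in nhds u0. \<psi> u \<in> V"
  proof -
    have "filterlim \<psi> (nhds x0) (nhds u0)"
      using cont unfolding isCont_def tendsto_at_iff_tendsto_nhds by (simp add: \<psi>(3))
    then show ?thesis using eventually_nhds_in_open[OF open_V x0V] unfolding filterlim_iff by blast
  qed
  moreover have "\<forall>\<^sub>F u in nhds u0. u \<in> U" by (rule eventually_nhds_in_open[OF U])
  ultimately have ev: "\<forall>\<^sub>F u in nhds u0. u \<in> U \<and> \<psi> u \<in> V" by eventually_elim simp
  obtain X where X: "X \<longlonglongrightarrow> u0" "\<And>n. X n \<in> U \<and> \<psi> (X n) \<in> V" "\<And>n. \<not> RPD_ii f M (\<psi> (X n), X n)"
    by (rule not_eventually_nhds_sequence[OF not_ev ev]) blast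
  have \<psi>X: "\<psi> (X n) \<in> M" "\<psi> (X n) \<in> V" for n using X(2)[of n] \<psi>(2) by auto
  \<comment> \<open>The quadratic form is homogeneous of degree two, so a direction violating
    positivity may be normalized.\<close>
  have "\<exists>v. v \<in> tangent_space M (\<psi> (X n)) \<and> norm v = 1 \<and> inner v (Gf' (\<psi> (X n), X n) (v, 0)) \<le> 0" for n
  proof -
    obtain v where v: "v \<in> tangent_space M (\<psi> (X n))" "v \<noteq> 0" "inner v (Gf' (\<psi> (X n), X n) (v, 0)) \<le> 0"
      using X(3)[of n] unfolding RPD[OF \<psi>X] by force
    have "(v /\<^sub>R norm v, 0) = (v, 0) /\<^sub>R norm v" by simp
    then have "Gf' (\<psi> (X n), X n) (v /\<^sub>R norm v, 0) = Gf' (\<psi> (X n), X n) (v, 0) /\<^sub>R norm v"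
      by (metis blinfun.scaleR_right)
    then have "inner (v /\<^sub>R norm v) (Gf' (\<psi> (X n), X n) (v /\<^sub>R norm v, 0))
      = (inverse (norm v))\<^sup>2 * inner v (Gf' (\<psi> (X n), X n) (v, 0))"
      by (simp add: power2_eq_square)
    also have "\<dots> \<le> 0" using v(3) by (simp add: mult_nonneg_nonpos)
    finally show ?thesis
      using v subspace_scale[OF subspace_tangent_space[OF \<psi>X] v(1)]
      by (intro exI[of _ "v /\<^sub>R norm v"]) auto
  qed
  then obtain v where v: "\<And>n. v n \<in> tangent_space M (\<psi> (X n))" "\<And>n. norm (v n) = 1"
    "\<And>n. inner (v n) (Gf' (\<psi> (X n), X n) (v n, 0)) \<le> 0" by metis
  have "v n \<in> sphere 0 1" for n using v(2) by simp
  then obtain e r where r: "e \<in> sphere 0 1" "strict_mono r" "(v \<circ> r) \<longlonglongrightarrow> e"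
    by (rule compact_subseq[OF compact_sphere])
  have Xr: "(\<lambda>n. X (r n)) \<longlonglongrightarrow> u0" using LIMSEQ_subseq_LIMSEQ[OF X(1) r(2)] by (simp add: o_def)
  have vr: "(\<lambda>n. v (r n)) \<longlonglongrightarrow> e" using r(3) by (simp add: o_def)
  have \<psi>r: "(\<lambda>n. \<psi> (X (r n))) \<longlonglongrightarrow> x0" using isCont_tendsto_compose[OF cont Xr] \<psi>(3) by simp
  have e: "e \<in> tangent_space M x0"
    by (rule tangent_space_outer_limit[OF \<psi>r x0 x0V \<psi>X v(1) vr])
  have "(\<lambda>n. Gf' (\<psi> (X (r n)), X (r n))) \<longlonglongrightarrow> Gf' (x0, u0)"
    by (rule continuous_on_tendsto_compose[OF Gf'(2)]) (intro tendsto_intros \<psi>r Xr | simp)+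
  then have "(\<lambda>n. inner (v (r n)) (Gf' (\<psi> (X (r n)), X (r n)) (v (r n), 0))) \<longlonglongrightarrow> inner e (Gf' (x0, u0) (e, 0))"
    by (intro tendsto_intros vr)
  then have "inner e (Gf' (x0, u0) (e, 0)) \<le> 0"
    by (rule LIMSEQ_le_const2) (use v(3) in blast)
  moreover have "e \<noteq> 0" using r(1) by auto
  ultimately show False using R[unfolded RPD[OF x0 x0V]] e by force
qed

text \<open>\<open>D_x\<close>, \<open>D_u\<close> and \<open>inv\<close> are total, with
  unspecified values where no derivative or inverse exists. Differentiability and bijectivity are
  therefore asserted together with the formulas.\<close>

theorem mainTheorem1:
  fixes f :: "'x::euclidean_space \<times> 'u::euclidean_space \<Rightarrow> real"
    and g :: "'x \<times> 'u \<Rightarrow> ereal"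
    and M :: "'x set" and \<Omega> :: "'u set"
    and L \<alpha>lo \<alpha>hi :: real
    and xs :: 'x and us :: 'u
  assumes "C2_submanifold M" and "open \<Omega>"
    and "CPSO f g M \<Omega> L"
    and "0 < \<alpha>lo" and "\<alpha>lo \<le> \<alpha>hi" and "\<alpha>hi < 2 / L"
    and "xs \<in> M" and "us \<in> \<Omega>"
    and "RPD_ii f M (xs, us)" and "ND f g (xs, us)"
  shows "(\<forall>\<alpha>\<in>{\<alpha>lo..\<alpha>hi}.
            PG f g \<alpha> differentiable (at (xs, us))
          \<and> spectral_radius (D_x (PG f g \<alpha>) (xs, us) \<circ> tproj M xs) < 1)
       \<and> (RPD_i f g M (xs, us) \<longrightarrow>
            (\<forall>U \<psi>. local_solution_map f g M \<Omega> xs us U \<psi> \<longrightarrow>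
              (\<forall>\<alpha>\<in>{\<alpha>lo..\<alpha>hi}. \<exists>V. open V \<and> us \<in> V \<and> V \<subseteq> U \<and>
                (\<forall>u\<in>V.
                   \<psi> u = PG f g \<alpha> (\<psi> u, u)
                 \<and> PG f g \<alpha> differentiable (at (\<psi> u, u))
                 \<and> bij (\<lambda>v. v - D_x (PG f g \<alpha>) (\<psi> u, u) (tproj M (\<psi> u) v))
                 \<and> (\<psi> has_derivative
                      inv (\<lambda>v. v - D_x (PG f g \<alpha>) (\<psi> u, u) (tproj M (\<psi> u) v))
                        \<circ> D_u (PG f g \<alpha>) (\<psi> u, u)) (at u)))))"
proof -
  \<comment> \<open>For \<open>L \<le> 0\<close>, including \<open>2 / 0 = 0\<close>, no step size
    could lie strictly between \<open>0\<close> and \<open>2 / L\<close>.\<close>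
  have L: "L > 0"
  proof (rule ccontr)
    assume "\<not> L > 0"
    then have "2 / L \<le> 0" by (simp add: divide_nonneg_nonpos)
    then show False using assms(4-6) by linarith
  qed
  have \<alpha>: "\<alpha> > 0 \<and> \<alpha> * L < 2" if "\<alpha> \<in> {\<alpha>lo..\<alpha>hi}" for \<alpha>
  proof -
    have "\<alpha> > 0" "\<alpha> < 2 / L" using that assms(4-6) by auto
    then show ?thesis using L by (simp add: pos_less_divide_eq)
  qed
  note local = proximal_gradient_at_solution[OF assms(1-3) L]
  have part1: "PG f g \<alpha> differentiable (at (xs, us))
      \<and> spectral_radius (D_x (PG f g \<alpha>) (xs, us) \<circ> tproj M xs) < 1" if \<alpha>_in: "\<alpha> \<in> {\<alpha>lo..\<alpha>hi}" for \<alpha>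
  proof -
    have diff: "PG f g \<alpha> differentiable (at (xs, us))"
      using local[of \<alpha>, OF _ _ assms(7-10)] \<alpha>[OF \<alpha>_in] by blast
    obtain q where q: "0 \<le> q" "q < 1" "\<And>v. norm (D_x (PG f g \<alpha>) (xs, us) (tproj M xs v)) \<le> q * norm v"
      using local[of \<alpha>, OF _ _ assms(7-10)] \<alpha>[OF \<alpha>_in] by blast
    have "linear (D_x (PG f g \<alpha>) (xs, us) \<circ> tproj M xs)"
      by (rule linear_compose[OF tproj_properties(1)[OF assms(1,7)] linear_D_x[OF diff]])
    then have "spectral_radius (D_x (PG f g \<alpha>) (xs, us) \<circ> tproj M xs) \<le> q"
      by (rule spectral_radius_le[OF _ q(1)]) (simp add: q(3))
    with q(2) diff show ?thesis by simp
  qed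
  have part2: "\<exists>V. open V \<and> us \<in> V \<and> V \<subseteq> U \<and>
      (\<forall>u\<in>V. \<psi> u = PG f g \<alpha> (\<psi> u, u)
         \<and> PG f g \<alpha> differentiable (at (\<psi> u, u))
         \<and> bij (\<lambda>v. v - D_x (PG f g \<alpha>) (\<psi> u, u) (tproj M (\<psi> u) v))
         \<and> (\<psi> has_derivative inv (\<lambda>v. v - D_x (PG f g \<alpha>) (\<psi> u, u) (tproj M (\<psi> u) v))
              \<circ> D_u (PG f g \<alpha>) (\<psi> u, u)) (at u))"
    if lsm: "local_solution_map f g M \<Omega> xs us U \<psi>" and \<alpha>_in: "\<alpha> \<in> {\<alpha>lo..\<alpha>hi}" for U \<psi> \<alpha>
  proof -
    have U: "open U" "us \<in> U" "U \<subseteq> \<Omega>" and \<psi>: "C1_on \<psi> U" "\<psi> ` U \<subseteq> M" "\<psi> us = xs"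
      and nd: "\<And>u. u \<in> U \<Longrightarrow> ND f g (\<psi> u, u)"
      using lsm unfolding local_solution_map_def by auto
    have "C2_on f UNIV" using assms(3) unfolding CPSO_def by blast
    from RPD_ii_persists[OF assms(1) this assms(9) U(1,2) C1_on_imp_continuous_on[OF \<psi>(1)] \<psi>(2,3)]
    obtain N where N: "open N" "us \<in> N" "\<And>u. u \<in> N \<Longrightarrow> RPD_ii f M (\<psi> u, u)"
      unfolding eventually_nhds by blast
    define V where "V = N \<inter> U"
    have V: "open V" "us \<in> V" "V \<subseteq> U" using N U by (auto simp: V_def)
    have fix_point: "PG f g \<alpha> (\<psi> u, u) = \<psi> u" and diff: "PG f g \<alpha> differentiable (at (\<psi> u, u))"
      and contr: "\<exists>q. 0 \<le> q \<and> q < 1 \<and> (\<forall>v. norm (D_x (PG f g \<alpha>) (\<psi> u, u) (tproj M (\<psi> u) v)) \<le> q * norm v)"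
      if "u \<in> V" for u
    proof -
      have "\<psi> u \<in> M" "u \<in> \<Omega>" "RPD_ii f M (\<psi> u, u)" "ND f g (\<psi> u, u)"
        using that U \<psi> N nd by (auto simp: V_def)
      from local[of \<alpha>, OF _ _ this] \<alpha>[OF \<alpha>_in]
      show "PG f g \<alpha> (\<psi> u, u) = \<psi> u" "PG f g \<alpha> differentiable (at (\<psi> u, u))"
        "\<exists>q. 0 \<le> q \<and> q < 1 \<and> (\<forall>v. norm (D_x (PG f g \<alpha>) (\<psi> u, u) (tproj M (\<psi> u) v)) \<le> q * norm v)"
        by blast+
    qed
    have "bij (\<lambda>v. v - D_x (PG f g \<alpha>) (\<psi> u, u) (tproj M (\<psi> u) v))
        \<and> (\<psi> has_derivative inv (\<lambda>v. v - D_x (PG f g \<alpha>) (\<psi> u, u) (tproj M (\<psi> u) v))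
              \<circ> D_u (PG f g \<alpha>) (\<psi> u, u)) (at u)" if u: "u \<in> V" for u
    proof -
      let ?A = "PG f g \<alpha>"
      let ?F = "\<lambda>v. v - D_x ?A (\<psi> u, u) (tproj M (\<psi> u) v)"
      have uU: "u \<in> U" and \<psi>uM: "\<psi> u \<in> M" using u V(3) \<psi>(2) by auto
      obtain q where q: "q < 1" "\<And>v. norm (D_x ?A (\<psi> u, u) (tproj M (\<psi> u) v)) \<le> q * norm v"
        using contr[OF u] by blast
      have "linear (\<lambda>v. D_x ?A (\<psi> u, u) (tproj M (\<psi> u) v))"
        using linear_compose[OF tproj_properties(1)[OF assms(1) \<psi>uM] linear_D_x[OF diff[OF u]]]
        by (simp add: o_def)
      then have bij: "bij ?F" using q by (rule bij_diff_contraction)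
      obtain \<psi>' where \<psi>': "(\<psi> has_derivative \<psi>') (at u)"
        using \<psi>(1) uU unfolding C1_on_def by blast
      obtain A' where A': "(?A has_derivative A') (at (\<psi> u, u))"
        using diff[OF u] unfolding differentiable_def by blast
      have "((\<lambda>w. (\<psi> w, w)) has_derivative (\<lambda>h. (\<psi>' h, h))) (at u)"
        by (intro has_derivative_Pair \<psi>' has_derivative_ident)
      from has_derivative_compose[OF this A']
      have "((\<lambda>w. ?A (\<psi> w, w)) has_derivative (\<lambda>h. A' (\<psi>' h, h))) (at u)" .
      then have "(\<psi> has_derivative (\<lambda>h. A' (\<psi>' h, h))) (at u)"
        by (rule has_derivative_transform_within_open[OF _ V(1) u]) (rule fix_point)
      then have \<psi>'_eq: "\<psi>' = (\<lambda>h. A' (\<psi>' h, h))" by (rule has_derivative_unique[OF \<psi>'])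
      \<comment> \<open>Differentiating the fixed point equation gives
        \<open>\<psi>' h = A' (\<psi>' h, 0) + A' (0, h)\<close>. Since \<open>\<psi>' h\<close> is
        tangent to \<open>M\<close>, the projection may be inserted in the first term.\<close>
      have "?F (\<psi>' h) = D_u ?A (\<psi> u, u) h" for h
      proof -
        have "tproj M (\<psi> u) (\<psi>' h) = \<psi>' h"
          by (intro tproj_properties(2)[OF assms(1) \<psi>uM]
              C1_on_derivative_in_tangent_space[OF U(1) uU \<psi>(1,2) \<psi>'])
        moreover have "A' (\<psi>' h, h) = A' (\<psi>' h, 0) + A' (0, h)"
          using linear_add[OF has_derivative_linear[OF A'], of "(\<psi>' h, 0)" "(0, h)"] by simp
        moreover have "\<psi>' h = A' (\<psi>' h, h)" using \<psi>'_eq by metis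
        ultimately have "\<psi>' h - A' (\<psi>' h, 0) = A' (0, h)" by (metis add_diff_cancel_left')
        with \<open>tproj M (\<psi> u) (\<psi>' h) = \<psi>' h\<close> show ?thesis
          unfolding partial_derivatives[OF A'] by simp
      qed
      then have "inv ?F \<circ> D_u ?A (\<psi> u, u) = \<psi>'"
        using bij by (auto simp: fun_eq_iff bij_is_inj inv_f_eq)
      with bij \<psi>' show ?thesis by simp
    qed
    with V fix_point diff show ?thesis by (intro exI[of _ V]) auto
  qed
  show ?thesis using part1 part2 by blast
qed

end
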